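(* Let $\Omega\subset\mathbb{R}^2$ be a bounded, smooth and simply connected domain. Suppose that $\psi\in C^1(\overline{\Omega})$ and that $\psi$ has $N$ local maximal points on $\partial\Omega$. Let $u$ be a non-constant solution of the boundary value problem $$\sum_{i,j=1}^{2}a_{ij}(\nabla u)\frac{\partial^2 u}{\partial x_i\partial x_j}=0\ \text{ in }\Omega,\qquad u=\psi\ \text{ on }\partial\Omega.$$ Then $u$ has finitely many interior critical points $x_1,\dots,x_k$ in $\Omega$, and $$\sum_{i=1}^{k}m_i+1\le N,$$ where $m_1,\dots,m_k$ are the multiplicities of the critical points $x_1,\dots,x_k$ respectively.
   Context: The coefficients $a_{ij}$ are smooth functions of $\nabla u$ and the operator $L$, $Lu=\sum_{i,j=1}^2 a_{ij}(\nabla u)u_{x_ix_j}$, is uniformly elliptic in $\Omega$ (there are constants $0<\lambda\le\Lambda$ with $\lambda|\xi|^2\le\sum_{i,j}a_{ij}(\nabla u(x))\xi_i\xi_j\le\Lambda|\xi|^2$ for all $x\in\Omega$, $\xi\in\mathbb{R}^2$). "Solution" means a classical solution attaining its boundary values continuously. Local maximal points on $\partial\Omega$ are local maximum points of the restriction $\psi|_{\partial\Omega}$. An interior critical point is a point $x_0\in\Omega$ with $\nabla u(x_0)=0$; its multiplicity is the integer $m\ge1$ such that, in a neighborhood of $x_0$, the level set $\{x\in\Omega:u(x)=u(x_0)\}$ consists of $m+1$ simple arcs intersecting at $x_0$ (as given by the Hartman–Wintner theorem). An empty sum is $0$. *)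

theory Defs
  imports "HOL-Analysis.Analysis"
begin

definition partial_deriv :: "2 \<Rightarrow> (real^2 \<Rightarrow> real) \<Rightarrow> real^2 \<Rightarrow> real" where
  "partial_deriv i f x = frechet_derivative f (at x) (axis i 1)"

definition grad :: "(real^2 \<Rightarrow> real) \<Rightarrow> real^2 \<Rightarrow> real^2" where
  "grad f x = (\<chi> i. partial_deriv i f x)"

text \<open>Intended for open \<open>S\<close>. Differentiability is required explicitly because
  \<^const>\<open>frechet_derivative\<close> is unspecified at points of non-differentiability.\<close>

fun Ck_on :: "nat \<Rightarrow> (real^2 \<Rightarrow> real) \<Rightarrow> (real^2) set \<Rightarrow> bool" where
  "Ck_on 0 f S \<longleftrightarrow> continuous_on S f"
| "Ck_on (Suc k) f S \<longleftrightarrow>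
     (\<forall>x\<in>S. f differentiable (at x)) \<and> (\<forall>i. Ck_on k (partial_deriv i f) S)"

definition smooth_fun_on :: "(real^2 \<Rightarrow> real) \<Rightarrow> (real^2) set \<Rightarrow> bool" where
  "smooth_fun_on f S \<longleftrightarrow> (\<forall>k. Ck_on k f S)"

text \<open>Membership in \<open>C\<^sup>1\<close> of the closure of the open set \<open>\<Omega>\<close>: the function and its first
  derivatives in \<open>\<Omega>\<close> extend continuously up to the boundary.\<close>

definition C1_closure :: "(real^2 \<Rightarrow> real) \<Rightarrow> (real^2) set \<Rightarrow> bool" where
  "C1_closure f \<Omega> \<longleftrightarrow>
     Ck_on 1 f \<Omega> \<and> continuous_on (closure \<Omega>) f \<and>
     (\<forall>i. \<exists>g. continuous_on (closure \<Omega>) g \<and> (\<forall>x\<in>\<Omega>. g x = partial_deriv i f x))"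

text \<open>Near each boundary point the set is the strict sublevel set of a smooth local defining
  function without critical points; in particular it lies on one side of its boundary.\<close>

definition smooth_boundary :: "(real^2) set \<Rightarrow> bool" where
  "smooth_boundary \<Omega> \<longleftrightarrow>
     (\<forall>p\<in>frontier \<Omega>. \<exists>V \<rho>. open V \<and> p \<in> V \<and> smooth_fun_on \<rho> V \<and>
        (\<forall>x\<in>V. grad \<rho> x \<noteq> 0) \<and> \<Omega> \<inter> V = {x\<in>V. \<rho> x < 0})"

definition uniformly_elliptic ::
    "(2 \<Rightarrow> 2 \<Rightarrow> real^2 \<Rightarrow> real) \<Rightarrow> (real^2 \<Rightarrow> real) \<Rightarrow> (real^2) set \<Rightarrow> bool" where
  "uniformly_elliptic a u \<Omega> \<longleftrightarrow>
     (\<exists>lo hi. 0 < lo \<and> lo \<le> hi \<and>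
        (\<forall>x\<in>\<Omega>. \<forall>\<xi>::real^2.
           lo * (norm \<xi>)\<^sup>2 \<le> (\<Sum>i\<in>UNIV. \<Sum>j\<in>UNIV. a i j (grad u x) * \<xi> $ i * \<xi> $ j) \<and>
           (\<Sum>i\<in>UNIV. \<Sum>j\<in>UNIV. a i j (grad u x) * \<xi> $ i * \<xi> $ j) \<le> hi * (norm \<xi>)\<^sup>2))"

definition classical_solution ::
    "(2 \<Rightarrow> 2 \<Rightarrow> real^2 \<Rightarrow> real) \<Rightarrow> (real^2 \<Rightarrow> real) \<Rightarrow> (real^2) set \<Rightarrow> (real^2 \<Rightarrow> real) \<Rightarrow> bool" where
  "classical_solution a \<psi> \<Omega> u \<longleftrightarrow>
     Ck_on 2 u \<Omega> \<and> continuous_on (closure \<Omega>) u \<and>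
     (\<forall>x\<in>\<Omega>. (\<Sum>i\<in>UNIV. \<Sum>j\<in>UNIV.
        a i j (grad u x) * partial_deriv j (partial_deriv i u) x) = 0) \<and>
     (\<forall>x\<in>frontier \<Omega>. u x = \<psi> x)"

definition local_max_points :: "(real^2 \<Rightarrow> real) \<Rightarrow> (real^2) set \<Rightarrow> (real^2) set" where
  "local_max_points f S = {p\<in>S. \<forall>\<^sub>F q in at p within S. f q \<le> f p}"

definition interior_critical_points :: "(real^2 \<Rightarrow> real) \<Rightarrow> (real^2) set \<Rightarrow> (real^2) set" where
  "interior_critical_points u \<Omega> = {x\<in>\<Omega>. grad u x = 0}"

text \<open>The neighbourhood \<open>V\<close> need not be open, since \<^const>\<open>arc\<close> is the library's notion of a
  compact simple arc. Each arc passes through \<open>x\<^sub>0\<close> (it is not an endpoint), and distinct arcs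
  meet only there, so the level set has exactly \<open>2 (m + 1)\<close> branches at \<open>x\<^sub>0\<close>.\<close>

definition has_crit_multiplicity ::
    "(real^2 \<Rightarrow> real) \<Rightarrow> (real^2) set \<Rightarrow> real^2 \<Rightarrow> nat \<Rightarrow> bool" where
  "has_crit_multiplicity u \<Omega> x0 m \<longleftrightarrow> m \<ge> 1 \<and>
     (\<exists>V \<gamma>. x0 \<in> interior V \<and> V \<subseteq> \<Omega> \<and>
        {x\<in>V. u x = u x0} = (\<Union>i<m+1. path_image (\<gamma> i)) \<and>
        (\<forall>i<m+1. arc (\<gamma> i) \<and>
           x0 \<in> path_image (\<gamma> i) - {pathstart (\<gamma> i), pathfinish (\<gamma> i)}) \<and>
        (\<forall>i<m+1. \<forall>j<m+1. i \<noteq> j \<longrightarrow> path_image (\<gamma> i) \<inter> path_image (\<gamma> j) = {x0}))"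

definition crit_multiplicity :: "(real^2 \<Rightarrow> real) \<Rightarrow> (real^2) set \<Rightarrow> real^2 \<Rightarrow> nat" where
  "crit_multiplicity u \<Omega> x0 = (THE m. has_crit_multiplicity u \<Omega> x0 m)"

end

theory Submission
  imports Defs "HOL-Complex_Analysis.Complex_Analysis"
begin

text \<open>At a critical point \<open>x0\<close>, normalise \<open>a i j 0\<close> to the identity by a linear change of
  coordinates. Since the coefficients depend on \<open>\<nabla>u\<close> only, the complex gradient
  \<open>f = u\<^sub>x - \<i> u\<^sub>y\<close> then satisfies \<open>\<bar>\<partial>f/\<partial>cnj z\<bar> \<le> K \<bar>f\<bar>\<close>. On a disc of radius \<open>\<rho>\<close>,
  \<open>f / z ^ k\<close> differs from its Cauchy integral by \<open>O(\<rho>)\<close> times its supremum, as long as it is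
  bounded; letting \<open>k\<close> grow, either \<open>f\<close> vanishes near \<open>0\<close> or \<open>f / z ^ m\<close> has a nonzero limit.
  The first case is excluded as \<open>u\<close> is not constant, so near \<open>x0\<close> the function \<open>u - u x0\<close> looks,
  together with its angular derivative, like a multiple of \<open>r ^ (m + 1) cos ((m + 1) \<theta>)\<close>, and
  its zero set consists of \<open>m + 1\<close> arcs.

  By the maximum principle and the Jordan curve theorem, the \<open>m + 1\<close> positive sectors at \<open>x0\<close>
  cannot be joined within \<open>{u \<ge> u x0} - {x0}\<close>: a closed curve through two of them would enclose a
  negative sector. Each of them reaches a local maximum of \<open>\<psi>\<close> on the boundary inside
  \<open>{u > u x0}\<close>. Merging the classes of local maxima reached from each critical point, in order of
  decreasing critical value, loses exactly \<open>m\<close> classes at a critical point of multiplicity \<open>m\<close>,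
  and at least one class survives.\<close>

section \<open>Cauchy integrals of almost holomorphic functions\<close>

text \<open>As \<open>u\<close> is only C^2, its complex gradient is merely C^1. The local theory
  rests on one estimate for Cauchy integrals, whose error is proportional to the radius with a
  constant independent of the power \<open>k\<close>. Division by \<open>z ^ k\<close> is singular
  at 0, so the estimates live on punctured discs.

  Sectors are separated in \<open>{u \<ge> u x0} - {x0}\<close> rather than in
  \<open>{u > u x0}\<close> because several critical points may share one critical value. When they
  are merged one after another, connecting paths may run through those merged before, at the same
  height; the weak inequality admits such paths, and removing \<open>x0\<close> alone suffices for
  the topological contradiction.

  Peaks lie on the boundary, outside \<open>\<Omega>\<close>, so a peak is represented by an
  interior point close to it; this rests on local path-connectedness of \<open>\<Omega>\<close> at
  its boundary. Finiteness of the critical set comes after the inequality, which is first proved for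
  every finite set of critical points.\<close>

lemma mean_value_bound_except_point:
  fixes f :: "real \<Rightarrow> 'a::real_inner"
  assumes cont: "continuous_on {a..b} f" and "a < c" "c < b"
    and der: "\<And>x. x \<in> {a<..<b} - {c} \<Longrightarrow> (f has_vector_derivative f' x) (at x)"
    and bound: "\<And>x. x \<in> {a<..<b} - {c} \<Longrightarrow> norm (f' x) \<le> M"
  shows "norm (f b - f a) \<le> M * (b - a)"
proof -
  have *: "norm (f y - f x) \<le> M * (y - x)"
    if "x < y" "{x..y} \<subseteq> {a..b}" "c \<notin> {x<..<y}" for x y
  proof -
    have sub: "{x<..<y} \<subseteq> {a<..<b} - {c}"
      using that by fastforce
    have "\<exists>z\<in>{x<..<y}. norm (f y - f x) \<le> norm ((y - x) *\<^sub>R f' z)"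
    proof (rule mvt_general)
      show "(f has_derivative (\<lambda>h. h *\<^sub>R f' z)) (at z)" if "x < z" "z < y" for z
        using der[OF subsetD[OF sub]] that unfolding has_vector_derivative_def by simp
    qed (use that continuous_on_subset[OF cont] in auto)
    then obtain z where z: "z \<in> {x<..<y}" "norm (f y - f x) \<le> norm ((y - x) *\<^sub>R f' z)"
      by blast
    note z(2)
    also have "norm ((y - x) *\<^sub>R f' z) \<le> (y - x) * M"
      using that bound[of z] z sub by (auto intro!: mult_left_mono)
    finally show ?thesis by (simp add: mult.commute)
  qed
  have "norm (f b - f a) \<le> norm (f b - f c) + norm (f c - f a)"
    using norm_triangle_ineq[of "f b - f c" "f c - f a"] by simp
  also have "\<dots> \<le> M * (b - c) + M * (c - a)"
    using *[of c b] *[of a c] assms by (intro add_mono) auto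
  finally show ?thesis by (simp add: algebra_simps)
qed

text \<open>The circle is contracted to \<open>\<zeta>\<close> along straight lines, and
  \<open>I s\<close> integrates \<open>h\<close> over the circle at stage \<open>s\<close> with the
  kernel \<open>\<gamma>' / (\<gamma> - \<zeta>)\<close>, which does not depend on \<open>s\<close>.
  So \<open>I 1\<close> is the Cauchy integral, \<open>I 0\<close> is
  \<open>2 * pi * \<i> * h \<zeta>\<close>, and up to an exact derivative in \<open>t\<close> the
  derivative of \<open>I\<close> involves only \<open>B\<close>.\<close>

lemma Cauchy_integral_dbar_bound:
  fixes h A B :: "complex \<Rightarrow> complex"
  assumes \<rho>: "0 < \<rho>" and \<zeta>: "\<zeta> \<in> ball 0 \<rho>" "\<zeta> \<noteq> 0"
    and U: "open U" "cball 0 \<rho> \<subseteq> U"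
    and der: "\<And>z. z \<in> U - {0} \<Longrightarrow> (h has_derivative (\<lambda>k. A z * k + B z * cnj k)) (at z)"
    and contA: "continuous_on (U - {0}) A" and contB: "continuous_on (U - {0}) B"
    and bd: "\<And>z. z \<in> cball 0 \<rho> - {0} \<Longrightarrow> norm (h z) \<le> G"
    and b: "\<And>z. z \<in> cball 0 \<rho> - {0} \<Longrightarrow> norm (B z) \<le> b"
  shows "norm (contour_integral (circlepath 0 \<rho>) (\<lambda>w. h w / (w - \<zeta>)) - 2 * pi * \<i> * h \<zeta>)
           \<le> 4 * pi * \<rho> * b"
proof -
  define \<gamma> where "\<gamma> = circlepath 0 \<rho>"
  define \<gamma>' where "\<gamma>' = (\<lambda>t::real. 2 * of_real pi * \<i> * \<rho> * exp (2 * of_real pi * \<i> * t))"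
  define P where "P = (\<lambda>(s::real) t. \<zeta> + s * (\<gamma> t - \<zeta>))"
  define q where "q = (\<lambda>t. \<gamma>' t / (\<gamma> t - \<zeta>))"
  define F where "F = (\<lambda>s t. h (P s t) * q t)"
  define I where "I = (\<lambda>s. integral {0..1} (F s))"
  \<comment> \<open>The only stage at which the contracted circle can meet the origin: there
    \<open>(1 - s) * norm \<zeta> = s * \<rho>\<close>.\<close>
  define s0 where "s0 = norm \<zeta> / (\<rho> + norm \<zeta>)"
  have s0: "0 < s0" "s0 < 1"
    using \<rho> \<zeta> by (auto simp: s0_def divide_simps add_pos_pos not_less add_eq_0_iff intro: add_nonneg_nonneg)
  have b0: "0 \<le> b"
    using order_trans[OF norm_ge_zero b[of \<zeta>]] \<zeta> by simp
  have n\<gamma>: "norm (\<gamma> t) = \<rho>" for t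
    using \<rho> by (simp add: \<gamma>_def circlepath norm_mult)
  have n\<gamma>': "norm (\<gamma>' t) = 2 * pi * \<rho>" for t
    using \<rho> by (simp add: \<gamma>'_def norm_mult)
  have d\<gamma>: "(\<gamma> has_vector_derivative \<gamma>' t) (at t within T)" for t T
    unfolding \<gamma>_def \<gamma>'_def using has_vector_derivative_circlepath[of 0 \<rho> t T] by simp
  have vd: "vector_derivative (circlepath 0 \<rho>) (at t) = \<gamma>' t" for t
    using vector_derivative_at[OF d\<gamma>[of t UNIV]] by (simp add: \<gamma>_def)
  have c\<gamma> [continuous_intros]: "continuous_on T \<gamma>" for T
    unfolding \<gamma>_def circlepath by (intro continuous_intros)
  have c\<gamma>' [continuous_intros]: "continuous_on T \<gamma>'" for T
    unfolding \<gamma>'_def by (intro continuous_intros)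
  have ne: "\<gamma> t \<noteq> \<zeta>" for t
    using n\<gamma>[of t] \<zeta> by auto
  have cq [continuous_intros]: "continuous_on T q" for T
    unfolding q_def using ne by (intro continuous_intros) auto
  have distz: "\<rho> - norm \<zeta> \<le> norm (\<gamma> t - \<zeta>)" for t
    using norm_triangle_ineq2[of "\<gamma> t" \<zeta>] n\<gamma>[of t] by simp
  have nq: "norm (q t) \<le> 2 * pi * \<rho> / (\<rho> - norm \<zeta>)" for t
    unfolding q_def norm_divide n\<gamma>' using distz[of t] \<rho> \<zeta>
    by (intro divide_left_mono) (auto intro!: mult_pos_pos)
  have Pc: "P s t \<in> cball 0 \<rho>" if "s \<in> {0..1}" for s t
  proof -
    have "P s t = (1 - s) *\<^sub>R \<zeta> + s *\<^sub>R \<gamma> t"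
      by (simp add: P_def algebra_simps scaleR_conv_of_real)
    then show ?thesis
      using convexD_alt[OF convex_cball[of 0 \<rho>], of \<zeta> "\<gamma> t" s] that \<zeta> n\<gamma>[of t] by simp
  qed
  have Pz: "s = s0" if "P s t = 0" "s \<in> {0..1}" for s t
  proof -
    have "(1 - s) *\<^sub>R \<zeta> = - (s *\<^sub>R \<gamma> t)"
      using that by (simp add: P_def algebra_simps scaleR_conv_of_real add_eq_0_iff)
    then have "norm ((1 - s) *\<^sub>R \<zeta>) = norm (s *\<^sub>R \<gamma> t)"
      by simp
    then have "(1 - s) * norm \<zeta> = s * \<rho>"
      using that n\<gamma>[of t] by simp
    then show ?thesis
      using \<rho> by (simp add: s0_def eq_divide_eq add_pos_nonneg[THEN less_imp_neq, symmetric] algebra_simps)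
  qed
  have cP [continuous_intros]: "continuous_on T (\<lambda>(s,t). P s t)" for T
    unfolding P_def split_beta
    by (intro continuous_intros continuous_on_compose2[OF c\<gamma>[of UNIV]]) auto
  have cP2 [continuous_intros]: "continuous_on T (P s)" for s T
    unfolding P_def by (intro continuous_intros)
  have ch: "continuous_on (U - {0}) h"
    by (rule has_derivative_continuous_on, rule has_derivative_at_withinI, rule der)
  have int1: "F s integrable_on {0..1}" if "s \<in> {0..1}" "s \<noteq> s0" for s
  proof (rule integrable_continuous_real)
    have "continuous_on {0..1} (\<lambda>t. h (P s t))"
      using Pc[OF that(1)] Pz[of s] that U
      by (intro continuous_on_compose2[OF ch cP2]) auto
    then show "continuous_on {0..1} (F s)"
      unfolding F_def by (intro continuous_intros)
  qed
  \<comment> \<open>\<open>F\<close> may sample \<open>h 0\<close>, on which nothing is assumed;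
    hence the maximum.\<close>
  define M where "M = max G (norm (h 0)) * (2 * pi * \<rho> / (\<rho> - norm \<zeta>))"
  have nF: "norm (F s t) \<le> M" if "s \<in> {0..1}" for s t
  proof -
    have "norm (h (P s t)) \<le> max G (norm (h 0))"
      using bd[of "P s t"] Pc[OF that, of t] by (cases "P s t = 0") auto
    then show ?thesis unfolding F_def M_def norm_mult
      using nq[of t] by (intro mult_mono) (auto simp: le_max_iff_disj)
  qed
  have neg: "finite {t \<in> {0..1}. P s t = 0}" if "s \<in> {0..1}" for s
  proof (cases "\<exists>t\<in>{0..1}. P s t = 0")
    case True
    then obtain t where t: "t \<in> {0..1}" "P s t = 0" by blast
    have "s = s0" using Pz t that by blast
    then have "s \<noteq> 0" using s0 by simp
    have sp: "simple_path \<gamma>"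
      using \<rho> by (simp add: \<gamma>_def simple_path_circlepath)
    have "{t \<in> {0..1}. P s t = 0} \<subseteq> {t, 0, 1}"
    proof clarsimp
      fix x :: real assume x: "P s x = 0" "0 \<le> x" "x \<le> 1" "x \<noteq> t" "x \<noteq> 0"
      have "P s x - P s t = s * (\<gamma> x - \<gamma> t)"
        by (simp add: P_def algebra_simps)
      then have "s * (\<gamma> x - \<gamma> t) = 0"
        using x t by simp
      then have "\<gamma> x = \<gamma> t" using \<open>s \<noteq> 0\<close> by simp
      moreover have "x \<in> {0..1}" using x by simp
      ultimately show "x = 1"
        using sp x t(1) unfolding simple_path_def loop_free_def by blast
    qed
    then show ?thesis by (meson finite.emptyI finite.insertI finite_subset)
  next
    case False
    then show ?thesis by (metis (mono_tags, lifting) Collect_empty_eq finite.emptyI)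
  qed
  \<comment> \<open>Dominated convergence. The limit circle meets 0, where \<open>h\<close> may be
    discontinuous, at finitely many parameters; there the integrands are replaced by 0.\<close>
  have DC: "F s integrable_on {0..1} \<and> (\<lambda>k. I (S k)) \<longlonglongrightarrow> I s"
    if S: "\<And>k. S k \<in> {0..1}" "\<And>k. F (S k) integrable_on {0..1}" "S \<longlonglongrightarrow> s" "s \<in> {0..1}" for S s
  proof -
    define T where "T = {t \<in> {0..1}. P s t = 0}"
    have T: "negligible T" unfolding T_def using neg[OF S(4)] by (rule negligible_finite)
    define f where "f = (\<lambda>k t. if t \<in> T then 0 else F (S k) t)"
    define g where "g = (\<lambda>t. if t \<in> T then 0 else F s t)"
    have fi: "f k integrable_on {0..1}" for k
      using integrable_spike[OF S(2)[of k] T, of "f k"] by (auto simp: f_def)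
    have le: "norm (f k x) \<le> max M 0" for k x
      using nF[OF S(1)[of k], of x] by (auto simp: f_def)
    have conv: "(\<lambda>k. f k x) \<longlonglongrightarrow> g x" if "x \<in> {0..1}" for x
    proof (cases "x \<in> T")
      case False
      then have PU: "P s x \<in> U - {0}" using that Pc[OF S(4), of x] U by (auto simp: T_def)
      have lim: "(\<lambda>k. P (S k) x) \<longlonglongrightarrow> P s x"
        unfolding P_def using S(3) by (intro tendsto_intros)
      have "isCont h (P s x)"
        using has_derivative_continuous[OF der[OF PU]] .
      from isCont_tendsto_compose[OF this lim]
      have "(\<lambda>k. h (P (S k) x)) \<longlonglongrightarrow> h (P s x)" .
      then show ?thesis using False unfolding f_def g_def F_def by (auto intro!: tendsto_intros)
    qed (auto simp: f_def g_def)
    have dc: "g integrable_on {0..1}" "(\<lambda>k. integral {0..1} (f k)) \<longlonglongrightarrow> integral {0..1} g"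
      using dominated_convergence[of f "{0..1}" "\<lambda>_. max M 0" g] fi le conv by auto
    have "integral {0..1} (f k) = I (S k)" for k
      unfolding I_def by (rule integral_spike[OF T]) (auto simp: f_def)
    moreover have "integral {0..1} g = I s"
      unfolding I_def by (rule integral_spike[OF T]) (auto simp: g_def)
    moreover have "F s integrable_on {0..1}"
      by (rule integrable_spike[OF dc(1) T]) (auto simp: g_def)
    ultimately show ?thesis using dc(2) by simp
  qed
  have int: "F s integrable_on {0..1}" if "s \<in> {0..1}" for s
  proof (cases "s = s0")
    case True
    \<comment> \<open>At the exceptional stage integrability is inherited from stages
      \<open>S k > s0\<close> tending to \<open>s0\<close>.\<close>
    define S where "S = (\<lambda>k. s0 + (1 - s0) / real (Suc k))"
    have "(\<lambda>k. (1 - s0) * inverse (real (Suc k))) \<longlonglongrightarrow> (1 - s0) * 0"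
      by (intro tendsto_intros LIMSEQ_inverse_real_of_nat)
    then have lim: "S \<longlonglongrightarrow> s0"
      unfolding S_def divide_inverse by (metis add.right_neutral mult_zero_right tendsto_add_const_iff)
    have Sk: "S k \<in> {0..1}" "S k \<noteq> s0" for k
    proof -
      have "(1 - s0) / real (Suc k) \<le> (1 - s0) / 1"
        using s0 by (intro divide_left_mono) auto
      moreover have "(1 - s0) / real (Suc k) > 0" using s0 by simp
      ultimately show "S k \<in> {0..1}" "S k \<noteq> s0" using s0 by (auto simp: S_def simp del: of_nat_Suc)
    qed
    show ?thesis using DC[OF _ _ lim] Sk int1 s0 True by auto
  qed (use int1 that in auto)
  have contI: "continuous_on {0..1} I"
    unfolding continuous_on_sequentially comp_def using DC int by blast
  define I' where "I' = (\<lambda>s. integral {0..1}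
      (\<lambda>t. (A (P s t) * (\<gamma> t - \<zeta>) + B (P s t) * cnj (\<gamma> t - \<zeta>)) * q t))"
  have derI: "(I has_vector_derivative I' s) (at s)" if s: "s \<in> {0<..<1} - {s0}" for s
  proof -
    \<comment> \<open>The Leibniz rule wants a convex set of stages; the side of \<open>s0\<close>
      that contains \<open>s\<close> keeps the circles away from the origin.\<close>
    define W where "W = (if s < s0 then {0<..<s0} else {s0<..<1})"
    have W: "open W" "convex W" "s \<in> W" "W \<subseteq> {0..1} - {s0}"
      using s s0 by (auto simp: W_def)
    have PW: "P x t \<in> U - {0}" if "x \<in> W" for x t
    proof -
      have "x \<in> {0..1}" "x \<noteq> s0" using W(4) that by blast+
      then show ?thesis using Pc[of x t] Pz[of x t] U by auto
    qed
    have cAB: "continuous_on (W \<times> cbox 0 1) (\<lambda>z. A (P (fst z) (snd z)))"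
              "continuous_on (W \<times> cbox 0 1) (\<lambda>z. B (P (fst z) (snd z)))"
      by (rule continuous_on_compose2[OF contA cP[unfolded split_beta]]
            continuous_on_compose2[OF contB cP[unfolded split_beta]]; use PW in auto)+
    have "((\<lambda>x. integral (cbox 0 1) (F x)) has_vector_derivative
            integral (cbox 0 1) (\<lambda>t. (A (P s t) * (\<gamma> t - \<zeta>) + B (P s t) * cnj (\<gamma> t - \<zeta>)) * q t)) (at s within W)"
    proof (rule leibniz_rule_vector_derivative[where U = W])
      fix x and t :: real assume x: "x \<in> W" "t \<in> cbox 0 1"
      have dP: "((\<lambda>x. P x t) has_derivative (\<lambda>k. k *\<^sub>R (\<gamma> t - \<zeta>))) (at x within W)"
        unfolding P_def by (auto intro!: derivative_eq_intros simp: scaleR_conv_of_real)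
      have "((\<lambda>x. h (P x t)) has_derivative
              (\<lambda>k. A (P x t) * (k *\<^sub>R (\<gamma> t - \<zeta>)) + B (P x t) * cnj (k *\<^sub>R (\<gamma> t - \<zeta>)))) (at x within W)"
        using has_derivative_compose[OF dP der[OF PW[OF x(1)]]] by simp
      from has_derivative_mult_left[OF this, of "q t"]
      show "((\<lambda>x. F x t) has_vector_derivative
          (A (P x t) * (\<gamma> t - \<zeta>) + B (P x t) * cnj (\<gamma> t - \<zeta>)) * q t) (at x within W)"
        unfolding F_def has_vector_derivative_def
        by (rule has_derivative_eq_rhs) (auto simp: scaleR_conv_of_real algebra_simps fun_eq_iff)
    next
      show "continuous_on (W \<times> cbox 0 1)
         (\<lambda>(x,t). (A (P x t) * (\<gamma> t - \<zeta>) + B (P x t) * cnj (\<gamma> t - \<zeta>)) * q t)"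
        unfolding split_beta
        by (intro continuous_intros cAB continuous_on_compose2[OF c\<gamma>[of UNIV]] continuous_on_compose2[OF cq[of UNIV]]) auto
    qed (use W int in auto)
    moreover have "at s within W = at s" using W(1,3) by (rule at_within_open[rotated])
    ultimately show ?thesis
      unfolding I_def[abs_def] I'_def cbox_interval by (simp only:)
  qed
  have bI: "norm (I' s) \<le> 4 * pi * \<rho> * b" if s: "s \<in> {0<..<1} - {s0}" for s
  proof -
    have PU: "P s t \<in> U - {0}" "P s t \<in> cball 0 \<rho> - {0}" for t
      using Pc[of s t] Pz[of s t] s U by auto
    have cAs [continuous_intros]: "continuous_on T (\<lambda>t. A (P s t))" "continuous_on T (\<lambda>t. B (P s t))" for T
      by (rule continuous_on_compose2[OF contA cP2] continuous_on_compose2[OF contB cP2]; use PU in auto)+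
    \<comment> \<open>Since \<open>(\<gamma> t - \<zeta>) * q t = \<gamma>' t\<close>, the integrand
      of \<open>I'\<close> is \<open>D + R\<close>, where \<open>D\<close> is the
      \<open>t\<close>-derivative of \<open>h (P s t) / s\<close> and integrates to 0 over the
      closed circle. Each of the two terms of \<open>R\<close> has norm at most
      \<open>b * 2 * pi * \<rho>\<close>.\<close>
    define R where "R = (\<lambda>t. B (P s t) * (cnj (\<gamma> t - \<zeta>) * q t - cnj (\<gamma>' t)))"
    define D where "D = (\<lambda>t. A (P s t) * \<gamma>' t + B (P s t) * cnj (\<gamma>' t))"
    have "(D has_integral ((1/s) *\<^sub>R h (P s 1) - (1/s) *\<^sub>R h (P s 0))) {0..1}"
    proof (rule fundamental_theorem_of_calculus)
      fix t :: real
      have dP: "((\<lambda>t. P s t) has_derivative (\<lambda>k. s *\<^sub>R (k *\<^sub>R \<gamma>' t))) (at t within {0..1})"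
        unfolding P_def using d\<gamma>[of t "{0..1}"] unfolding has_vector_derivative_def
        by (auto intro!: derivative_eq_intros simp: scaleR_conv_of_real)
      have "((\<lambda>t. h (P s t)) has_derivative
              (\<lambda>k. A (P s t) * (s *\<^sub>R (k *\<^sub>R \<gamma>' t)) + B (P s t) * cnj (s *\<^sub>R (k *\<^sub>R \<gamma>' t)))) (at t within {0..1})"
        using has_derivative_compose[OF dP der[OF PU(1)]] by simp
      from has_derivative_scaleR_right[OF this, of "1/s"]
      show "((\<lambda>t. (1/s) *\<^sub>R h (P s t)) has_vector_derivative D t) (at t within {0..1})"
        unfolding has_vector_derivative_def D_def
        by (rule has_derivative_eq_rhs) (use s in \<open>auto simp: scaleR_conv_of_real algebra_simps fun_eq_iff\<close>)
    qed simp
    moreover have "P s 1 = P s 0"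
      by (simp add: P_def \<gamma>_def circlepath)
    ultimately have D: "(D has_integral 0) {0..1}" by simp
    have cR: "continuous_on {0..1} R"
      unfolding R_def by (intro continuous_intros)
    have "(\<lambda>t. (A (P s t) * (\<gamma> t - \<zeta>) + B (P s t) * cnj (\<gamma> t - \<zeta>)) * q t) = (\<lambda>t. D t + R t)"
      using ne by (auto simp: D_def R_def q_def fun_eq_iff field_simps)
    moreover have "((\<lambda>t. D t + R t) has_integral (0 + integral {0..1} R)) {0..1}"
      by (intro has_integral_add D integrable_integral integrable_continuous_real cR)
    ultimately have I'R: "I' s = integral {0..1} R"
      unfolding I'_def by (simp add: integral_unique)
    have "norm (R t) \<le> 4 * pi * \<rho> * b" for t
    proof -
      have "norm (cnj (\<gamma> t - \<zeta>) * q t) = 2 * pi * \<rho>"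
        using ne[of t] by (simp add: q_def norm_mult norm_divide n\<gamma>' del: complex_cnj_diff)
      then have "norm (cnj (\<gamma> t - \<zeta>) * q t - cnj (\<gamma>' t)) \<le> 2 * pi * \<rho> + 2 * pi * \<rho>"
        using norm_triangle_ineq4[of "cnj (\<gamma> t - \<zeta>) * q t" "cnj (\<gamma>' t)"] n\<gamma>'[of t] by simp
      then have "norm (R t) \<le> b * (2 * pi * \<rho> + 2 * pi * \<rho>)"
        unfolding R_def norm_mult using b[OF PU(2)[of t]] b0 by (intro mult_mono) auto
      then show ?thesis by (simp add: algebra_simps)
    qed
    then show ?thesis
      unfolding I'R using integral_bound[OF _ cR, of "4 * pi * \<rho> * b"] by simp
  qed
  have "norm (I 1 - I 0) \<le> (4 * pi * \<rho> * b) * (1 - 0)"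
    by (rule mean_value_bound_except_point[OF contI s0]) (use derI bI in auto)
  moreover have "I 1 = contour_integral (circlepath 0 \<rho>) (\<lambda>w. h w / (w - \<zeta>))"
    unfolding contour_integral_integral I_def F_def P_def q_def
    by (intro integral_cong) (simp add: vd, simp add: \<gamma>_def)
  moreover have "I 0 = 2 * pi * \<i> * h \<zeta>"
  proof -
    have "I 0 = h \<zeta> * integral {0..1} q"
      unfolding I_def F_def P_def by simp
    moreover have "integral {0..1} q = contour_integral (circlepath 0 \<rho>) (\<lambda>w. 1 / (w - \<zeta>))"
      unfolding contour_integral_integral q_def
      by (intro integral_cong) (simp add: vd, simp add: \<gamma>_def)
    moreover have "contour_integral (circlepath 0 \<rho>) (\<lambda>w. 1 / (w - \<zeta>)) = 2 * pi * \<i>"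
      using Cauchy_integral_circlepath_simple[of "\<lambda>_. 1" 0 \<rho> \<zeta>] \<zeta>
      by (auto intro!: contour_integral_unique)
    ultimately show ?thesis by simp
  qed
  ultimately show ?thesis by simp
qed

text \<open>\<open>H\<close> is the Cauchy integral of \<open>h\<close> over the boundary circle.
  The last estimate sees \<open>h\<close> on that circle only; for \<open>f / z ^ k\<close> this
  avoids the large values that the division may create inside.\<close>

lemma near_holomorphic:
  fixes h A B :: "complex \<Rightarrow> complex"
  assumes \<rho>: "0 < \<rho>"
    and U: "open U" "cball 0 \<rho> \<subseteq> U"
    and der: "\<And>z. z \<in> U - {0} \<Longrightarrow> (h has_derivative (\<lambda>k. A z * k + B z * cnj k)) (at z)"
    and contA: "continuous_on (U - {0}) A" and contB: "continuous_on (U - {0}) B"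
    and bd: "\<And>z. z \<in> cball 0 \<rho> - {0} \<Longrightarrow> norm (h z) \<le> G"
    and b: "\<And>z. z \<in> cball 0 \<rho> - {0} \<Longrightarrow> norm (B z) \<le> b"
  obtains H where "H holomorphic_on ball 0 \<rho>"
    and "\<And>z. z \<in> ball 0 \<rho> - {0} \<Longrightarrow> norm (h z - H z) \<le> 2 * \<rho> * b"
    and "\<And>z M. \<lbrakk>z \<in> ball 0 \<rho>; \<forall>w. norm w = \<rho> \<longrightarrow> norm (h w) \<le> M\<rbrakk> \<Longrightarrow>
           norm (H z) \<le> \<rho> * M / (\<rho> - norm z)"
proof -
  define C where "C = (\<lambda>z. contour_integral (circlepath 0 \<rho>) (\<lambda>w. h w / (w - z)))"
  define H where "H = (\<lambda>z. C z / (2 * pi * \<i>))"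
  have pi: "path_image (circlepath 0 \<rho>) = sphere 0 \<rho>" using \<rho> by simp
  have ch: "continuous_on (path_image (circlepath 0 \<rho>)) h"
  proof -
    have "continuous_on (U - {0}) h"
      by (rule has_derivative_continuous_on, rule has_derivative_at_withinI, rule der)
    then show ?thesis using U \<rho> unfolding pi by (auto elim!: continuous_on_subset)
  qed
  have int: "((\<lambda>w. h w / (w - z)) has_contour_integral C z) (circlepath 0 \<rho>)" if "z \<in> ball 0 \<rho>" for z
    unfolding C_def
  proof (rule has_contour_integral_integral, rule contour_integrable_continuous_circlepath)
    show "continuous_on (path_image (circlepath 0 \<rho>)) (\<lambda>w. h w / (w - z))"
      using that \<rho> by (intro continuous_intros ch) auto
  qed
  have holC: "C holomorphic_on ball 0 \<rho>"
    unfolding holomorphic_on_open[OF open_ball]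
  proof
    fix z :: complex assume z: "z \<in> ball 0 \<rho>"
    have "((\<lambda>u. h u / (u - w)^1) has_contour_integral C w) (circlepath 0 \<rho>)" if "w \<in> ball 0 \<rho>" for w
      using int[OF that] by simp
    from Cauchy_next_derivative_circlepath(2)[OF ch this _ z]
    show "\<exists>f'. (C has_field_derivative f') (at z)"
      by auto
  qed
  show ?thesis
  proof
    show "H holomorphic_on ball 0 \<rho>"
      unfolding H_def by (intro holomorphic_intros holC) auto
    show "norm (h z - H z) \<le> 2 * \<rho> * b" if z: "z \<in> ball 0 \<rho> - {0}" for z
    proof -
      have "norm (C z - 2 * pi * \<i> * h z) \<le> 4 * pi * \<rho> * b"
        unfolding C_def using z by (intro Cauchy_integral_dbar_bound[OF \<rho> _ _ U der contA contB bd b]) auto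
      moreover have "C z - 2 * pi * \<i> * h z = - (2 * pi * \<i>) * (h z - H z)"
        by (simp add: H_def algebra_simps)
      then have "norm (C z - 2 * pi * \<i> * h z) = 2 * pi * norm (h z - H z)"
        by (simp add: norm_mult)
      ultimately show ?thesis by (simp add: mult.assoc)
    qed
    show "norm (H z) \<le> \<rho> * M / (\<rho> - norm z)"
      if z: "z \<in> ball 0 \<rho>" and M: "\<forall>w. norm w = \<rho> \<longrightarrow> norm (h w) \<le> M" for z M
    proof -
      have M0: "0 \<le> M"
        using M[rule_format, of "of_real \<rho>"] \<rho> order_trans[OF norm_ge_zero] by auto
      have "norm (C z) \<le> M / (\<rho> - norm z) * (2 * pi * \<rho>)"
      proof (rule has_contour_integral_bound_circlepath[OF int[OF z]])
        fix x :: complex assume x: "norm (x - 0) = \<rho>"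
        have "\<rho> - norm z \<le> norm (x - z)"
          using norm_triangle_ineq2[of x z] x by simp
        then show "norm (h x / (x - z)) \<le> M / (\<rho> - norm z)"
          unfolding norm_divide using M[rule_format, of x] x z M0 by (intro frac_le) auto
      qed (use \<rho> M0 z in auto)
      then show ?thesis
        by (simp add: H_def norm_divide norm_mult field_simps)
    qed
  qed
qed

lemma Schwarz_ball:
  assumes H: "H holomorphic_on ball 0 r" and r: "0 < r"
    and M: "\<And>z. z \<in> ball 0 r \<Longrightarrow> norm (H z - H 0) \<le> M" and z: "z \<in> ball 0 r"
  shows "norm (H z - H 0) \<le> M * norm z / r"
proof -
  have M0: "0 \<le> M" using M[of 0] r by simp
  \<comment> \<open>The Schwarz lemma asks for values strictly inside the unit disc, so the scaling
    uses \<open>M + e\<close>; this also covers \<open>M = 0\<close>.\<close>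
  have le: "norm (H z - H 0) \<le> (M + e) * (norm z / r)" if "e > 0" for e
  proof -
    define \<phi> where "\<phi> = (\<lambda>w::complex. (H (r * w) - H 0) / (M + e))"
    have img: "(\<lambda>w::complex. r * w) ` ball 0 1 \<subseteq> ball 0 r"
      using r by (auto simp: norm_mult)
    have "(\<lambda>w::complex. H (r * w)) holomorphic_on ball 0 1"
      using holomorphic_on_compose_gen[OF _ H, of "\<lambda>w. r * w" "ball 0 1"] img
      by (auto simp: comp_def intro!: holomorphic_intros)
    then have "\<phi> holomorphic_on ball 0 1"
      unfolding \<phi>_def using M0 that by (intro holomorphic_intros) (auto simp flip: of_real_add)
    moreover have "\<phi> 0 = 0" by (simp add: \<phi>_def)
    moreover have "norm (\<phi> w) < 1" if "norm w < 1" for w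
    proof -
      have "norm (H (r * w) - H 0) \<le> M" using that r by (intro M) (auto simp: norm_mult)
      then show ?thesis using M0 \<open>e > 0\<close>
        by (auto simp: \<phi>_def norm_divide divide_less_eq simp flip: of_real_add)
    qed
    moreover have "norm (z / r) < 1" using z r by (simp add: norm_divide)
    ultimately have "norm (\<phi> (z / r)) \<le> norm (z / r)" by (rule Schwarz_Lemma)
    then show ?thesis using M0 that r
      by (simp add: \<phi>_def norm_divide field_simps flip: of_real_add)
  qed
  have "norm (H z - H 0) \<le> M * (norm z / r)"
  proof (rule field_le_epsilon)
    fix e :: real assume "e > 0"
    have "norm z / r \<le> 1" using z r by simp
    then have "(M + e) * (norm z / r) \<le> M * (norm z / r) + e * 1"
      using \<open>e > 0\<close> unfolding distrib_right by (intro add_left_mono mult_left_mono) auto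
    then show "norm (H z - H 0) \<le> M * (norm z / r) + e" using le[OF \<open>e > 0\<close>] by simp
  qed
  then show ?thesis by simp
qed

section \<open>Zeros of functions that dominate their antiholomorphic derivative\<close>

lemma norm_quotient_power_le_iff:
  fixes w z :: complex
  assumes "z \<noteq> 0"
  shows "norm (w / z ^ k) \<le> C \<longleftrightarrow> norm w \<le> C * norm z ^ k"
  using assms by (simp add: norm_divide norm_power pos_divide_le_eq)

text \<open>\<open>A\<close> and \<open>B\<close> are the Wirtinger derivatives of \<open>f\<close>.
  Functions with this inequality have zeros like those of holomorphic functions (the similarity
  principle of Bers and Vekua).\<close>

locale dbar_inequality =
  fixes f A B :: "complex \<Rightarrow> complex" and R K :: real
  assumes R: "0 < R" and K: "0 \<le> K"
    and der: "z \<in> ball 0 R \<Longrightarrow> (f has_derivative (\<lambda>k. A z * k + B z * cnj k)) (at z)"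
    and contA: "continuous_on (ball 0 R) A" and contB: "continuous_on (ball 0 R) B"
    and ineq: "z \<in> ball 0 R \<Longrightarrow> norm (B z) \<le> K * norm (f z)"
begin

text \<open>Off the origin \<open>z ^ k\<close> is holomorphic and nonzero, so the quotient has
  antiholomorphic derivative \<open>B / z ^ k\<close> and satisfies the inequality with the same
  \<open>K\<close> for every \<open>k\<close>.\<close>

lemma quotient_near_holomorphic:
  assumes \<rho>: "0 < \<rho>" "\<rho> < R"
    and G: "\<And>z. z \<in> cball 0 \<rho> - {0} \<Longrightarrow> norm (f z / z ^ k) \<le> G"
  obtains H where "H holomorphic_on ball 0 \<rho>"
    and "\<And>z. z \<in> ball 0 \<rho> - {0} \<Longrightarrow> norm (f z / z ^ k - H z) \<le> 2 * \<rho> * (K * G)"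
    and "\<And>z M. \<lbrakk>z \<in> ball 0 \<rho>; \<forall>w. norm w = \<rho> \<longrightarrow> norm (f w / w ^ k) \<le> M\<rbrakk> \<Longrightarrow>
           norm (H z) \<le> \<rho> * M / (\<rho> - norm z)"
proof (rule near_holomorphic)
  show "0 < \<rho>" by fact
  show "open (ball 0 R :: complex set)" "cball 0 \<rho> \<subseteq> (ball 0 R :: complex set)"
    using \<rho> by auto
  show "((\<lambda>z. f z / z ^ k) has_derivative
          (\<lambda>h. (A z / z ^ k - k * f z / z ^ Suc k) * h + B z / z ^ k * cnj h)) (at z)"
    if "z \<in> ball 0 R - {0}" for z
  proof -
    have pow: "((\<lambda>z. inverse (z ^ k)) has_field_derivative - (k / z ^ Suc k)) (at z)"
    proof (cases k)
      case (Suc n)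
      have eq: "(1 + of_nat n) * z ^ n / (z * z ^ n) ^ 2 = (1 + of_nat n) / (z * (z * z ^ n))"
        using that by (simp add: divide_simps power2_eq_square)
      show ?thesis
        by (rule derivative_eq_intros refl)+ (use that Suc eq in \<open>auto simp: field_simps power2_eq_square\<close>)
    qed auto
    have "((\<lambda>z. f z * inverse (z ^ k)) has_derivative
       (\<lambda>h. f z * (- (k / z ^ Suc k) * h) + (A z * h + B z * cnj h) * inverse (z ^ k))) (at z)"
      using that by (intro has_derivative_mult der pow[unfolded has_field_derivative_def]) auto
    then show ?thesis
      unfolding divide_inverse by (rule has_derivative_eq_rhs) (simp add: fun_eq_iff algebra_simps)
  qed
  have cf: "continuous_on (ball 0 R) f"
    by (rule has_derivative_continuous_on, rule has_derivative_at_withinI, rule der)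
  note cs = continuous_on_subset[OF contA] continuous_on_subset[OF contB] continuous_on_subset[OF cf]
  show "continuous_on (ball 0 R - {0}) (\<lambda>z. A z / z ^ k - k * f z / z ^ Suc k)"
       "continuous_on (ball 0 R - {0}) (\<lambda>z. B z / z ^ k)"
    by (intro continuous_intros cs; auto)+
  show "norm (f z / z ^ k) \<le> G" if "z \<in> cball 0 \<rho> - {0}" for z
    by (rule G[OF that])
  show "norm (B z / z ^ k) \<le> K * G" if "z \<in> cball 0 \<rho> - {0}" for z
  proof -
    have "norm (B z / z ^ k) \<le> K * norm (f z) / norm (z ^ k)"
      unfolding norm_divide using that \<rho> by (intro divide_right_mono ineq) auto
    also have "\<dots> = K * norm (f z / z ^ k)" by (simp add: norm_divide)
    also have "\<dots> \<le> K * G" by (intro mult_left_mono G that K)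
    finally show ?thesis .
  qed
qed blast

text \<open>Absorption in the style of Carleman: with \<open>G\<close> the supremum of
  \<open>norm (f / z ^ k)\<close>, flatness makes \<open>G\<close> finite and
  \<open>4 * K * \<rho> \<le> 1\<close> makes the error at most \<open>G / 2\<close>, which moves to
  the left-hand side. The resulting bound on \<open>G\<close> grows like
  \<open>(2 / \<rho>) ^ k\<close>, which \<open>norm z ^ k\<close> beats for
  \<open>norm z < \<rho> / 2\<close>.\<close>

lemma zero_if_flat:
  assumes \<rho>: "0 < \<rho>" "\<rho> < R" "4 * K * \<rho> \<le> 1"
    and flat: "\<And>k. \<exists>C. \<forall>z\<in>cball 0 \<rho>. norm (f z) \<le> C * norm z ^ k"
    and z: "z \<in> ball 0 (\<rho>/2)"
  shows "f z = 0"
proof (cases "z = 0")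
  case True
  obtain C where "\<forall>z\<in>cball 0 \<rho>. norm (f z) \<le> C * norm z ^ 1" using flat[of 1] by blast
  then have "norm (f 0) \<le> 0" using \<rho> by (auto dest!: bspec[of _ _ 0])
  then show ?thesis using True by simp
next
  case False
  have cf: "continuous_on (cball 0 \<rho>) f"
    by (rule has_derivative_continuous_on, rule has_derivative_at_withinI, rule der) (use \<rho> in auto)
  have "compact (f ` cball 0 \<rho>)" using cf by (intro compact_continuous_image) auto
  then have "bounded (f ` cball 0 \<rho>)" by (rule compact_imp_bounded)
  then obtain F where "\<forall>y\<in>f ` cball 0 \<rho>. norm y \<le> F"
    unfolding bounded_iff ..
  then have F: "\<And>w. w \<in> cball 0 \<rho> \<Longrightarrow> norm (f w) \<le> F" by simp
  have F0: "0 \<le> F" using F[of 0] \<rho> order_trans[OF norm_ge_zero] by auto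
  have main: "norm (f z) \<le> 4 * F * (norm z / (\<rho>/2)) ^ k" for k
  proof -
    define X where "X = (\<lambda>w. norm (f w / w ^ k)) ` (cball 0 \<rho> - {0})"
    define G where "G = Sup X"
    obtain C where C: "\<And>w. w \<in> cball 0 \<rho> \<Longrightarrow> norm (f w) \<le> C * norm w ^ k"
      using flat[of k] by blast
    have "bdd_above X"
    proof (intro bdd_aboveI[of _ C])
      fix y assume "y \<in> X"
      then obtain w where "w \<noteq> 0" "w \<in> cball 0 \<rho>" "y = norm (f w / w ^ k)"
        unfolding X_def by blast
      then show "y \<le> C" using C[of w] norm_quotient_power_le_iff by metis
    qed
    then have G: "norm (f w / w ^ k) \<le> G" if "w \<in> cball 0 \<rho> - {0}" for w
      unfolding G_def X_def using that by (intro cSup_upper) auto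
    have "z \<in> cball 0 \<rho> - {0}" using z False \<rho> by simp
    then have "X \<noteq> {}" unfolding X_def by blast
    obtain H where H: "\<And>w. w \<in> ball 0 \<rho> - {0} \<Longrightarrow> norm (f w / w ^ k - H w) \<le> 2 * \<rho> * (K * G)"
      "\<And>w M. \<lbrakk>w \<in> ball 0 \<rho>; \<forall>w. norm w = \<rho> \<longrightarrow> norm (f w / w ^ k) \<le> M\<rbrakk> \<Longrightarrow>
           norm (H w) \<le> \<rho> * M / (\<rho> - norm w)"
    proof (rule quotient_near_holomorphic[OF \<rho>(1,2)])
      show "norm (f w / w ^ k) \<le> G" if "w \<in> cball 0 \<rho> - {0}" for w
        by (rule G[OF that])
    qed (rule that)
    have G0: "0 \<le> G" using G[of z] False z \<rho> order_trans[OF norm_ge_zero] by auto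
    \<comment> \<open>In the inner half disc \<open>H\<close> is controlled by \<open>f\<close> on
      the circle of radius \<open>\<rho>\<close>; in the outer annulus the division costs at most
      \<open>(2 / \<rho>) ^ k\<close>.\<close>
    have up: "norm (f w / w ^ k) \<le> max (2 * F / \<rho> ^ k + G / 2) (F * (2 / \<rho>) ^ k)"
      if w: "w \<in> cball 0 \<rho> - {0}" for w
    proof (cases "norm w \<le> \<rho>/2")
      case True
      then have wb: "w \<in> ball 0 \<rho> - {0}" using \<rho> w by auto
      have "norm (H w) \<le> \<rho> * (F / \<rho> ^ k) / (\<rho> - norm w)"
        using wb F \<rho> by (intro H(2)) (auto simp: norm_divide norm_power intro!: divide_right_mono)
      also have "\<dots> \<le> \<rho> * (F / \<rho> ^ k) / (\<rho> / 2)"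
        using True \<rho> F0 by (intro divide_left_mono) auto
      also have "\<dots> = 2 * F / \<rho> ^ k" using \<rho> by simp
      finally have "norm (H w) \<le> 2 * F / \<rho> ^ k" .
      moreover have "2 * \<rho> * (K * G) \<le> G / 2"
        using mult_right_mono[OF \<rho>(3) G0] by (simp add: mult_ac)
      moreover have "norm (f w / w ^ k) \<le> norm (f w / w ^ k - H w) + norm (H w)"
        using norm_triangle_ineq[of "f w / w ^ k - H w" "H w"] by simp
      ultimately have "norm (f w / w ^ k) \<le> 2 * F / \<rho> ^ k + G / 2"
        using H(1)[OF wb] by linarith
      then show ?thesis by simp
    next
      case False
      have "norm (f w / w ^ k) \<le> F / (\<rho>/2) ^ k"
        unfolding norm_divide norm_power using False F[of w] w \<rho> F0
        by (intro frac_le power_mono) auto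
      also have "\<dots> = F * (2 / \<rho>) ^ k" by (simp add: power_divide)
      finally show ?thesis by simp
    qed
    have "Sup X \<le> max (2 * F / \<rho> ^ k + G / 2) (F * (2 / \<rho>) ^ k)"
    proof (rule cSup_least[OF \<open>X \<noteq> {}\<close>])
      fix y assume "y \<in> X"
      then obtain w where "w \<in> cball 0 \<rho> - {0}" "y = norm (f w / w ^ k)"
        unfolding X_def by blast
      then show "y \<le> max (2 * F / \<rho> ^ k + G / 2) (F * (2 / \<rho>) ^ k)"
        using up[of w] by simp
    qed
    then have "G \<le> max (2 * F / \<rho> ^ k + G / 2) (F * (2 / \<rho>) ^ k)"
      by (simp only: G_def[symmetric])
    moreover have "2 * F / \<rho> ^ k \<le> 2 * F * (2 / \<rho>) ^ k"
    proof -
      have "1 / \<rho> ^ k \<le> (2 / \<rho>) ^ k"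
        using \<rho> by (simp add: power_divide divide_right_mono)
      then show ?thesis using mult_left_mono[of "1 / \<rho> ^ k" "(2 / \<rho>) ^ k" "2 * F"] F0 by simp
    qed
    moreover have "0 \<le> F * (2 / \<rho>) ^ k" using F0 \<rho> by simp
    ultimately have "G \<le> 4 * F * (2 / \<rho>) ^ k"
      by (auto simp: max_def mult.assoc split: if_splits)
    then have "norm (f z / z ^ k) \<le> 4 * F * (2 / \<rho>) ^ k"
      using G[of z] z False \<rho> by auto
    then have "norm (f z) \<le> 4 * F * (2 / \<rho>) ^ k * norm z ^ k"
      using False by (simp add: norm_quotient_power_le_iff)
    then show ?thesis by (simp add: power_divide power_mult_distrib mult_ac)
  qed
  have "(\<lambda>k. 4 * F * (norm z / (\<rho>/2)) ^ k) \<longlonglongrightarrow> 4 * F * 0"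
    using z \<rho> by (intro tendsto_intros LIMSEQ_power_zero) auto
  then have "norm (f z) \<le> 0"
    using main by (intro LIMSEQ_le_const[of _ 0]) auto
  then show ?thesis by simp
qed

text \<open>On each disc of radius \<open>r\<close> the quotient is within \<open>O(r)\<close> of a
  continuous function, which may change with \<open>r\<close>. Hence its oscillation at 0 vanishes,
  and completeness gives the limit.\<close>

lemma quotient_has_limit:
  assumes \<rho>: "0 < \<rho>" "\<rho> < R"
    and C: "\<And>z. z \<in> cball 0 \<rho> \<Longrightarrow> norm (f z) \<le> C * norm z ^ k"
  shows "\<exists>L. (\<lambda>z. f z / z ^ k) \<midarrow>0\<rightarrow> L"
proof -
  define g where "g = (\<lambda>z. f z / z ^ k)"
  have gC: "norm (g z) \<le> C" if "z \<in> cball 0 \<rho> - {0}" for z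
    using C[of z] that by (auto simp: g_def norm_quotient_power_le_iff)
  have C0: "0 \<le> C" using gC[of "of_real \<rho>"] \<rho> order_trans[OF norm_ge_zero] by auto
  have osc: "\<exists>d>0. \<forall>z w. z \<noteq> 0 \<and> w \<noteq> 0 \<and> norm z < d \<and> norm w < d \<longrightarrow> norm (g z - g w) < e"
    if e: "e > 0" for e
  proof -
    \<comment> \<open>Makes the approximation error less than \<open>e / 4\<close>, one of four such
      terms below; the summand 1 covers \<open>K * C = 0\<close>.\<close>
    define r where "r = min \<rho> (e / (8 * (K * C + 1)))"
    have r: "0 < r" "r \<le> \<rho>" "r < R" using \<rho> e K C0 by (auto simp: r_def add_nonneg_pos)
    have "r * (8 * (K * C + 1)) \<le> e"
    proof -
      have "0 < 8 * (K * C + 1)" using K C0 by (simp add: add_nonneg_pos)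
      moreover have "r \<le> e / (8 * (K * C + 1))" by (simp add: r_def)
      ultimately show ?thesis by (simp only: pos_le_divide_eq)
    qed
    then have rK: "2 * r * (K * C) < e / 4"
      using r(1) by (simp add: algebra_simps)
    obtain H where H: "H holomorphic_on ball 0 r"
      "\<And>z. z \<in> ball 0 r - {0} \<Longrightarrow> norm (g z - H z) \<le> 2 * r * (K * C)"
    proof (rule quotient_near_holomorphic[OF r(1,3)])
      show "norm (f z / z ^ k) \<le> C" if "z \<in> cball 0 r - {0}" for z
        using gC[of z] that r by (simp add: g_def)
    qed (use that g_def in auto)
    have "isCont H 0"
      using H(1) r(1) holomorphic_on_imp_continuous_on continuous_on_interior by fastforce
    then obtain d where d: "d > 0" "\<And>z. norm z < d \<Longrightarrow> norm (H z - H 0) < e / 4"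
      using e unfolding continuous_at_eps_delta dist_norm
      by (metis diff_zero zero_less_divide_iff zero_less_numeral)
    have "norm (g z - g w) < e" if zw: "z \<noteq> 0" "w \<noteq> 0" "norm z < min d r" "norm w < min d r" for z w
    proof -
      have "norm (g z - g w) = norm ((g z - H z) + (H z - H 0) - ((g w - H w) + (H w - H 0)))" by simp
      then have "norm (g z - g w) \<le> (norm (g z - H z) + norm (H z - H 0)) + (norm (g w - H w) + norm (H w - H 0))"
        using norm_triangle_ineq4[of "(g z - H z) + (H z - H 0)" "(g w - H w) + (H w - H 0)"]
          norm_triangle_ineq[of "g z - H z" "H z - H 0"] norm_triangle_ineq[of "g w - H w" "H w - H 0"]
        by linarith
      moreover have "norm (g z - H z) < e / 4" "norm (g w - H w) < e / 4"
        using H(2)[of z] H(2)[of w] zw rK by auto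
      ultimately show ?thesis using d(2)[of z] d(2)[of w] zw by auto
    qed
    then show ?thesis using d(1) r(1) by (intro exI[of _ "min d r"]) auto
  qed
  define x where "x = (\<lambda>n. complex_of_real (inverse (real (Suc n))))"
  have x0: "x n \<noteq> 0" for n by (simp add: x_def del: of_nat_Suc)
  have xl: "x \<longlonglongrightarrow> 0"
    unfolding x_def using tendsto_of_real[OF LIMSEQ_inverse_real_of_nat, where 'a = complex]
    by (simp only: of_real_0)
  have small: "\<exists>N. \<forall>n\<ge>N. norm (x n) < d" if "d > 0" for d
    using xl that unfolding LIMSEQ_def by (simp add: dist_norm)
  have "Cauchy (\<lambda>n. g (x n))"
    unfolding Cauchy_iff
  proof (intro allI impI)
    fix e :: real assume "e > 0"
    from osc[OF this] obtain d where "d > 0" and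
      d: "\<And>z w. z \<noteq> 0 \<Longrightarrow> w \<noteq> 0 \<Longrightarrow> norm z < d \<Longrightarrow> norm w < d \<Longrightarrow> norm (g z - g w) < e" by blast
    from small[OF this(1)] obtain N where "\<forall>n\<ge>N. norm (x n) < d" by blast
    then show "\<exists>M. \<forall>m\<ge>M. \<forall>n\<ge>M. norm (g (x m) - g (x n)) < e"
      using d x0 by (intro exI[of _ N]) auto
  qed
  then obtain L where L: "(\<lambda>n. g (x n)) \<longlonglongrightarrow> L"
    using Cauchy_convergent convergent_def by blast
  have "g \<midarrow>0\<rightarrow> L"
    unfolding LIM_eq
  proof (intro allI impI)
    fix e :: real assume "e > 0"
    then have "e / 2 > 0" by simp
    from osc[OF this] obtain d where "d > 0" and
      d: "\<And>z w. z \<noteq> 0 \<Longrightarrow> w \<noteq> 0 \<Longrightarrow> norm z < d \<Longrightarrow> norm w < d \<Longrightarrow> norm (g z - g w) < e/2" by blast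
    from small[OF this(1)] obtain N where N: "\<And>n. n \<ge> N \<Longrightarrow> norm (x n) < d" by blast
    have "norm (g z - L) < e" if "z \<noteq> 0" "norm z < d" for z
    proof -
      have "(\<lambda>n. norm (g z - g (x n))) \<longlonglongrightarrow> norm (g z - L)"
        by (intro tendsto_intros L)
      moreover have "\<exists>N. \<forall>n\<ge>N. norm (g z - g (x n)) \<le> e / 2"
        using d[OF that(1) x0 that(2)] N by (intro exI[of _ N]) (auto intro: less_imp_le)
      ultimately have "norm (g z - L) \<le> e / 2" by (rule LIMSEQ_le_const2)
      then show ?thesis using \<open>e > 0\<close> by simp
    qed
    then show "\<exists>s>0. \<forall>x. x \<noteq> 0 \<and> norm (x - 0) < s \<longrightarrow> norm (g x - L) < e"
      using \<open>d > 0\<close> by (intro exI[of _ d]) auto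
  qed
  then show ?thesis unfolding g_def by blast
qed

text \<open>Halving the radius halves \<open>sup \<bar>f z / z ^ k\<bar>\<close> up to a factor \<open>1 + O(r)\<close>, by the Schwarz
  lemma; the weights \<open>exp (- 24 K r)\<close> absorb the product of these factors.\<close>

lemma order_increases:
  assumes \<rho>: "0 < \<rho>" "\<rho> < R"
    and C: "\<And>z. z \<in> cball 0 \<rho> \<Longrightarrow> norm (f z) \<le> C * norm z ^ k"
    and L: "(\<lambda>z. f z / z ^ k) \<midarrow>0\<rightarrow> 0"
  shows "\<exists>C'. \<forall>z\<in>cball 0 \<rho>. norm (f z) \<le> C' * norm z ^ Suc k"
proof -
  define g where "g = (\<lambda>z. f z / z ^ k)"
  have gC: "norm (g z) \<le> C" if "z \<in> cball 0 \<rho> - {0}" for z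
    using C[of z] that by (auto simp: g_def norm_quotient_power_le_iff)
  have C0: "0 \<le> C" using gC[of "of_real \<rho>"] \<rho> order_trans[OF norm_ge_zero] by auto
  \<comment> \<open>With \<open>E = 2 * r * (K * G)\<close>, also \<open>norm (H 0) \<le> E\<close>
    because \<open>g\<close> tends to 0. The Schwarz lemma halves \<open>G + 2 * E\<close>, and two
    more errors give \<open>G / 2 + 3 * E\<close>, that is
    \<open>(1 + 12 * K * r) * G / 2\<close>.\<close>
  have halve: "norm (g z) \<le> exp (12 * K * r) * G / 2"
    if r: "0 < r" "r \<le> \<rho>" and G: "\<And>z. z \<in> cball 0 r - {0} \<Longrightarrow> norm (g z) \<le> G"
      and z: "z \<in> cball 0 (r/2) - {0}" for r G z
  proof -
    have G0: "0 \<le> G" using G[of "of_real r"] r order_trans[OF norm_ge_zero] by auto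
    obtain H where H: "H holomorphic_on ball 0 r"
      "\<And>z. z \<in> ball 0 r - {0} \<Longrightarrow> norm (g z - H z) \<le> 2 * r * (K * G)"
    proof (rule quotient_near_holomorphic[OF r(1)])
      show "r < R" using r \<rho> by simp
      show "norm (f z / z ^ k) \<le> G" if "z \<in> cball 0 r - {0}" for z
        using G[OF that] by (simp add: g_def)
    qed (use that g_def in auto)
    define E where "E = 2 * r * (K * G)"
    have "isCont H 0"
      using H(1) r(1) holomorphic_on_imp_continuous_on continuous_on_interior by fastforce
    then have "(\<lambda>z. norm (g z - H z)) \<midarrow>0\<rightarrow> norm (0 - H 0)"
      using L unfolding g_def isCont_def by (intro tendsto_intros)
    moreover have "\<forall>\<^sub>F z in at 0. norm (g z - H z) \<le> E"
      unfolding eventually_at E_def using r(1) H(2) by (intro exI[of _ r]) auto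
    ultimately have H0: "norm (H 0) \<le> E"
      using tendsto_upperbound[of "\<lambda>z. norm (g z - H z)" "norm (0 - H 0)" "at 0" E] by simp
    have "norm (H w - H 0) \<le> G + 2 * E" if "w \<in> ball 0 r" for w
    proof (cases "w = 0")
      case False
      have "norm (H w - H 0) \<le> norm (g w) + norm (g w - H w) + norm (H 0)"
        using norm_triangle_ineq4[of "g w" "g w - H w"] norm_triangle_ineq4[of "H w" "H 0"] by simp
      then show ?thesis using H(2)[of w] G[of w] H0 that False E_def by auto
    qed (use r K G0 E_def in simp)
    then have "norm (H z - H 0) \<le> (G + 2 * E) * norm z / r"
      using z r by (intro Schwarz_ball H) auto
    also have "\<dots> \<le> (G + 2 * E) * (r/2) / r"
      using z r G0 K E_def by (intro divide_right_mono mult_left_mono) auto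
    finally have "norm (H z - H 0) \<le> (G + 2 * E) / 2" using r by simp
    moreover have "norm (g z) \<le> norm (g z - H z) + norm (H z - H 0) + norm (H 0)"
      using norm_triangle_ineq[of "g z - H z" "H z"] norm_triangle_ineq[of "H z - H 0" "H 0"] by simp
    moreover have "norm (g z - H z) \<le> E" using H(2)[of z] z r E_def by auto
    ultimately have "norm (g z) \<le> (1 + 12 * K * r) * G / 2"
      using H0 by (simp add: E_def algebra_simps)
    also have "\<dots> \<le> exp (12 * K * r) * G / 2"
      using G0 exp_ge_add_one_self[of "12 * K * r"] by (intro divide_right_mono mult_right_mono) auto
    finally show ?thesis .
  qed
  define S where "S = C * exp (24 * K * \<rho>) / \<rho>"
  have S0: "0 \<le> S" using C0 \<rho> by (simp add: S_def)
  define r where "r = (\<lambda>j::nat. \<rho> / 2 ^ j)"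
  have rpos: "0 < r j" for j using \<rho> by (simp add: r_def)
  have rle: "r j \<le> \<rho>" for j using \<rho> by (simp add: r_def field_simps)
  \<comment> \<open>24 is twice 12: a halving multiplies \<open>exp (- (24 * K * r))\<close> by
    \<open>exp (12 * K * r)\<close>, which is exactly the weight for \<open>r / 2\<close>.\<close>
  have ind: "\<forall>z\<in>cball 0 (r j) - {0}. norm (g z) \<le> S * exp (- (24 * K * r j)) * r j" for j
  proof (induction j)
    case 0
    have "S * exp (- (24 * K * r 0)) * r 0 = C"
      using \<rho> by (simp add: S_def r_def exp_minus)
    then show ?case using gC by (simp add: r_def)
  next
    case (Suc j)
    have half: "r j / 2 = r (Suc j)" by (simp add: r_def)
    have "exp (12 * K * r j) * (S * exp (- (24 * K * r j)) * r j) / 2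
        = S * exp (- (24 * K * r (Suc j))) * r (Suc j)"
    proof -
      have "exp (12 * K * r j) * exp (- (24 * K * r j)) = exp (- (24 * K * r (Suc j)))"
        by (simp add: flip: exp_add half)
      then show ?thesis by (simp add: half[symmetric] mult_ac)
    qed
    moreover have "norm (g z) \<le> exp (12 * K * r j) * (S * exp (- (24 * K * r j)) * r j) / 2"
      if "z \<in> cball 0 (r (Suc j)) - {0}" for z
      using Suc by (intro halve[OF rpos rle]) (use that half in auto)
    ultimately show ?case by (intro ballI) (simp only:)
  qed
  have bound: "norm (g z) \<le> 2 * S * norm z" if z: "z \<in> cball 0 \<rho> - {0}" for z
  proof -
    have "\<exists>j. r j < norm z"
    proof -
      obtain j where "(1/2) ^ j < norm z / \<rho>"
        using real_arch_pow_inv[of "norm z / \<rho>" "1/2"] z \<rho> by auto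
      then have "r j < norm z" using \<rho> by (simp add: r_def field_simps power_divide)
      then show ?thesis ..
    qed
    then have l: "r (LEAST j. r j < norm z) < norm z" by (rule LeastI_ex)
    \<comment> \<open>Dyadic bracket: \<open>r i < norm z\<close>, while the preceding radius
      \<open>2 * r i\<close> is at least \<open>norm z\<close>.\<close>
    define i where "i = (LEAST j. r j < norm z)"
    have "i \<noteq> 0"
    proof
      assume "i = 0"
      then have "r 0 < norm z" using l by (simp only: i_def[symmetric])
      then have "\<rho> < norm z" by (simp add: r_def)
      then show False using z by simp
    qed
    then obtain j where j: "i = Suc j" by (cases i) auto
    have "\<not> r j < norm z" using not_less_Least[of j "\<lambda>j. r j < norm z"] j i_def by simp
    then have "norm (g z) \<le> S * exp (- (24 * K * r j)) * r j"
      using ind[of j] z by auto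
    also have "\<dots> \<le> S * 1 * r j"
      using S0 K rpos[of j] by (intro mult_right_mono mult_left_mono) auto
    also have "r j = 2 * r i" by (simp add: j r_def)
    also have "S * 1 * (2 * r i) \<le> S * 1 * (2 * norm z)"
      using l S0 by (intro mult_left_mono) (auto simp: i_def)
    finally show ?thesis by simp
  qed
  have "norm (f z) \<le> 2 * S * norm z ^ Suc k" if "z \<in> cball 0 \<rho>" for z
  proof (cases "z = 0")
    case True
    have "(\<lambda>z. f z) \<midarrow>0\<rightarrow> f 0"
      using has_derivative_continuous[OF der[of 0]] R by (simp add: isCont_def)
    moreover have "(\<lambda>z. g z * z ^ k) \<midarrow>0\<rightarrow> 0 * 0 ^ k"
      using L unfolding g_def by (intro tendsto_intros)
    then have "(\<lambda>z. g z * z ^ k) \<midarrow>0\<rightarrow> 0" by (simp only: mult_zero_left)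
    then have "f \<midarrow>0\<rightarrow> 0"
      by (rule Lim_transform_eventually) (auto simp: g_def eventually_at intro!: exI[of _ 1])
    ultimately have "f 0 = 0" by (simp add: LIM_unique)
    then show ?thesis using True by simp
  next
    case False
    then have "norm (f z) \<le> 2 * S * norm z * norm z ^ k"
      using bound[of z] that by (simp add: g_def norm_quotient_power_le_iff)
    then show ?thesis by (simp add: mult.assoc)
  qed
  then show ?thesis by blast
qed

theorem vanishing_order:
  obtains \<delta> where "\<delta> > 0" "\<And>z. z \<in> ball 0 \<delta> \<Longrightarrow> f z = 0"
  | k L where "L \<noteq> 0" "(\<lambda>z. f z / z ^ k) \<midarrow>0\<rightarrow> L"
proof -
  \<comment> \<open>One radius for all \<open>k\<close>, since flatness is required on a common
    disc. The summand 1 keeps it positive when \<open>K = 0\<close>.\<close>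
  define \<rho> where "\<rho> = min (R/2) (1 / (4 * (K + 1)))"
  have \<rho>: "0 < \<rho>" "\<rho> < R" using R K by (auto simp: \<rho>_def)
  have "\<rho> * (4 * (K + 1)) \<le> 1" using K by (auto simp: \<rho>_def min_def field_simps)
  then have \<rho>K: "4 * K * \<rho> \<le> 1" using \<rho> by (simp add: algebra_simps)
  show thesis
  proof (cases "\<exists>k L. L \<noteq> 0 \<and> (\<lambda>z. f z / z ^ k) \<midarrow>0\<rightarrow> L")
    case True
    then show thesis using that(2) by blast
  next
    case False
    have "\<exists>C. \<forall>z\<in>cball 0 \<rho>. norm (f z) \<le> C * norm z ^ k" for k
    proof (induction k)
      case 0
      have "continuous_on (cball 0 \<rho>) f"
        by (rule has_derivative_continuous_on, rule has_derivative_at_withinI, rule der) (use \<rho> in auto)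
      then have "compact (f ` cball 0 \<rho>)" by (intro compact_continuous_image) auto
      then have "bounded (f ` cball 0 \<rho>)" by (rule compact_imp_bounded)
      then obtain F where "\<forall>y\<in>f ` cball 0 \<rho>. norm y \<le> F"
        unfolding bounded_iff ..
      then show ?case by (intro exI[of _ F]) auto
    next
      case (Suc k)
      then obtain C where C: "\<And>z. z \<in> cball 0 \<rho> \<Longrightarrow> norm (f z) \<le> C * norm z ^ k" by blast
      obtain L where "(\<lambda>z. f z / z ^ k) \<midarrow>0\<rightarrow> L" using quotient_has_limit[OF \<rho> C] by blast
      moreover have "L = 0"
      proof (rule ccontr)
        assume "L \<noteq> 0"
        with calculation have "\<exists>k L. L \<noteq> 0 \<and> (\<lambda>z. f z / z ^ k) \<midarrow>0\<rightarrow> L"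
          by (intro exI conjI)
        with False show False ..
      qed
      ultimately have "(\<lambda>z. f z / z ^ k) \<midarrow>0\<rightarrow> 0" by simp
      from order_increases[OF \<rho> C this] show ?case .
    qed
    then have "f z = 0" if "z \<in> ball 0 (\<rho>/2)" for z
      using zero_if_flat[OF \<rho> \<rho>K _ that] by blast
    then show thesis using that(1)[of "\<rho>/2"] \<rho> by simp
  qed
qed

end

section \<open>The complex gradient at a critical point\<close>

abbreviation partial2 :: "2 \<Rightarrow> 2 \<Rightarrow> (real^2 \<Rightarrow> real) \<Rightarrow> real^2 \<Rightarrow> real" where
  "partial2 j i f \<equiv> partial_deriv j (partial_deriv i f)"

section \<open>Symmetry of second partial derivatives\<close>

lemma has_derivative_partial_deriv:
  assumes "f differentiable (at x)"
  shows "(f has_derivative (\<lambda>h. \<Sum>i\<in>UNIV. partial_deriv i f x * h $ i)) (at x)"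
proof -
  let ?D = "frechet_derivative f (at x)"
  have D: "(f has_derivative ?D) (at x)"
    using assms frechet_derivative_works by blast
  interpret D: bounded_linear ?D using D by (rule has_derivative_bounded_linear)
  have "?D h = (\<Sum>i\<in>UNIV. partial_deriv i f x * h $ i)" for h
  proof -
    have "?D h = ?D (\<Sum>i\<in>UNIV. h $ i *\<^sub>R axis i 1)"
      using basis_expansion[of h] by (simp add: scalar_mult_eq_scaleR)
    then show ?thesis
      by (simp add: D.sum D.scaleR partial_deriv_def mult.commute)
  qed
  then have "?D = (\<lambda>h. \<Sum>i\<in>UNIV. partial_deriv i f x * h $ i)" by blast
  with D show ?thesis by (rule subst[rotated])
qed

text \<open>The mean value theorem is applied in direction \<open>v\<close>, then to
  \<open>\<lambda>y. f' y v\<close> in direction \<open>w\<close>. The second difference is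
  symmetric in \<open>v\<close> and \<open>w\<close>, which \<open>partial_deriv_commute\<close>
  exploits.\<close>

lemma second_difference_eq:
  fixes f :: "'a::real_normed_vector \<Rightarrow> real"
  assumes f': "\<And>y. y \<in> ball x d \<Longrightarrow> (f has_derivative f' y) (at y)"
    and f'': "\<And>y. y \<in> ball x d \<Longrightarrow> ((\<lambda>y. f' y v) has_derivative f'' y) (at y)"
    and s: "0 < s" "s * (norm v + norm w) < d"
  obtains y where "y \<in> ball x d"
    "f (x + s *\<^sub>R v + s *\<^sub>R w) - f (x + s *\<^sub>R v) - f (x + s *\<^sub>R w) + f x = s * s * f'' y w"
proof -
  have inb: "x + t *\<^sub>R v + r *\<^sub>R w \<in> ball x d" if "0 \<le> t" "t \<le> s" "0 \<le> r" "r \<le> s" for t r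
  proof -
    have "norm (t *\<^sub>R v + r *\<^sub>R w) \<le> t * norm v + r * norm w"
      using norm_triangle_ineq[of "t *\<^sub>R v" "r *\<^sub>R w"] that by simp
    also have "\<dots> \<le> s * norm v + s * norm w"
      using that by (intro add_mono mult_right_mono) auto
    finally have "norm (t *\<^sub>R v + r *\<^sub>R w) < d" using s by (simp add: distrib_left)
    moreover have "dist x (x + t *\<^sub>R v + r *\<^sub>R w) = norm (t *\<^sub>R v + r *\<^sub>R w)"
      by (metis add.assoc add_diff_cancel_left' dist_commute dist_norm)
    ultimately show ?thesis by simp
  qed
  have inb0: "x + t *\<^sub>R v \<in> ball x d" if "0 \<le> t" "t \<le> s" for t
    using inb[of t 0] that s by simp
  have "\<exists>\<tau>. 0 < \<tau> \<and> \<tau> < s \<and>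
     (f (x + s *\<^sub>R v + s *\<^sub>R w) - f (x + s *\<^sub>R v)) - (f (x + 0 *\<^sub>R v + s *\<^sub>R w) - f (x + 0 *\<^sub>R v))
     = (s - 0) * (f' (x + \<tau> *\<^sub>R v + s *\<^sub>R w) v - f' (x + \<tau> *\<^sub>R v) v)"
  proof (rule MVT2[OF s(1)])
    fix t assume t: "0 \<le> t" "t \<le> s"
    have 1: "((\<lambda>t. f (x + t *\<^sub>R v + s *\<^sub>R w)) has_derivative (\<lambda>h. f' (x + t *\<^sub>R v + s *\<^sub>R w) (h *\<^sub>R v))) (at t)"
      by (rule has_derivative_compose[of "\<lambda>t. x + t *\<^sub>R v + s *\<^sub>R w" "\<lambda>h. h *\<^sub>R v", OF _ f'[OF inb[of t s]]])
         (use t s in \<open>auto intro!: derivative_eq_intros\<close>)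
    have 2: "((\<lambda>t. f (x + t *\<^sub>R v)) has_derivative (\<lambda>h. f' (x + t *\<^sub>R v) (h *\<^sub>R v))) (at t)"
      by (rule has_derivative_compose[of "\<lambda>t. x + t *\<^sub>R v" "\<lambda>h. h *\<^sub>R v", OF _ f'[OF inb0[of t]]])
         (use t s in \<open>auto intro!: derivative_eq_intros\<close>)
    have lin: "linear (f' (x + t *\<^sub>R v + s *\<^sub>R w))" "linear (f' (x + t *\<^sub>R v))"
      using has_derivative_linear[OF f'[OF inb]] has_derivative_linear[OF f'[OF inb0]] t s by auto
    show "((\<lambda>t. f (x + t *\<^sub>R v + s *\<^sub>R w) - f (x + t *\<^sub>R v)) has_real_derivative
        (f' (x + t *\<^sub>R v + s *\<^sub>R w) v - f' (x + t *\<^sub>R v) v)) (at t)"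
      unfolding has_field_derivative_def
      by (rule has_derivative_eq_rhs[OF has_derivative_diff[OF 1 2]])
         (auto simp: linear_cmul[OF lin(1)] linear_cmul[OF lin(2)] fun_eq_iff right_diff_distrib mult.commute)
  qed
  then obtain \<tau> where \<tau>: "0 < \<tau>" "\<tau> < s" and
    e1: "f (x + s *\<^sub>R v + s *\<^sub>R w) - f (x + s *\<^sub>R v) - f (x + s *\<^sub>R w) + f x
     = s * (f' (x + \<tau> *\<^sub>R v + s *\<^sub>R w) v - f' (x + \<tau> *\<^sub>R v) v)"
    by (auto simp: algebra_simps)
  have "\<exists>\<sigma>. 0 < \<sigma> \<and> \<sigma> < s \<and>
     f' (x + \<tau> *\<^sub>R v + s *\<^sub>R w) v - f' (x + \<tau> *\<^sub>R v + 0 *\<^sub>R w) v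
     = (s - 0) * f'' (x + \<tau> *\<^sub>R v + \<sigma> *\<^sub>R w) w"
  proof (rule MVT2[OF s(1)])
    fix r assume r: "0 \<le> r" "r \<le> s"
    have 1: "((\<lambda>r. f' (x + \<tau> *\<^sub>R v + r *\<^sub>R w) v) has_derivative
        (\<lambda>h. f'' (x + \<tau> *\<^sub>R v + r *\<^sub>R w) (h *\<^sub>R w))) (at r)"
      by (rule has_derivative_compose[of "\<lambda>r. x + \<tau> *\<^sub>R v + r *\<^sub>R w" "\<lambda>h. h *\<^sub>R w", OF _ f''[OF inb[of \<tau> r]]])
         (use r \<tau> in \<open>auto intro!: derivative_eq_intros\<close>)
    have lin: "linear (f'' (x + \<tau> *\<^sub>R v + r *\<^sub>R w))"
      using has_derivative_linear[OF f''[OF inb]] r \<tau> by auto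
    show "((\<lambda>r. f' (x + \<tau> *\<^sub>R v + r *\<^sub>R w) v) has_real_derivative
        f'' (x + \<tau> *\<^sub>R v + r *\<^sub>R w) w) (at r)"
      unfolding has_field_derivative_def
      by (rule has_derivative_eq_rhs[OF 1]) (auto simp: linear_cmul[OF lin])
  qed
  then obtain \<sigma> where \<sigma>: "0 < \<sigma>" "\<sigma> < s" and
    e2: "f' (x + \<tau> *\<^sub>R v + s *\<^sub>R w) v - f' (x + \<tau> *\<^sub>R v) v = s * f'' (x + \<tau> *\<^sub>R v + \<sigma> *\<^sub>R w) w"
    by auto
  show thesis
    by (rule that[OF inb[of \<tau> \<sigma>]]) (use \<tau> \<sigma> e1 e2 in auto)
qed

lemma partial_deriv_commute:
  assumes C2: "Ck_on 2 f S" and "open S" and x: "x \<in> S"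
  shows "partial2 j i f x = partial2 i j f x"
proof -
  have dif: "f differentiable (at y)" "partial_deriv k f differentiable (at y)"
    and cont: "continuous_on S (partial2 l k f)" if "y \<in> S" for y k l
    using C2 that by (auto simp: numeral_2_eq_2)
  show ?thesis
  proof (rule ccontr)
    assume neq: "\<not> ?thesis"
    \<comment> \<open>Half the gap: numbers within \<open>e\<close> of the two mixed partials at
      \<open>x\<close> cannot coincide.\<close>
    define e where "e = \<bar>partial2 j i f x - partial2 i j f x\<bar> / 2"
    have "e > 0" using neq by (simp add: e_def)
    have near: "\<exists>d>0. \<forall>y\<in>ball x d. \<bar>partial2 l k f y - partial2 l k f x\<bar> < e" for k l
    proof -
      have "isCont (partial2 l k f) x"
        using cont[OF x] \<open>open S\<close> x continuous_on_eq_continuous_at by blast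
      then show ?thesis
        using \<open>e > 0\<close> unfolding continuous_at_eps_delta dist_real_def mem_ball Ball_def by (simp add: dist_commute)
    qed
    obtain d1 where d1: "d1 > 0"
      "\<And>y. y \<in> ball x d1 \<Longrightarrow> \<bar>partial2 j i f y - partial2 j i f x\<bar> < e"
      using near[of j i] by auto
    obtain d2 where d2: "d2 > 0"
      "\<And>y. y \<in> ball x d2 \<Longrightarrow> \<bar>partial2 i j f y - partial2 i j f x\<bar> < e"
      using near[of i j] by auto
    obtain d3 where d3: "d3 > 0" "ball x d3 \<subseteq> S"
      using \<open>open S\<close> x open_contains_ball by blast
    define d where "d = min d1 (min d2 d3)"
    define s where "s = d / 3"
    have d: "d > 0" "ball x d \<subseteq> S" "ball x d \<subseteq> ball x d1" "ball x d \<subseteq> ball x d2"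
      using d1 d2 d3 by (auto simp: d_def)
    have key: "\<exists>y\<in>ball x d. f (x + s *\<^sub>R axis k 1 + s *\<^sub>R axis l 1) - f (x + s *\<^sub>R axis k 1)
        - f (x + s *\<^sub>R axis l 1) + f x = s * s * partial2 l k f y" for k l :: 2
    proof -
      obtain y where "y \<in> ball x d" "f (x + s *\<^sub>R axis k 1 + s *\<^sub>R axis l 1) - f (x + s *\<^sub>R axis k 1)
        - f (x + s *\<^sub>R axis l 1) + f x = s * s * (\<Sum>i\<in>UNIV. partial2 i k f y * axis l 1 $ i)"
      proof (rule second_difference_eq[of x d f "\<lambda>y h. \<Sum>i\<in>UNIV. partial_deriv i f y * h $ i"
              "axis k 1" "\<lambda>y h. \<Sum>i\<in>UNIV. partial2 i k f y * h $ i" s "axis l 1"])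
        fix y assume "y \<in> ball x d"
        then have y: "y \<in> S" using d by blast
        show "(f has_derivative (\<lambda>h. \<Sum>i\<in>UNIV. partial_deriv i f y * h $ i)) (at y)"
          by (intro has_derivative_partial_deriv dif y)
        have "(\<lambda>y. \<Sum>i\<in>UNIV. partial_deriv i f y * axis k 1 $ i) = partial_deriv k f"
          by (simp add: fun_eq_iff axis_def if_distrib cong: if_cong)
        then show "((\<lambda>y. \<Sum>i\<in>UNIV. partial_deriv i f y * axis k 1 $ i) has_derivative
            (\<lambda>h. \<Sum>i\<in>UNIV. partial2 i k f y * h $ i)) (at y)"
          using has_derivative_partial_deriv[OF dif(2)[OF y]] by simp
      qed (use d in \<open>auto simp: s_def\<close>)
      moreover have "(\<Sum>i\<in>UNIV. partial2 i k f y * axis l 1 $ i) = partial2 l k f y"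
        by (simp add: axis_def if_distrib cong: if_cong)
      ultimately show ?thesis by auto
    qed
    obtain y where y: "y \<in> ball x d" "f (x + s *\<^sub>R axis i 1 + s *\<^sub>R axis j 1) - f (x + s *\<^sub>R axis i 1)
        - f (x + s *\<^sub>R axis j 1) + f x = s * s * partial2 j i f y"
      using key[of i j] by blast
    obtain z where z: "z \<in> ball x d" "f (x + s *\<^sub>R axis j 1 + s *\<^sub>R axis i 1) - f (x + s *\<^sub>R axis j 1)
        - f (x + s *\<^sub>R axis i 1) + f x = s * s * partial2 i j f z"
      using key[of j i] by blast
    have "x + s *\<^sub>R axis j 1 + s *\<^sub>R axis i 1 = x + s *\<^sub>R axis i 1 + s *\<^sub>R axis j (1::real)" by simp
    then have "s * s * partial2 j i f y = s * s * partial2 i j f z"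
      using y(2) z(2) by (simp add: algebra_simps)
    then have eq: "partial2 j i f y = partial2 i j f z"
      using d by (simp add: s_def)
    have "\<bar>partial2 j i f y - partial2 j i f x\<bar> < e"
      using y(1) d by (intro d1) auto
    moreover have "\<bar>partial2 i j f z - partial2 i j f x\<bar> < e"
      using z(1) d by (intro d2) auto
    moreover have "\<bar>p - q\<bar> \<le> \<bar>r - p\<bar> + \<bar>r - q\<bar>" for p q r :: real by linarith
    from this[of "partial2 j i f x" "partial2 i j f x"
        "partial2 i j f z"]
    have "2 * e \<le> \<bar>partial2 i j f z - partial2 j i f x\<bar>
        + \<bar>partial2 i j f z - partial2 i j f x\<bar>"
      by (simp add: e_def)
    ultimately show False unfolding eq by linarith
  qed
qed

unbundle no fps_syntax

section \<open>Normalising the leading coefficients at a critical point\<close>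

lemma differentiable_imp_locally_Lipschitz_at:
  assumes "f differentiable (at x)"
  obtains C where "\<forall>\<^sub>F y in nhds x. norm (f y - f x) \<le> C * norm (y - x)"
proof -
  obtain f' where f': "(f has_derivative f') (at x)"
    using assms differentiable_def by blast
  interpret bounded_linear f' using f' by (rule has_derivative_bounded_linear)
  obtain K where K: "\<And>h. norm (f' h) \<le> norm h * K" using bounded by blast
  obtain d where d: "d > 0" "\<And>y. norm (y - x) < d \<Longrightarrow> norm (f y - f x - f' (y - x)) \<le> 1 * norm (y - x)"
    using f' unfolding has_derivative_at_alt by (metis zero_less_one)
  have "norm (f y - f x) \<le> (K + 1) * norm (y - x)" if "dist y x < d" for y
  proof -
    have "norm (f y - f x) \<le> norm (f y - f x - f' (y - x)) + norm (f' (y - x))"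
      using norm_triangle_ineq[of "f y - f x - f' (y - x)" "f' (y - x)"] by simp
    then show ?thesis using d(2)[of y] K[of "y - x"] that by (simp add: dist_norm algebra_simps)
  qed
  then have "\<forall>\<^sub>F y in nhds x. norm (f y - f x) \<le> (K + 1) * norm (y - x)"
    unfolding eventually_nhds_metric using d(1) by blast
  then show thesis by (rule that)
qed

text \<open>Cholesky factorisation: the matrix with rows \<open>(\<alpha>, \<beta>)\<close> and
  \<open>(\<beta>, \<gamma>)\<close> is the sum of \<open>e1 e1^T\<close> and
  \<open>e2 e2^T\<close>. The triangular shape keeps the inverse coordinate change explicit.\<close>

lemma positive_definite_factorization:
  fixes \<alpha> \<beta> \<gamma> :: real
  assumes "\<alpha> > 0" "\<beta>\<^sup>2 < \<alpha> * \<gamma>"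
  obtains e1 e2 :: "real^2" where "e1 $ 1 > 0" "e2 $ 1 = 0" "e2 $ 2 > 0"
    "e1 $ 1 * e1 $ 1 = \<alpha>" "e1 $ 1 * e1 $ 2 = \<beta>" "e1 $ 2 * e1 $ 2 + e2 $ 2 * e2 $ 2 = \<gamma>"
proof
  let ?e1 = "vector [sqrt \<alpha>, \<beta> / sqrt \<alpha>] :: real^2"
  let ?e2 = "vector [0, sqrt (\<gamma> - \<beta>\<^sup>2 / \<alpha>)] :: real^2"
  have pos: "\<gamma> - \<beta>\<^sup>2 / \<alpha> > 0" using assms by (simp add: field_simps)
  show "?e1 $ 1 > 0" "?e2 $ 1 = 0" "?e2 $ 2 > 0" "?e1 $ 1 * ?e1 $ 1 = \<alpha>" "?e1 $ 1 * ?e1 $ 2 = \<beta>"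
    using assms pos by (simp_all add: vector_2)
  have "(\<beta> / sqrt \<alpha>) * (\<beta> / sqrt \<alpha>) = \<beta>\<^sup>2 / \<alpha>"
    using assms by (simp add: power2_eq_square)
  moreover have "sqrt (\<gamma> - \<beta>\<^sup>2 / \<alpha>) * sqrt (\<gamma> - \<beta>\<^sup>2 / \<alpha>) = \<gamma> - \<beta>\<^sup>2 / \<alpha>"
    using pos by simp
  ultimately show "?e1 $ 2 * ?e1 $ 2 + ?e2 $ 2 * ?e2 $ 2 = \<gamma>"
    by (simp add: vector_2)
qed

locale quasilinear_solution =
  fixes \<Omega> :: "(real^2) set" and u :: "real^2 \<Rightarrow> real" and a :: "2 \<Rightarrow> 2 \<Rightarrow> real^2 \<Rightarrow> real"
  assumes open_domain: "open \<Omega>" and connected_domain: "connected \<Omega>"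
    and C2: "Ck_on 2 u \<Omega>"
    and smooth: "smooth_fun_on (a i j) UNIV"
    and elliptic: "uniformly_elliptic a u \<Omega>"
    and pde: "x \<in> \<Omega> \<Longrightarrow>
      (\<Sum>i\<in>UNIV. \<Sum>j\<in>UNIV. a i j (grad u x) * partial2 j i u x) = 0"
    and nonconstant: "\<not> u constant_on \<Omega>"
begin

lemma
  assumes "x \<in> \<Omega>"
  shows differentiable_u: "u differentiable (at x)"
    and differentiable_partial: "partial_deriv k u differentiable (at x)"
    and isCont_second_partial: "isCont (partial2 l k u) x"
proof -
  show "u differentiable (at x)" "partial_deriv k u differentiable (at x)"
    using C2 assms by (auto simp: numeral_2_eq_2)
  have "continuous_on \<Omega> (partial2 l k u)"
    using C2 by (auto simp: numeral_2_eq_2)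
  then show "isCont (partial2 l k u) x"
    using assms open_domain continuous_on_eq_continuous_at by blast
qed

lemma has_derivative_u: "x \<in> \<Omega> \<Longrightarrow> (u has_derivative (\<lambda>h. grad u x \<bullet> h)) (at x)"
  using has_derivative_partial_deriv[OF differentiable_u]
  by (simp add: grad_def inner_vec_def)

lemma continuous_on_u: "continuous_on \<Omega> u"
  by (rule has_derivative_continuous_on, rule has_derivative_at_withinI, rule has_derivative_u)

lemma coefficient_factorization:
  assumes x0: "x0 \<in> \<Omega>" "grad u x0 = 0"
  obtains e1 e2 :: "real^2" where "e1 $ 1 > 0" "e2 $ 1 = 0" "e2 $ 2 > 0"
    "e1 $ 1 * e1 $ 1 = a 1 1 0" "e1 $ 1 * e1 $ 2 = (a 1 2 0 + a 2 1 0) / 2"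
    "e1 $ 2 * e1 $ 2 + e2 $ 2 * e2 $ 2 = a 2 2 0"
proof -
  obtain lo where "lo > 0" and lo: "\<And>\<xi>::real^2. lo * (norm \<xi>)\<^sup>2 \<le>
      a 1 1 0 * \<xi> $ 1 * \<xi> $ 1 + a 1 2 0 * \<xi> $ 1 * \<xi> $ 2 + (a 2 1 0 * \<xi> $ 2 * \<xi> $ 1 + a 2 2 0 * \<xi> $ 2 * \<xi> $ 2)"
    using elliptic x0 unfolding uniformly_elliptic_def sum_2 by fastforce
  \<comment> \<open>\<open>a\<close> need not be symmetric; the quadratic form, like the equation,
    sees only the symmetric part.\<close>
  define \<beta> where "\<beta> = (a 1 2 0 + a 2 1 0) / 2"
  have q: "0 < a 1 1 0 * p * p + 2 * \<beta> * p * q + a 2 2 0 * q * q" if "p \<noteq> 0 \<or> q \<noteq> 0" for p q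
  proof -
    have "vector [p, q] \<noteq> (0::real^2)" using that by (auto simp: vec_eq_iff forall_2)
    then have "0 < lo * (norm (vector [p, q] :: real^2))\<^sup>2" using \<open>lo > 0\<close> by simp
    moreover have "2 * \<beta> * p * q = a 1 2 0 * p * q + a 2 1 0 * q * p"
      by (simp add: \<beta>_def field_simps)
    ultimately show ?thesis using lo[of "vector [p, q]"] by simp
  qed
  have \<alpha>: "0 < a 1 1 0" using q[of 1 0] by simp
  \<comment> \<open>The form at \<open>(- \<beta>, a 1 1 0)\<close> is \<open>a 1 1 0\<close> times
    the determinant.\<close>
  have "0 < a 1 1 0 * (a 1 1 0 * a 2 2 0 - \<beta>\<^sup>2)"
    using q[of "- \<beta>" "a 1 1 0"] \<alpha> by (simp add: algebra_simps power2_eq_square)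
  then have "\<beta>\<^sup>2 < a 1 1 0 * a 2 2 0" using \<alpha> by (simp add: zero_less_mult_iff)
  from positive_definite_factorization[OF \<alpha> this] that show thesis
    unfolding \<beta>_def by blast
qed

lemma eventually_coefficient_bounds:
  assumes x0: "x0 \<in> \<Omega>" "grad u x0 = 0"
  obtains M C where "0 \<le> M" "0 \<le> C" "\<forall>\<^sub>F x in nhds x0. x \<in> \<Omega> \<and>
     (\<forall>k l. \<bar>partial2 l k u x\<bar> \<le> M) \<and>
     (\<forall>i j. \<bar>a i j (grad u x) - a i j 0\<bar> \<le> C * norm (grad u x))"
proof -
  define M where "M = (\<Sum>k\<in>UNIV. \<Sum>l\<in>UNIV. \<bar>partial2 l k u x0\<bar>) + 1"
  have M0: "\<bar>partial2 l k u x0\<bar> < M" for k l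
  proof -
    have "\<bar>partial2 l k u x0\<bar> \<le> (\<Sum>l\<in>UNIV. \<bar>partial2 l k u x0\<bar>)"
      by (rule member_le_sum) auto
    also have "\<dots> \<le> (\<Sum>k\<in>UNIV. \<Sum>l\<in>UNIV. \<bar>partial2 l k u x0\<bar>)"
      by (rule member_le_sum) (auto intro: sum_nonneg)
    finally show ?thesis by (simp add: M_def)
  qed
  have ev1: "\<forall>\<^sub>F x in nhds x0. \<forall>k l. \<bar>partial2 l k u x\<bar> \<le> M"
  proof (intro eventually_all_finite)
    fix k l
    have "((\<lambda>x. \<bar>partial2 l k u x\<bar>) \<longlongrightarrow> \<bar>partial2 l k u x0\<bar>) (nhds x0)"
      using isCont_second_partial[OF x0(1)] unfolding isCont_def tendsto_at_iff_tendsto_nhds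
      by (rule tendsto_rabs)
    from order_tendstoD(2)[OF this M0]
    show "\<forall>\<^sub>F x in nhds x0. \<bar>partial2 l k u x\<bar> \<le> M"
      by (rule eventually_mono) simp
  qed
  define C where "C = (\<lambda>i j. SOME C. \<forall>\<^sub>F p in nhds 0. norm (a i j p - a i j 0) \<le> C * norm (p - 0))"
  have "\<exists>C. \<forall>\<^sub>F p in nhds 0. norm (a i j p - a i j 0) \<le> C * norm (p - 0)" for i j
  proof -
    have "Ck_on 1 (a i j) UNIV" using smooth[of i j] unfolding smooth_fun_on_def by blast
    then have "a i j differentiable (at 0)" by simp
    then show ?thesis by (rule differentiable_imp_locally_Lipschitz_at) blast
  qed
  then have C: "\<forall>\<^sub>F p in nhds 0. norm (a i j p - a i j 0) \<le> C i j * norm (p - 0)" for i j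
    unfolding C_def by (rule someI_ex)
  define C' where "C' = (\<Sum>i\<in>UNIV. \<Sum>j\<in>UNIV. \<bar>C i j\<bar>)"
  have C': "C i j \<le> C'" for i j
  proof -
    have "C i j \<le> \<bar>C i j\<bar>" by simp
    also have "\<bar>C i j\<bar> \<le> (\<Sum>j\<in>UNIV. \<bar>C i j\<bar>)"
      by (rule member_le_sum) auto
    also have "\<dots> \<le> C'" unfolding C'_def
      by (rule member_le_sum) (auto intro: sum_nonneg)
    finally show ?thesis .
  qed
  have "isCont (partial_deriv k u) x0" for k
    using differentiable_partial[OF x0(1)] by (rule differentiable_imp_continuous_within)
  then have "(partial_deriv k u \<longlongrightarrow> partial_deriv k u x0) (nhds x0)" for k
    unfolding isCont_def tendsto_at_iff_tendsto_nhds .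
  then have "(grad u \<longlongrightarrow> grad u x0) (nhds x0)"
    unfolding grad_def by (intro vec_tendstoI) simp
  then have lim: "filterlim (grad u) (nhds 0) (nhds x0)" by (simp add: x0)
  have ev2: "\<forall>\<^sub>F x in nhds x0. \<forall>i j. \<bar>a i j (grad u x) - a i j 0\<bar> \<le> C' * norm (grad u x)"
  proof (intro eventually_all_finite)
    fix i j
    have "C i j * norm p \<le> C' * norm p" for p :: "real^2"
      using C' by (intro mult_right_mono) auto
    with eventually_compose_filterlim[OF C[of i j] lim]
    show "\<forall>\<^sub>F x in nhds x0. \<bar>a i j (grad u x) - a i j 0\<bar> \<le> C' * norm (grad u x)"
      by (elim eventually_mono) (auto intro: order_trans)
  qed
  have "\<forall>\<^sub>F x in nhds x0. x \<in> \<Omega>"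
    using x0(1) open_domain by (rule eventually_nhds_in_open[rotated])
  with ev1 ev2 have "\<forall>\<^sub>F x in nhds x0. x \<in> \<Omega> \<and>
     (\<forall>k l. \<bar>partial2 l k u x\<bar> \<le> M) \<and>
     (\<forall>i j. \<bar>a i j (grad u x) - a i j 0\<bar> \<le> C' * norm (grad u x))"
    by eventually_elim auto
  moreover have "0 \<le> M" using M0 order_trans[OF abs_ge_zero less_imp_le] by blast
  moreover have "0 \<le> C'" by (auto simp: C'_def intro!: sum_nonneg)
  ultimately show thesis using that by blast
qed

text \<open>In coordinates \<open>x0 + \<Psi> z\<close> that turn \<open>a i j 0\<close> into the identity matrix, the complex
  gradient \<open>f\<close> of \<open>u\<close> has \<open>B = \<Delta>(u \<circ> \<Psi>) / 2\<close>, which the equation bounds by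
  \<open>\<bar>a(\<nabla>u) - a(0)\<bar> \<bar>D\<^sup>2u\<bar> = O(\<bar>f\<bar>)\<close>. This is where it matters that the coefficients
  depend on the gradient only.\<close>

lemma complex_gradient:
  assumes x0: "x0 \<in> \<Omega>" "grad u x0 = 0"
  obtains \<Psi> :: "complex \<Rightarrow> real^2" and f A B R K where
    "linear \<Psi>" "bij \<Psi>" "dbar_inequality f A B R K"
    "\<And>z. z \<in> ball 0 R \<Longrightarrow> x0 + \<Psi> z \<in> \<Omega>"
    "\<And>z. f z = 0 \<longleftrightarrow> grad u (x0 + \<Psi> z) = 0"
    "\<And>z. z \<in> ball 0 R \<Longrightarrow> ((\<lambda>z. u (x0 + \<Psi> z)) has_derivative (\<lambda>h. Re (f z * h))) (at z)"
proof -
  obtain e1 e2 :: "real^2" where e: "e1 $ 1 > 0" "e2 $ 1 = 0" "e2 $ 2 > 0"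
    "e1 $ 1 * e1 $ 1 = a 1 1 0" "e1 $ 1 * e1 $ 2 = (a 1 2 0 + a 2 1 0) / 2"
    "e1 $ 2 * e1 $ 2 + e2 $ 2 * e2 $ 2 = a 2 2 0"
    using coefficient_factorization[OF x0] by blast
  obtain M C where MC: "0 \<le> M" "0 \<le> C" and ev: "\<forall>\<^sub>F x in nhds x0. x \<in> \<Omega> \<and>
     (\<forall>k l. \<bar>partial2 l k u x\<bar> \<le> M) \<and>
     (\<forall>i j. \<bar>a i j (grad u x) - a i j 0\<bar> \<le> C * norm (grad u x))"
    using eventually_coefficient_bounds[OF x0] by blast
  define \<Psi> where "\<Psi> = (\<lambda>z. Re z *\<^sub>R e1 + Im z *\<^sub>R e2)"
  have lin: "linear \<Psi>"
    by (rule linearI) (auto simp: \<Psi>_def algebra_simps)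
  have bij: "bij \<Psi>"
  proof (rule o_bij)
    define \<Phi> where "\<Phi> = (\<lambda>x::real^2. Complex (x $ 1 / e1 $ 1) ((x $ 2 - x $ 1 / e1 $ 1 * e1 $ 2) / e2 $ 2))"
    show "\<Phi> \<circ> \<Psi> = id" "\<Psi> \<circ> \<Phi> = id"
      using e by (auto simp: \<Phi>_def \<Psi>_def fun_eq_iff vec_eq_iff forall_2 complex_eq_iff)
  qed
  define X where "X = (\<lambda>z. x0 + \<Psi> z)"
  have dX: "(X has_derivative \<Psi>) (at z)" for z
    unfolding X_def using lin
    by (auto intro!: derivative_eq_intros linear_imp_has_derivative)
  have cX: "continuous_on T X" for T
    by (rule has_derivative_continuous_on, rule has_derivative_at_withinI, rule dX)
  have "(X \<longlongrightarrow> X 0) (nhds 0)"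
    using has_derivative_continuous[OF dX[of 0]] unfolding isCont_def tendsto_at_iff_tendsto_nhds .
  moreover have "X 0 = x0" using linear_0[OF lin] by (simp add: X_def)
  ultimately have "(X \<longlongrightarrow> x0) (nhds 0)" by simp
  from eventually_compose_filterlim[OF ev this]
  obtain R where R: "R > 0" and evR: "\<And>z. z \<in> ball 0 R \<Longrightarrow> X z \<in> \<Omega> \<and>
     (\<forall>k l. \<bar>partial2 l k u (X z)\<bar> \<le> M) \<and>
     (\<forall>i j. \<bar>a i j (grad u (X z)) - a i j 0\<bar> \<le> C * norm (grad u (X z)))"
    unfolding eventually_nhds_metric by (auto simp: dist_commute)
  define p where "p = (\<lambda>k z. partial_deriv k u (X z))"
  define D where "D = (\<lambda>k l z. partial2 l k u (X z))"
  \<comment> \<open>\<open>H v w\<close> is the second derivative of \<open>u\<close> in the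
    directions \<open>v\<close> and \<open>w\<close>. For \<open>V z = u (x0 + \<Psi> z)\<close> and
    \<open>f = V_x - i V_y\<close> the Wirtinger derivatives are
    \<open>A = (V_xx - V_yy) / 2 - i V_xy\<close> and \<open>B = (V_xx + V_yy) / 2\<close>.\<close>
  define H where "H = (\<lambda>v w z. \<Sum>k\<in>UNIV. \<Sum>l\<in>UNIV. D k l z * v $ k * w $ l)"
  define f where "f = (\<lambda>z. Complex (\<Sum>k\<in>UNIV. p k z * e1 $ k) (- (\<Sum>k\<in>UNIV. p k z * e2 $ k)))"
  define A where "A = (\<lambda>z. Complex ((H e1 e1 z - H e2 e2 z) / 2) (- H e1 e2 z))"
  define B where "B = (\<lambda>z. complex_of_real ((H e1 e1 z + H e2 e2 z) / 2))"
  have sym: "D k l z = D l k z" if "z \<in> ball 0 R" for k l z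
    unfolding D_def using partial_deriv_commute[OF C2 open_domain] evR[OF that] by blast
  have dp: "(p k has_derivative (\<lambda>h. \<Sum>l\<in>UNIV. D k l z * \<Psi> h $ l)) (at z)" if "z \<in> ball 0 R" for k z
    unfolding p_def D_def
    by (rule has_derivative_compose[OF dX has_derivative_partial_deriv[OF differentiable_partial]])
       (use evR[OF that] in blast)
  have df: "(f has_derivative (\<lambda>h. A z * h + B z * cnj h)) (at z)" if z: "z \<in> ball 0 R" for z
  proof -
    have "((\<lambda>z. complex_of_real (\<Sum>k\<in>UNIV. p k z * e1 $ k) - \<i> * complex_of_real (\<Sum>k\<in>UNIV. p k z * e2 $ k))
        has_derivative (\<lambda>h. complex_of_real (\<Sum>k\<in>UNIV. (\<Sum>l\<in>UNIV. D k l z * \<Psi> h $ l) * e1 $ k) -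
           \<i> * complex_of_real (\<Sum>k\<in>UNIV. (\<Sum>l\<in>UNIV. D k l z * \<Psi> h $ l) * e2 $ k))) (at z)"
      by (intro has_derivative_diff has_derivative_of_real has_derivative_sum has_derivative_mult_left
            has_derivative_mult_right dp z)
    moreover have "(\<lambda>z. complex_of_real (\<Sum>k\<in>UNIV. p k z * e1 $ k) - \<i> * complex_of_real (\<Sum>k\<in>UNIV. p k z * e2 $ k)) = f"
      by (auto simp: f_def fun_eq_iff complex_eq_iff)
    moreover have "complex_of_real (\<Sum>k\<in>UNIV. (\<Sum>l\<in>UNIV. D k l z * \<Psi> h $ l) * e1 $ k) -
           \<i> * complex_of_real (\<Sum>k\<in>UNIV. (\<Sum>l\<in>UNIV. D k l z * \<Psi> h $ l) * e2 $ k) = A z * h + B z * cnj h" for h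
      using sym[OF z, of 2 1]
      by (simp add: complex_eq_iff A_def B_def H_def \<Psi>_def sum_2 field_simps)
    ultimately show ?thesis by simp
  qed
  have cD: "continuous_on (ball 0 R) (D k l)" for k l
    unfolding D_def
  proof (rule continuous_on_compose2[OF _ cX])
    show "continuous_on \<Omega> (partial2 l k u)"
      using isCont_second_partial by (intro continuous_at_imp_continuous_on) blast
  qed (use evR in blast)
  have cH: "continuous_on (ball 0 R) (H v w)" for v w
    unfolding H_def by (intro continuous_intros cD)
  have p2: "\<bar>p 2 z\<bar> \<le> norm (f z) / e2 $ 2" for z
  proof -
    have "\<bar>p 2 z\<bar> * e2 $ 2 = \<bar>Im (f z)\<bar>"
      using e by (simp add: f_def sum_2 abs_mult)
    also have "\<dots> \<le> norm (f z)" by (rule abs_Im_le_cmod)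
    finally show ?thesis using e by (simp add: field_simps)
  qed
  \<comment> \<open>Bounds the inverse of the triangular system that expresses \<open>f\<close>
    through the two partial derivatives.\<close>
  define K1 where "K1 = (1 + \<bar>e1 $ 2\<bar> / e2 $ 2) / e1 $ 1 + 1 / e2 $ 2"
  have K1: "K1 \<ge> 0" using e by (simp add: K1_def)
  have gradf: "norm (grad u (X z)) \<le> K1 * norm (f z)" for z
  proof -
    have "p 1 z * e1 $ 1 = Re (f z) - p 2 z * e1 $ 2"
      by (simp add: f_def sum_2)
    then have "\<bar>p 1 z\<bar> * e1 $ 1 = \<bar>Re (f z) - p 2 z * e1 $ 2\<bar>"
      using e by (metis abs_mult abs_of_pos)
    also have "\<dots> \<le> \<bar>Re (f z)\<bar> + \<bar>p 2 z\<bar> * \<bar>e1 $ 2\<bar>"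
      using abs_triangle_ineq4[of "Re (f z)" "p 2 z * e1 $ 2"] by (simp add: abs_mult)
    also have "\<dots> \<le> norm (f z) + norm (f z) / e2 $ 2 * \<bar>e1 $ 2\<bar>"
      by (intro add_mono abs_Re_le_cmod mult_right_mono p2) auto
    also have "\<dots> = norm (f z) * (1 + \<bar>e1 $ 2\<bar> / e2 $ 2)"
      by (simp add: algebra_simps)
    finally have p1: "\<bar>p 1 z\<bar> \<le> norm (f z) * (1 + \<bar>e1 $ 2\<bar> / e2 $ 2) / e1 $ 1"
      using e by (simp add: pos_le_divide_eq)
    have "norm (grad u (X z)) \<le> \<bar>p 1 z\<bar> + \<bar>p 2 z\<bar>"
      using norm_le_l1_cart[of "grad u (X z)"] by (simp add: sum_2 grad_def p_def)
    also have "\<dots> \<le> K1 * norm (f z)"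
      using p1 p2[of z] by (simp add: K1_def algebra_simps)
    finally show ?thesis .
  qed
  \<comment> \<open>Four index pairs, each contributing at most
    \<open>C * K1 * M * norm (f z)\<close>.\<close>
  define K where "K = 4 * (C * K1 * M)"
  have "norm (B z) \<le> K * norm (f z)" if z: "z \<in> ball 0 R" for z
  proof -
    have "H e1 e1 z + H e2 e2 z = a 1 1 0 * D 1 1 z + a 1 2 0 * D 1 2 z + a 2 1 0 * D 2 1 z + a 2 2 0 * D 2 2 z"
    proof -
      have "H e1 e1 z + H e2 e2 z = D 1 1 z * (e1 $ 1 * e1 $ 1) + 2 * D 1 2 z * (e1 $ 1 * e1 $ 2)
          + D 2 2 z * (e1 $ 2 * e1 $ 2 + e2 $ 2 * e2 $ 2)"
        using e(2) sym[OF z, of 2 1] by (simp add: H_def sum_2 algebra_simps)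
      also have "\<dots> = a 1 1 0 * D 1 1 z + a 1 2 0 * D 1 2 z + a 2 1 0 * D 2 1 z + a 2 2 0 * D 2 2 z"
        unfolding e(4-6) using sym[OF z, of 2 1] by (simp add: algebra_simps)
      finally show ?thesis .
    qed
    \<comment> \<open>The equation at \<open>X z\<close> is subtracted, so that only differences of
      coefficients remain.\<close>
    also have "\<dots> = (\<Sum>i\<in>UNIV. \<Sum>j\<in>UNIV. (a i j 0 - a i j (grad u (X z))) * D i j z)"
      using pde[of "X z"] evR[OF z] by (simp add: sum_2 D_def algebra_simps)
    finally have eq: "H e1 e1 z + H e2 e2 z = \<dots>" .
    have "\<bar>H e1 e1 z + H e2 e2 z\<bar> \<le> (\<Sum>i\<in>(UNIV::2 set). \<Sum>j\<in>(UNIV::2 set). C * (K1 * norm (f z)) * M)"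
      unfolding eq
    proof (intro sum_abs[THEN order_trans] sum_mono)
      fix i j :: 2
      have "\<bar>a i j 0 - a i j (grad u (X z))\<bar> \<le> C * norm (grad u (X z))"
        using evR[OF z] by (simp add: abs_minus_commute)
      also have "\<dots> \<le> C * (K1 * norm (f z))" by (intro mult_left_mono gradf MC)
      finally show "\<bar>(a i j 0 - a i j (grad u (X z))) * D i j z\<bar> \<le> C * (K1 * norm (f z)) * M"
        unfolding abs_mult using evR[OF z] MC K1 by (intro mult_mono) (auto simp: D_def)
    qed
    also have "\<dots> = K * norm (f z)" by (simp add: K_def)
    finally show ?thesis
      unfolding B_def norm_of_real by simp
  qed
  then have ineq: "dbar_inequality f A B R K"
    using R df cH MC K1 by unfold_locales
      (auto simp: K_def A_def B_def Complex_eq intro!: continuous_intros)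
  have "((\<lambda>z. u (x0 + \<Psi> z)) has_derivative (\<lambda>h. Re (f z * h))) (at z)" if z: "z \<in> ball 0 R" for z
  proof -
    have "((\<lambda>z. u (X z)) has_derivative (\<lambda>h. grad u (X z) \<bullet> \<Psi> h)) (at z)"
      by (rule has_derivative_compose[OF dX has_derivative_u]) (use evR[OF z] in blast)
    moreover have "(\<lambda>h. grad u (X z) \<bullet> \<Psi> h) = (\<lambda>h. Re (f z * h))"
      by (simp add: fun_eq_iff inner_vec_def sum_2 grad_def f_def \<Psi>_def p_def algebra_simps)
    ultimately show ?thesis by (simp add: X_def)
  qed
  moreover have "f z = 0 \<longleftrightarrow> grad u (x0 + \<Psi> z) = 0" for z
  proof
    assume "f z = 0"
    then show "grad u (x0 + \<Psi> z) = 0" using gradf[of z] by (simp add: X_def)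
  next
    assume "grad u (x0 + \<Psi> z) = 0"
    then have "p k z = 0" for k by (simp add: p_def X_def grad_def vec_eq_iff)
    then show "f z = 0" by (simp add: f_def complex_eq_iff)
  qed
  ultimately show thesis
    using that[OF lin bij ineq] evR by (auto simp: X_def)
qed

end

section \<open>Saddles in polar coordinates\<close>

lemma filterlim_inverse_affine:
  fixes \<Psi> :: "complex \<Rightarrow> real^2"
  assumes "linear \<Psi>" "bij \<Psi>"
  shows "((\<lambda>y. inv \<Psi> (y - x0)) \<longlongrightarrow> 0) (nhds x0)"
    and "filterlim (\<lambda>y. inv \<Psi> (y - x0)) (at 0) (at x0)"
proof -
  obtain g where g: "linear g" "g \<circ> \<Psi> = id"
    using linear_injective_left_inverse[OF assms(1)] assms(2) bij_is_inj by blast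
  have "inv \<Psi> y = g y" for y
    using g(2) assms(2) by (metis bij_is_surj comp_apply id_apply surj_f_inv_f)
  then have lin: "linear (inv \<Psi>)"
    using g(1) by presburger
  define G where "G = (\<lambda>y. inv \<Psi> (y - x0))"
  have "isCont G x0"
    using lin unfolding G_def
    by (intro continuous_intros bounded_linear.isCont[of "inv \<Psi>"])
       (simp add: linear_conv_bounded_linear)
  then have limG: "(G \<longlongrightarrow> G x0) (nhds x0)"
    unfolding isCont_def tendsto_at_iff_tendsto_nhds .
  have "G x0 = 0" using linear_0[OF lin] by (simp add: G_def)
  with limG show lim: "((\<lambda>y. inv \<Psi> (y - x0)) \<longlongrightarrow> 0) (nhds x0)"
    by (simp only: G_def)
  have "inv \<Psi> (y - x0) \<noteq> 0" if "y \<noteq> x0" for y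
    using that assms by (metis bij_inv_eq_iff eq_iff_diff_eq_0 linear_0)
  then show "filterlim (\<lambda>y. inv \<Psi> (y - x0)) (at 0) (at x0)"
    by (intro filterlim_atI tendsto_mono[OF at_within_le_nhds lim])
       (simp add: eventually_at_filter)
qed

lemma eventually_affine_image:
  fixes \<Psi> :: "complex \<Rightarrow> real^2"
  assumes "linear \<Psi>" "bij \<Psi>"
  shows "\<forall>\<^sub>F z in at 0. P (x0 + \<Psi> z) \<Longrightarrow> \<forall>\<^sub>F y in at x0. P y"
    and "\<forall>\<^sub>F z in nhds 0. P (x0 + \<Psi> z) \<Longrightarrow> \<forall>\<^sub>F y in nhds x0. P y"
proof -
  have eq: "x0 + \<Psi> (inv \<Psi> (y - x0)) = y" for y
    using assms(2) by (simp add: bij_is_surj surj_f_inv_f)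
  show "\<forall>\<^sub>F z in at 0. P (x0 + \<Psi> z) \<Longrightarrow> \<forall>\<^sub>F y in at x0. P y"
    using eventually_compose_filterlim[OF _ filterlim_inverse_affine(2)[OF assms, of x0], of "\<lambda>z. P (x0 + \<Psi> z)"]
    by (simp add: eq)
  show "\<forall>\<^sub>F z in nhds 0. P (x0 + \<Psi> z) \<Longrightarrow> \<forall>\<^sub>F y in nhds x0. P y"
    using eventually_compose_filterlim[OF _ filterlim_inverse_affine(1)[OF assms, of x0], of "\<lambda>z. P (x0 + \<Psi> z)"]
    by (simp add: eq)
qed

abbreviation polar :: "real \<Rightarrow> real \<Rightarrow> complex" where
  "polar r \<theta> \<equiv> of_real r * cis \<theta>"

lemma cis_eq_imp_eq:
  fixes s t :: real
  assumes "cis s = cis t" "\<bar>s - t\<bar> < 2 * pi"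
  shows "s = t"
proof -
  obtain k :: int where k: "s = t + 2 * pi * k"
    using assms(1) sin_cos_eq_iff[of s t] by (auto simp: complex_eq_iff)
  then have "2 * pi * k < 2 * pi * 1" "2 * pi * (- 1) < 2 * pi * k"
    using assms(2) by linarith+
  then have "real_of_int k < 1" "- 1 < real_of_int k"
    by (simp_all only: mult_less_cancel_left_pos pi_gt_zero mult_pos_pos zero_less_numeral)
  then have "k = 0" by linarith
  then show ?thesis using k by simp
qed

lemma polar_eq_imp_eq:
  fixes r s a b :: real
  assumes "polar r a = polar s b" "0 < r" "0 \<le> s" "\<bar>a - b\<bar> < 2 * pi"
  shows "r = s" "a = b"
proof -
  have "norm (polar r a) = norm (polar s b)" using assms(1) by simp
  then show rs: "r = s" using assms(2,3) by (simp add: norm_mult)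
  then show "a = b" using assms by (intro cis_eq_imp_eq) auto
qed

text \<open>The sign pattern of \<open>k * r ^ n * cos (n * \<theta>)\<close> and of its angular derivative, up to relative
  errors less than one half.\<close>

definition polar_saddle :: "nat \<Rightarrow> (complex \<Rightarrow> real) \<Rightarrow> real \<Rightarrow> bool" where
  "polar_saddle n v R \<longleftrightarrow> 2 \<le> n \<and> 0 < R \<and> v 0 = 0 \<and> continuous_on (cball 0 R) v \<and>
     (\<forall>(r::real) (\<theta>::real). 0 < r \<and> r \<le> R \<longrightarrow>
        (cos (n * \<theta>) \<ge> 1/2 \<longrightarrow> v (polar r \<theta>) > 0) \<and>
        (cos (n * \<theta>) \<le> - (1/2) \<longrightarrow> v (polar r \<theta>) < 0) \<and>
        (\<exists>D. ((\<lambda>\<theta>. v (polar r \<theta>)) has_real_derivative D) (at \<theta>) \<and>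
           (sin (n * \<theta>) \<ge> 1/2 \<longrightarrow> D < 0) \<and> (sin (n * \<theta>) \<le> - (1/2) \<longrightarrow> D > 0)))"

lemma
  assumes "polar_saddle n v R" "0 < r" "r \<le> R"
  shows polar_saddle_pos: "1/2 \<le> cos (n * \<theta>) \<Longrightarrow> 0 < v (polar r \<theta>)"
    and polar_saddle_neg: "cos (n * \<theta>) \<le> - (1/2) \<Longrightarrow> v (polar r \<theta>) < 0"
    and polar_saddle_deriv: "\<exists>D. ((\<lambda>\<theta>. v (polar r \<theta>)) has_real_derivative D) (at \<theta>) \<and>
           (1/2 \<le> sin (n * \<theta>) \<longrightarrow> D < 0) \<and> (sin (n * \<theta>) \<le> - (1/2) \<longrightarrow> 0 < D)"
  using assms unfolding polar_saddle_def by blast+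

text \<open>\<open>f\<close> is \<open>c * z ^ m\<close> up to
  \<open>\<epsilon> * norm z ^ m\<close>, so the mean value inequality puts \<open>v\<close> within
  \<open>\<epsilon> * norm z ^ n\<close> of \<open>Re (c * z ^ n / n)\<close>, where
  \<open>n = Suc m\<close>. The angular derivative of \<open>v\<close> is
  \<open>Re (f z * (\<i> * z))\<close>, with leading part
  \<open>- (c * r ^ n * sin (n * \<theta>))\<close>.\<close>

lemma polar_saddleI:
  fixes v :: "complex \<Rightarrow> real" and f :: "complex \<Rightarrow> complex"
  assumes R: "0 < R" and m: "1 \<le> m" and c: "0 < c"
    and der: "\<And>z. z \<in> ball 0 R \<Longrightarrow> (v has_derivative (\<lambda>h. Re (f z * h))) (at z)"
    and v0: "v 0 = 0" and f0: "f 0 = 0"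
    and lim: "(\<lambda>z. f z / z ^ m) \<midarrow>0\<rightarrow> of_real c"
  obtains r0 where "0 < r0" "r0 < R" "polar_saddle (Suc m) v r0"
proof -
  define n where "n = Suc m"
  \<comment> \<open>A quarter of the leading coefficient \<open>c / n\<close> of \<open>v\<close>,
    hence also at most a quarter of the coefficient \<open>c\<close> of the angular derivative; a
    cosine or sine of absolute value at least one half then decides the sign.\<close>
  define \<epsilon> where "\<epsilon> = c / (4 * n)"
  have \<epsilon>: "\<epsilon> > 0" "\<epsilon> \<le> c / 4" using c by (auto simp: \<epsilon>_def n_def field_simps)
  obtain d where d: "d > 0" "\<And>z. z \<noteq> 0 \<Longrightarrow> norm z < d \<Longrightarrow> norm (f z / z ^ m - c) < \<epsilon>"
    using lim \<epsilon>(1) unfolding LIM_eq by auto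
  define r0 where "r0 = min d R / 2"
  have r0: "0 < r0" "r0 < R" "r0 < d" using d R by (auto simp: r0_def)
  have fz: "norm (f z - c * z ^ m) \<le> \<epsilon> * norm z ^ m" if "norm z < d" for z :: complex
  proof (cases "z = 0")
    case False
    have "f z - c * z ^ m = (f z / z ^ m - c) * z ^ m" using False by (simp add: algebra_simps)
    then have "norm (f z - c * z ^ m) = norm (f z / z ^ m - c) * norm z ^ m"
      by (simp only: norm_mult norm_power)
    then show ?thesis using d(2)[OF False that] by (simp add: mult_right_mono)
  qed (use m f0 in \<open>auto simp: power_0_left\<close>)
  have vz: "\<bar>v z - Re (c * z ^ n / n)\<bar> \<le> \<epsilon> * norm z ^ n" if z: "norm z \<le> r0" for z :: complex
  proof -
    define w where "w = (\<lambda>z::complex. v z - Re (c * z ^ n / n))"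
    have n0: "of_nat n \<noteq> (0::complex)" and nm: "n - Suc 0 = m"
      by (simp_all add: n_def del: of_nat_Suc)
    have dw: "(w has_derivative (\<lambda>h. Re ((f y - c * y ^ m) * h))) (at y within cball 0 (norm z))"
      if y: "y \<in> cball 0 (norm z)" for y :: complex
    proof -
      have "((\<lambda>z. c * z ^ n / n) has_field_derivative c * y ^ m) (at y)"
        using n0 nm by (auto intro!: derivative_eq_intros)
      then have "((\<lambda>z. Re (c * z ^ n / n)) has_derivative (\<lambda>h. Re (c * y ^ m * h))) (at y)"
        unfolding has_field_derivative_def by (rule has_derivative_Re)
      moreover have "(v has_derivative (\<lambda>h. Re (f y * h))) (at y)"
        using y z r0 by (intro der) auto
      ultimately have "(w has_derivative (\<lambda>h. Re (f y * h) - Re (c * y ^ m * h))) (at y)"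
        unfolding w_def by (rule has_derivative_diff[rotated])
      then show ?thesis by (simp add: algebra_simps has_derivative_at_withinI)
    qed
    have "norm (w z - w 0) \<le> (\<epsilon> * norm z ^ m) * norm (z - 0)"
    proof (rule differentiable_bound[OF convex_cball dw])
      fix y :: complex assume y: "y \<in> cball 0 (norm z)"
      have "norm (f y - c * y ^ m) \<le> \<epsilon> * norm z ^ m"
      proof (rule order_trans[OF fz])
        show "norm y < d" using y z r0 by simp
        show "\<epsilon> * norm y ^ m \<le> \<epsilon> * norm z ^ m"
          using y \<epsilon>(1) by (intro mult_left_mono power_mono) auto
      qed
      then have "norm (Re ((f y - c * y ^ m) * h)) \<le> \<epsilon> * norm z ^ m * norm h" for h
        using order_trans[OF abs_Re_le_cmod, of "(f y - c * y ^ m) * h" "\<epsilon> * norm z ^ m * norm h"]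
        by (simp only: norm_mult real_norm_def mult_right_mono norm_ge_zero)
      then show "onorm (\<lambda>h. Re ((f y - c * y ^ m) * h)) \<le> \<epsilon> * norm z ^ m"
        using \<epsilon>(1) by (intro onorm_bound) auto
    qed auto
    then show ?thesis by (simp add: w_def v0 n_def mult_ac)
  qed
  have "continuous_on (cball 0 r0) v"
    using r0 by (intro has_derivative_continuous_on[OF has_derivative_at_withinI[OF der]]) auto
  moreover have "(cos (n * \<theta>) \<ge> 1/2 \<longrightarrow> v (polar r \<theta>) > 0) \<and>
        (cos (n * \<theta>) \<le> - (1/2) \<longrightarrow> v (polar r \<theta>) < 0) \<and>
        (\<exists>D. ((\<lambda>\<theta>. v (polar r \<theta>)) has_real_derivative D) (at \<theta>) \<and>
           (sin (n * \<theta>) \<ge> 1/2 \<longrightarrow> D < 0) \<and> (sin (n * \<theta>) \<le> - (1/2) \<longrightarrow> D > 0))"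
    if r: "0 < r" "r \<le> r0" for r \<theta> :: real
  proof -
    define z where "z = polar r \<theta>"
    have nz: "norm z = r" using r by (simp add: z_def norm_mult)
    have zn: "z ^ n = polar (r ^ n) (n * \<theta>)"
      unfolding z_def power_mult_distrib Complex.DeMoivre of_real_power ..
    have rn: "r ^ n > 0" using r by simp
    have Re_eq: "Re (c * z ^ n / n) = c / n * r ^ n * cos (n * \<theta>)"
      unfolding zn by (simp add: cis.sel flip: of_real_power)
    have \<epsilon>_eq: "\<epsilon> * r ^ n = c / n * r ^ n * (1/4)" by (simp add: \<epsilon>_def)
    have "\<bar>v z - Re (c * z ^ n / n)\<bar> \<le> \<epsilon> * r ^ n" using vz[of z] nz r by simp
    then have V: "\<bar>v z - c / n * r ^ n * cos (n * \<theta>)\<bar> \<le> c / n * r ^ n * (1/4)"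
      by (simp only: Re_eq \<epsilon>_eq)
    have kpos: "c / n * r ^ n > 0" using c rn by (simp add: n_def)
    have 1: "v z > 0" if "cos (n * \<theta>) \<ge> 1/2"
      using V mult_left_mono[OF that, of "c / n * r ^ n"] kpos by argo
    have 2: "v z < 0" if "cos (n * \<theta>) \<le> - (1/2)"
      using V mult_left_mono[OF that, of "c / n * r ^ n"] kpos by argo
    define D where "D = Re (f z * (\<i> * z))"
    have "((\<lambda>\<theta>. polar r \<theta>) has_derivative (\<lambda>h. h *\<^sub>R (\<i> * z))) (at \<theta>)"
      by (auto simp: z_def scaleR_conv_of_real has_vector_derivative_def
           intro!: derivative_eq_intros has_derivative_cis)
    from has_derivative_compose[OF this der[of "polar r \<theta>"]]
    have "((\<lambda>\<theta>. v (polar r \<theta>)) has_derivative (\<lambda>h. Re (f z * (h *\<^sub>R (\<i> * z))))) (at \<theta>)"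
      using r r0 nz by (simp add: z_def)
    moreover have "(\<lambda>h. Re (f z * (h *\<^sub>R (\<i> * z)))) = (*) D"
      by (simp add: D_def fun_eq_iff algebra_simps)
    ultimately have 3: "((\<lambda>\<theta>. v (polar r \<theta>)) has_real_derivative D) (at \<theta>)"
      by (simp add: has_field_derivative_def)
    have "D - Re (c * z ^ m * (\<i> * z)) = Re ((f z - c * z ^ m) * (\<i> * z))"
      by (simp add: D_def algebra_simps)
    also have "\<bar>\<dots>\<bar> \<le> norm ((f z - c * z ^ m) * (\<i> * z))" by (rule abs_Re_le_cmod)
    also have "\<dots> \<le> \<epsilon> * norm z ^ m * norm z"
      unfolding norm_mult using fz[of z] nz r r0 by (simp add: mult_right_mono)
    also have "\<dots> \<le> c / 4 * r ^ n"
      using mult_right_mono[OF \<epsilon>(2), of "r ^ n"] rn by (simp add: nz n_def mult_ac)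
    also have "Re (c * z ^ m * (\<i> * z)) = - (c * r ^ n * sin (n * \<theta>))"
    proof -
      have "c * z ^ m * (\<i> * z) = \<i> * (c * z ^ n)" by (simp add: n_def)
      moreover have "Re (\<i> * (c * z ^ n)) = - (c * Im (z ^ n))" by simp
      moreover have "Im (z ^ n) = r ^ n * sin (n * \<theta>)"
        unfolding zn by (simp add: cis.sel flip: of_real_power)
      ultimately show ?thesis by (simp only: mult.assoc)
    qed
    finally have D: "\<bar>D + c * r ^ n * sin (n * \<theta>)\<bar> \<le> c * r ^ n * (1/4)" by simp
    have kpos': "c * r ^ n > 0" using c rn by simp
    have 4: "D < 0" if "sin (n * \<theta>) \<ge> 1/2"
      using D mult_left_mono[OF that, of "c * r ^ n"] kpos' by argo
    have 5: "D > 0" if "sin (n * \<theta>) \<le> - (1/2)"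
      using D mult_left_mono[OF that, of "c * r ^ n"] kpos' by argo
    show ?thesis using 1 2 3 4 5 unfolding z_def by blast
  qed
  ultimately have "polar_saddle n v r0"
    unfolding polar_saddle_def using r0 m v0 by (simp add: n_def del: of_nat_Suc)
  then show thesis using r0 that by (simp add: n_def)
qed

section \<open>Unique continuation, the saddle at a critical point, and the strong maximum
  principle\<close>

context quasilinear_solution
begin

lemma gradient_dichotomy:
  assumes x: "x \<in> \<Omega>"
  shows "(\<forall>\<^sub>F y in at x. grad u y \<noteq> 0) \<or> (\<forall>\<^sub>F y in nhds x. grad u y = 0)"
proof (cases "grad u x = 0")
  case False
  then obtain i where i: "partial_deriv i u x \<noteq> 0" by (auto simp: grad_def vec_eq_iff)
  have "isCont (partial_deriv i u) x"
    using differentiable_partial[OF x] by (rule differentiable_imp_continuous_within)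
  then have "\<forall>\<^sub>F y in at x. partial_deriv i u y \<noteq> 0"
    unfolding isCont_def using i by (rule tendsto_imp_eventually_ne)
  then show ?thesis
    by (intro disjI1) (auto elim!: eventually_mono simp: grad_def vec_eq_iff)
next
  case True
  obtain \<Psi> :: "complex \<Rightarrow> real^2" and f A B R K where \<Psi>: "linear \<Psi>" "bij \<Psi>"
    and f: "dbar_inequality f A B R K" "\<And>z. f z = 0 \<longleftrightarrow> grad u (x + \<Psi> z) = 0"
    by (rule complex_gradient[OF x True]) (rule that)
  interpret dbar_inequality f A B R K by fact
  show ?thesis
  proof (rule vanishing_order)
    fix \<delta> :: real assume "\<delta> > 0" "\<And>z. z \<in> ball 0 \<delta> \<Longrightarrow> f z = 0"
    then have "\<forall>\<^sub>F z in nhds 0. grad u (x + \<Psi> z) = 0"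
      using eventually_nhds_in_open[of "ball 0 \<delta>" 0] f(2) by (auto elim!: eventually_mono)
    then show ?thesis using eventually_affine_image(2)[OF \<Psi>, of "\<lambda>y. grad u y = 0"] by blast
  next
    fix k L assume "L \<noteq> 0" "(\<lambda>z. f z / z ^ k) \<midarrow>0\<rightarrow> L"
    then have "\<forall>\<^sub>F z in at 0. f z / z ^ k \<noteq> 0"
      by (intro tendsto_imp_eventually_ne)
    then have "\<forall>\<^sub>F z in at 0. grad u (x + \<Psi> z) \<noteq> 0"
      by (rule eventually_mono) (use f(2) in auto)
    then show ?thesis using eventually_affine_image(1)[OF \<Psi>, of "\<lambda>y. grad u y \<noteq> 0"] by blast
  qed
qed

text \<open>By the dichotomy, the set of points near which the gradient vanishes identically is open
  with open complement in \<open>\<Omega>\<close>; were it nonempty, connectedness would make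
  \<open>u\<close> constant.\<close>

lemma gradient_nonzero_nearby:
  assumes x: "x \<in> \<Omega>"
  shows "\<forall>\<^sub>F y in at x. grad u y \<noteq> 0"
proof (rule ccontr)
  assume neg: "\<not> ?thesis"
  define E where "E = {x \<in> \<Omega>. \<forall>\<^sub>F y in nhds x. grad u y = 0}"
  have "open E"
    unfolding open_subopen[of E]
  proof
    fix y assume y: "y \<in> E"
    then have "\<forall>\<^sub>F z in nhds y. \<forall>\<^sub>F w in nhds z. grad u w = 0"
      unfolding E_def eventually_eventually by simp
    moreover have "\<forall>\<^sub>F z in nhds y. z \<in> \<Omega>"
      using y open_domain unfolding E_def by (intro eventually_nhds_in_open) auto
    ultimately have "\<forall>\<^sub>F z in nhds y. z \<in> E"
      by eventually_elim (auto simp: E_def)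
    then show "\<exists>T. open T \<and> y \<in> T \<and> T \<subseteq> E" unfolding eventually_nhds by blast
  qed
  moreover have "open (\<Omega> - E)"
    unfolding open_subopen[of "\<Omega> - E"]
  proof
    fix y assume y: "y \<in> \<Omega> - E"
    then have "\<forall>\<^sub>F z in at y. grad u z \<noteq> 0"
      using gradient_dichotomy[of y] by (auto simp: E_def)
    then have "\<forall>\<^sub>F z in nhds y. z \<noteq> y \<longrightarrow> grad u z \<noteq> 0"
      by (simp add: eventually_at_filter)
    moreover have "\<forall>\<^sub>F z in nhds y. z \<in> \<Omega>"
      using y open_domain by (intro eventually_nhds_in_open) auto
    ultimately have "\<forall>\<^sub>F z in nhds y. z \<in> \<Omega> - E"
    proof eventually_elim
      case (elim z)
      have "grad u z = 0" if "z \<in> E"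
        using that eventually_nhds_x_imp_x unfolding E_def by blast
      then show ?case using elim y by blast
    qed
    then show "\<exists>T. open T \<and> y \<in> T \<and> T \<subseteq> \<Omega> - E" unfolding eventually_nhds by blast
  qed
  moreover have "x \<in> E" using neg gradient_dichotomy[OF x] x by (auto simp: E_def)
  ultimately have "\<Omega> - E = {}"
    using connected_domain x unfolding connected_def E_def by blast
  then have "grad u y = 0" if "y \<in> \<Omega>" for y
    using that eventually_nhds_x_imp_x unfolding E_def by blast
  then have "(u has_derivative (\<lambda>h. 0)) (at y)" if "y \<in> \<Omega>" for y
    using has_derivative_u[OF that] that by simp
  then have "u constant_on \<Omega>"
    unfolding constant_on_def
    using has_derivative_zero_unique_connected[OF open_domain connected_domain] x by metis
  with nonconstant show False ..
qed

lemma critical_point_saddle: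
  assumes x0: "x0 \<in> \<Omega>" "grad u x0 = 0"
  obtains \<Phi> :: "complex \<Rightarrow> real^2" and m R where
    "linear \<Phi>" "bij \<Phi>" "1 \<le> m" "\<And>z. z \<in> cball 0 R \<Longrightarrow> x0 + \<Phi> z \<in> \<Omega>"
    "polar_saddle (Suc m) (\<lambda>z. u (x0 + \<Phi> z) - u x0) R"
proof -
  obtain \<Psi> :: "complex \<Rightarrow> real^2" and f A B R K where \<Psi>: "linear \<Psi>" "bij \<Psi>"
    and f: "dbar_inequality f A B R K" and dom: "\<And>z. z \<in> ball 0 R \<Longrightarrow> x0 + \<Psi> z \<in> \<Omega>"
    and f0: "\<And>z. f z = 0 \<longleftrightarrow> grad u (x0 + \<Psi> z) = 0"
    and v: "\<And>z. z \<in> ball 0 R \<Longrightarrow> ((\<lambda>z. u (x0 + \<Psi> z)) has_derivative (\<lambda>h. Re (f z * h))) (at z)"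
    by (rule complex_gradient[OF x0]) (rule that)
  interpret dbar_inequality f A B R K by fact
  have \<Psi>0: "\<Psi> 0 = 0" by (rule linear_0[OF \<Psi>(1)])
  have f00: "f 0 = 0" using f0 x0 \<Psi>0 by simp
  obtain m L where L: "L \<noteq> 0" "(\<lambda>z. f z / z ^ m) \<midarrow>0\<rightarrow> L"
  proof (rule vanishing_order)
    fix \<delta> :: real assume "\<delta> > 0" "\<And>z. z \<in> ball 0 \<delta> \<Longrightarrow> f z = 0"
    then have "\<forall>\<^sub>F z in nhds 0. grad u (x0 + \<Psi> z) = 0"
      using eventually_nhds_in_open[of "ball 0 \<delta>" 0] f0 by (auto elim!: eventually_mono)
    then have "\<forall>\<^sub>F y in nhds x0. grad u y = 0"
      by (rule eventually_affine_image(2)[OF \<Psi>, of "\<lambda>y. grad u y = 0"])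
    then have "\<forall>\<^sub>F y in at x0. grad u y = 0"
      by (simp add: eventually_at_filter eventually_mono)
    with gradient_nonzero_nearby[OF x0(1)] have "\<forall>\<^sub>F y in at x0. False"
      by eventually_elim simp
    then show thesis by simp
  qed (rule that)
  \<comment> \<open>For \<open>m = 0\<close> the limit \<open>L\<close> would be
    \<open>f 0 = 0\<close>.\<close>
  have m: "1 \<le> m"
  proof (rule ccontr)
    assume "\<not> 1 \<le> m"
    then have "f \<midarrow>0\<rightarrow> L" using L(2) by (simp add: not_le)
    moreover have "f \<midarrow>0\<rightarrow> f 0"
      using has_derivative_continuous[OF der[of 0]] R by (simp add: isCont_def)
    ultimately show False using L(1) f00 LIM_unique by metis
  qed
  \<comment> \<open>A rotation that makes the limit positive. The exponent is \<open>Suc m\<close>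
    because the chain rule contributes one more factor \<open>\<omega>\<close> than
    \<open>z ^ m\<close>.\<close>
  define \<omega> where "\<omega> = cis (- (Arg L / Suc m))"
  have \<omega>: "norm \<omega> = 1" "\<omega> \<noteq> 0" by (simp_all add: \<omega>_def)
  have \<omega>L: "L * \<omega> ^ Suc m = of_real (norm L)"
  proof -
    have "\<omega> ^ Suc m = cis (- Arg L)"
      using Complex.DeMoivre[of "- (Arg L / Suc m)" "Suc m"] by (simp add: \<omega>_def del: of_nat_Suc power_Suc)
    then show ?thesis
      using rcis_cmod_Arg[of L] by (metis (no_types, lifting) add.right_inverse cis_mult cis_zero mult.assoc mult.right_neutral rcis_def)
  qed
  define \<Phi> where "\<Phi> = (\<lambda>z. \<Psi> (\<omega> * z))"
  have lin: "linear \<Phi>"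
    unfolding \<Phi>_def
    using linear_compose[OF bounded_linear.linear[OF bounded_linear_mult_right] \<Psi>(1), of \<omega>] by (simp add: comp_def)
  have bij: "bij \<Phi>"
  proof -
    have "bij (\<lambda>z. \<omega> * z)"
      by (rule bij_betw_byWitness[where f' = "\<lambda>z. z / \<omega>"]) (use \<omega> in auto)
    then show ?thesis unfolding \<Phi>_def using bij_comp[OF _ \<Psi>(2)] by (simp add: comp_def)
  qed
  define v where "v = (\<lambda>z. u (x0 + \<Phi> z) - u x0)"
  define g where "g = (\<lambda>z. f (\<omega> * z) * \<omega>)"
  have inb: "\<omega> * z \<in> ball 0 R" if "z \<in> ball 0 R" for z
    using that \<omega> by (simp add: norm_mult)
  have dv: "(v has_derivative (\<lambda>h. Re (g z * h))) (at z)" if "z \<in> ball 0 R" for z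
  proof -
    have "((\<lambda>z. \<omega> * z) has_derivative (\<lambda>h. \<omega> * h)) (at z)" by (auto intro!: derivative_eq_intros)
    from has_derivative_compose[OF this v[OF inb[OF that]]]
    have "((\<lambda>z. u (x0 + \<Phi> z)) has_derivative (\<lambda>h. Re (f (\<omega> * z) * (\<omega> * h)))) (at z)"
      by (simp add: \<Phi>_def)
    from has_derivative_diff[OF this has_derivative_const[of "u x0"]]
    show ?thesis unfolding v_def g_def by (simp add: mult.assoc)
  qed
  have "(\<lambda>z. g z / z ^ m) \<midarrow>0\<rightarrow> of_real (norm L)"
  proof -
    have "filterlim (\<lambda>z. \<omega> * z) (at 0) (at 0)"
      unfolding filterlim_at using \<omega> by (auto intro!: tendsto_eq_intros simp: eventually_at_filter)
    from filterlim_compose[OF L(2) this]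
    have "(\<lambda>z. f (\<omega> * z) / (\<omega> * z) ^ m * \<omega> ^ Suc m) \<midarrow>0\<rightarrow> L * \<omega> ^ Suc m"
      by (rule tendsto_mult_right)
    moreover have "(\<lambda>z. f (\<omega> * z) / (\<omega> * z) ^ m * \<omega> ^ Suc m) = (\<lambda>z. g z / z ^ m)"
      using \<omega> by (simp add: fun_eq_iff g_def power_mult_distrib)
    ultimately show ?thesis by (simp only: \<omega>L)
  qed
  then obtain r0 where r0: "0 < r0" "r0 < R" "polar_saddle (Suc m) v r0"
    using polar_saddleI[OF R m _ dv, of "norm L"] L(1) f00 linear_0[OF lin] by (auto simp: v_def g_def)
  show thesis
  proof (rule that[OF lin bij m])
    show "x0 + \<Phi> z \<in> \<Omega>" if "z \<in> cball 0 r0" for z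
      unfolding \<Phi>_def using that r0 by (intro dom inb) auto
    show "polar_saddle (Suc m) (\<lambda>z. u (x0 + \<Phi> z) - u x0) r0"
      using r0(3) unfolding v_def .
  qed
qed

text \<open>An extremum would be a critical point, and there the rays on which
  \<open>cos (n * \<theta>)\<close> is 1 and -1 carry both strict signs of \<open>u - u x\<close>
  arbitrarily close to \<open>x\<close>.\<close>

lemma no_local_extremum:
  assumes x: "x \<in> \<Omega>"
  shows "\<not> (\<forall>\<^sub>F y in at x. u x \<le> u y)" and "\<not> (\<forall>\<^sub>F y in at x. u y \<le> u x)"
proof -
  have "\<not> ((\<forall>\<^sub>F y in at x. u x \<le> u y) \<or> (\<forall>\<^sub>F y in at x. u y \<le> u x))"
  proof
    assume ext: "(\<forall>\<^sub>F y in at x. u x \<le> u y) \<or> (\<forall>\<^sub>F y in at x. u y \<le> u x)"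
    then obtain e where "e > 0"
      "(\<forall>y\<in>ball x e. u x \<le> u y) \<or> (\<forall>y\<in>ball x e. u y \<le> u x)"
      unfolding eventually_at by (metis dist_commute mem_ball order_refl UNIV_I)
    then have "(\<lambda>h. grad u x \<bullet> h) = (\<lambda>h. 0)"
      by (intro differential_zero_maxmin[where S = "ball x e", OF _ open_ball has_derivative_u[OF x]]) auto
    then have g0: "grad u x = 0" by (metis inner_eq_zero_iff)
    obtain \<Phi> :: "complex \<Rightarrow> real^2" and m R where \<Phi>: "linear \<Phi>" "bij \<Phi>"
      and p: "polar_saddle (Suc m) (\<lambda>z. u (x + \<Phi> z) - u x) R"
      by (rule critical_point_saddle[OF x g0]) (rule that)
    have R: "R > 0" using p by (simp add: polar_saddle_def)
    have ray: "filterlim (\<lambda>r. x + \<Phi> (polar r \<theta>)) (at x) (at_right 0)" for \<theta>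
      unfolding filterlim_at
    proof
      have "isCont (\<lambda>r. x + \<Phi> (polar r \<theta>)) 0"
        using \<Phi>(1) by (intro continuous_intros bounded_linear.isCont[of \<Phi>]) (simp add: linear_conv_bounded_linear)
      then have "((\<lambda>r. x + \<Phi> (polar r \<theta>)) \<longlongrightarrow> x) (at 0)"
        using linear_0[OF \<Phi>(1)] by (simp add: isCont_def)
      then show "((\<lambda>r. x + \<Phi> (polar r \<theta>)) \<longlongrightarrow> x) (at_right 0)"
        by (rule tendsto_mono[rotated]) (simp add: at_le)
      have "\<Phi> (polar r \<theta>) \<noteq> 0" if "r > 0" for r
        using that \<Phi> by (metis bij_is_inj cis_neq_zero injD less_irrefl linear_0 mult_eq_0_iff of_real_eq_0_iff)
      then show "\<forall>\<^sub>F r in at_right 0. x + \<Phi> (polar r \<theta>) \<in> UNIV \<and> x + \<Phi> (polar r \<theta>) \<noteq> x"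
        by (auto simp: eventually_at_filter)
    qed
    have small: "\<forall>\<^sub>F r in at_right (0::real). 0 < r \<and> r \<le> R"
      using R by (auto simp: eventually_at_right[of 0 1] intro!: exI[of _ R])
    from ext show False
    proof
      assume "\<forall>\<^sub>F y in at x. u x \<le> u y"
      from eventually_compose_filterlim[OF this ray[of "pi / Suc m"]] small
      have "\<forall>\<^sub>F r in at_right (0::real). False"
      proof eventually_elim
        case (elim r)
        have "cos (Suc m * (pi / Suc m)) \<le> - (1/2)" by (simp del: of_nat_Suc)
        then show ?case using polar_saddle_neg[OF p, of r] elim by fastforce
      qed
      then show False by simp
    next
      assume "\<forall>\<^sub>F y in at x. u y \<le> u x"
      from eventually_compose_filterlim[OF this ray[of 0]] small
      have "\<forall>\<^sub>F r in at_right (0::real). False"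
      proof eventually_elim
        case (elim r)
        have "cos (Suc m * (0::real)) \<ge> 1/2" by simp
        then show ?case using polar_saddle_pos[OF p, of r] elim by fastforce
      qed
      then show False by simp
    qed
  qed
  then show "\<not> (\<forall>\<^sub>F y in at x. u x \<le> u y)" "\<not> (\<forall>\<^sub>F y in at x. u y \<le> u x)" by blast+
qed

end

section \<open>The arcs of a level set\<close>

lemma cos_sin_shift:
  fixes j :: nat and t :: real
  shows "cos (j * pi + t) = (- 1) ^ j * cos t" "sin (j * pi + t) = (- 1) ^ j * sin t"
  by (simp_all add: cos_add sin_add)

lemma half_le_cos: "\<bar>t\<bar> \<le> pi / 3 \<Longrightarrow> 1 / 2 \<le> cos t" for t :: real
  using cos_monotone_0_pi_le[of "\<bar>t\<bar>" "pi / 3"] by (simp add: cos_60)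

lemma half_le_sin: "pi / 3 \<le> t \<Longrightarrow> t \<le> 2 * pi / 3 \<Longrightarrow> 1 / 2 \<le> sin t" for t :: real
proof -
  assume "pi / 3 \<le> t" "t \<le> 2 * pi / 3"
  then have "\<bar>t - pi / 2\<bar> \<le> pi / 3"
    using pi_gt_zero unfolding abs_le_iff by (intro conjI) linarith+
  then show ?thesis using half_le_cos[of "t - pi / 2"] by (simp add: cos_diff)
qed

lemma cos_le_neg_half: "2 * pi / 3 \<le> t \<Longrightarrow> t \<le> pi \<Longrightarrow> cos t \<le> - (1 / 2)" for t :: real
  using half_le_cos[of "pi - t"] by (simp add: cos_diff abs_le_iff)

locale saddle =
  fixes n :: nat and v :: "complex \<Rightarrow> real" and R :: real
  assumes saddle: "polar_saddle n v R"
begin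

lemma n: "2 \<le> n" and R: "0 < R" and v0: "v 0 = 0" and contv: "continuous_on (cball 0 R) v"
  using saddle by (simp_all add: polar_saddle_def)

text \<open>Here \<open>n * \<theta>\<close> is within \<open>pi / 6\<close> of the zero
  \<open>j * pi + pi / 2\<close> of the cosine. In such a window the sine has absolute value at
  least one half, so \<open>v\<close> is strictly monotone in the angle; outside all windows the
  cosine decides the sign of \<open>v\<close>.\<close>

definition angles :: "nat \<Rightarrow> real set" where
  "angles j = {(j + 1/3) * pi / n .. (j + 2/3) * pi / n}"

definition branch :: "nat \<Rightarrow> complex set" where
  "branch j = {z \<in> (\<lambda>(r,\<theta>). polar r \<theta>) ` ({0..R} \<times> angles j). v z = 0}"

lemma angles_iff:
  fixes \<theta> :: real
  shows "\<theta> \<in> angles j \<longleftrightarrow> pi / 3 \<le> n * \<theta> - j * pi \<and> n * \<theta> - j * pi \<le> 2 * pi / 3"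
  using n by (simp add: angles_def field_simps)

lemma angles_floor:
  fixes \<theta> :: real
  assumes "\<theta> \<in> angles j"
  shows "\<lfloor>n * \<theta> / pi\<rfloor> = int j"
proof -
  have "real j * pi < n * \<theta>" "n * \<theta> < (real j + 1) * pi"
    using assms pi_gt_zero unfolding angles_iff distrib_right by linarith+
  then show ?thesis by (simp add: floor_eq_iff field_simps)
qed

lemma angles_bounds:
  fixes \<theta> :: real
  assumes "\<theta> \<in> angles j" "j < 2 * n"
  shows "0 < \<theta>" "\<theta> < 2 * pi"
proof -
  have "0 \<le> real j * pi" by simp
  then have "0 < n * \<theta>"
    using assms pi_gt_zero unfolding angles_iff by linarith
  then show "0 < \<theta>" using n by (simp add: zero_less_mult_iff)
  have "n * \<theta> < (real j + 1) * pi"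
    using assms pi_gt_zero unfolding angles_iff distrib_right by linarith
  also have "\<dots> \<le> real (2 * n) * pi"
    using assms(2) by (intro mult_right_mono) auto
  finally have "n * \<theta> < n * (2 * pi)" by (simp add: mult_ac)
  then show "\<theta> < 2 * pi" using n by simp
qed

lemma branchE:
  assumes "z \<in> branch j"
  obtains r \<theta> :: real where "0 \<le> r" "r \<le> R" "\<theta> \<in> angles j" "z = polar r \<theta>" "norm z = r" "v z = 0"
  using assms by (auto simp: branch_def norm_mult)

lemma branchI:
  fixes r \<theta> :: real
  shows "0 \<le> r \<Longrightarrow> r \<le> R \<Longrightarrow> \<theta> \<in> angles j \<Longrightarrow> v (polar r \<theta>) = 0 \<Longrightarrow> polar r \<theta> \<in> branch j"
  by (force simp: branch_def)

lemma angles_nonempty: "(j + 1/2) * pi / n \<in> angles j"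
  using n pi_gt_zero by (simp add: angles_iff field_simps)

lemma zero_in_branch: "0 \<in> branch j"
  using branchI[OF _ _ angles_nonempty, of 0] R v0 by simp

lemma compact_branch: "compact (branch j)"
proof -
  let ?W = "(\<lambda>(r,\<theta>). polar r \<theta>) ` ({0..R} \<times> angles j)"
  have W: "compact ?W"
    unfolding split_beta angles_def
    by (intro compact_continuous_image compact_Times continuous_intros) auto
  have "?W \<subseteq> cball 0 R" by (auto simp: norm_mult)
  then have "closed (?W \<inter> v -` {0})"
    using W contv continuous_on_subset by (intro continuous_closed_preimage compact_imp_closed) auto
  moreover have "branch j = ?W \<inter> (?W \<inter> v -` {0})" by (auto simp: branch_def)
  ultimately show ?thesis using W by (metis compact_Int_closed)
qed

text \<open>The factor \<open>(- 1) ^ j\<close> cancels the sign of the sine on the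
  \<open>j\<close>-th window, so that one monotonicity argument serves both parities.\<close>

lemma radial_sign:
  fixes r \<theta> :: real
  assumes r: "0 < r" "r \<le> R" and \<theta>: "\<theta> \<in> angles j"
  obtains D where "((\<lambda>\<theta>. (- 1) ^ j * v (polar r \<theta>)) has_real_derivative D) (at \<theta>)" "D < 0"
proof -
  define t where "t = n * \<theta> - j * pi"
  have nt: "n * \<theta> = j * pi + t" by (simp add: t_def)
  have s: "1 / 2 \<le> sin t" using \<theta> unfolding angles_iff t_def by (intro half_le_sin) auto
  obtain D where D: "((\<lambda>\<theta>. v (polar r \<theta>)) has_real_derivative D) (at \<theta>)"
    "1/2 \<le> sin (n * \<theta>) \<longrightarrow> D < 0" "sin (n * \<theta>) \<le> - (1/2) \<longrightarrow> 0 < D"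
    using polar_saddle_deriv[OF saddle r, of \<theta>] by blast
  show thesis
  proof (rule that)
    show "((\<lambda>\<theta>. (- 1) ^ j * v (polar r \<theta>)) has_real_derivative (- 1) ^ j * D) (at \<theta>)"
      using D(1) by (rule DERIV_cmult)
    show "(- 1) ^ j * D < 0"
      using D(2,3) s unfolding nt cos_sin_shift by (cases "even j") auto
  qed
qed

lemma branch_unique:
  assumes z: "z \<in> branch j" and w: "w \<in> branch j" and eq: "norm z = norm w"
  shows "z = w"
proof (cases "norm z = 0")
  case True
  then show ?thesis using eq by simp
next
  case False
  obtain \<theta> where \<theta>: "\<theta> \<in> angles j" "z = polar (norm z) \<theta>" "v z = 0" "norm z \<le> R"
    using z by (metis branchE)
  obtain \<phi> where \<phi>: "\<phi> \<in> angles j" "w = polar (norm z) \<phi>" "v w = 0"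
    using w eq by (metis branchE)
  have r: "0 < norm z" "norm z \<le> R" using False \<theta> by auto
  have dec: False if "x \<in> angles j" "y \<in> angles j" "x < y"
      "v (polar (norm z) x) = 0" "v (polar (norm z) y) = 0" for x y
  proof -
    have "(- 1) ^ j * v (polar (norm z) y) < (- 1) ^ j * v (polar (norm z) x)"
    proof (rule DERIV_neg_imp_decreasing[OF that(3)])
      fix t assume "x \<le> t" "t \<le> y"
      then have "t \<in> angles j" using that(1,2) by (auto simp: angles_def)
      then show "\<exists>D. ((\<lambda>\<theta>. (- 1) ^ j * v (polar (norm z) \<theta>)) has_real_derivative D) (at t) \<and> D < 0"
        using radial_sign[OF r] by metis
    qed
    then show False using that by simp
  qed
  have "\<theta> = \<phi>"
    using dec[of \<theta> \<phi>] dec[of \<phi> \<theta>] \<theta> \<phi> by (metis linorder_neqE_linordered_idom)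
  then show ?thesis using \<theta>(2) \<phi>(2) by simp
qed

text \<open>At the two ends of a window \<open>cos (n * \<theta>)\<close> takes the values one half
  and minus one half. This is just enough to give \<open>v\<close> opposite signs, and the
  intermediate value theorem applies.\<close>

lemma branch_exists:
  assumes r: "0 \<le> r" "r \<le> R"
  shows "\<exists>z\<in>branch j. norm z = r"
proof (cases "r = 0")
  case True
  then show ?thesis using zero_in_branch by (intro bexI[of _ 0]) auto
next
  case False
  then have r0: "0 < r" using r by simp
  define \<alpha> \<beta> where "\<alpha> = (j + 1/3) * pi / n" and "\<beta> = (j + 2/3) * pi / n"
  define G where "G = (\<lambda>\<theta>. (- 1) ^ j * v (polar r \<theta>))"
  have n\<alpha>: "n * \<alpha> = j * pi + pi / 3" and n\<beta>: "n * \<beta> = j * pi + 2 * pi / 3"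
    using n by (auto simp: \<alpha>_def \<beta>_def field_simps)
  have "\<alpha> \<le> \<beta>" unfolding \<alpha>_def \<beta>_def using n by (intro divide_right_mono mult_right_mono) auto
  have "0 \<le> G \<alpha>"
    using half_le_cos[of "pi / 3"] polar_saddle_pos[OF saddle r0 r(2), of \<alpha>] polar_saddle_neg[OF saddle r0 r(2), of \<alpha>]
    unfolding n\<alpha> cos_sin_shift G_def by (cases "even j") auto
  moreover have "G \<beta> \<le> 0"
    using cos_le_neg_half[of "2 * pi / 3"] polar_saddle_pos[OF saddle r0 r(2), of \<beta>] polar_saddle_neg[OF saddle r0 r(2), of \<beta>]
    unfolding n\<beta> cos_sin_shift G_def by (cases "even j") auto
  moreover have "continuous_on {\<alpha>..\<beta>} G"
  proof (intro continuous_at_imp_continuous_on ballI)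
    fix x assume "x \<in> {\<alpha>..\<beta>}"
    then have "x \<in> angles j" by (simp add: angles_def \<alpha>_def \<beta>_def)
    then show "isCont G x" using radial_sign[OF r0 r(2)] DERIV_isCont unfolding G_def by metis
  qed
  ultimately obtain \<theta> where "\<alpha> \<le> \<theta>" "\<theta> \<le> \<beta>" "G \<theta> = 0"
    using IVT2'[of G \<beta> 0 \<alpha>] \<open>\<alpha> \<le> \<beta>\<close> by auto
  then have "polar r \<theta> \<in> branch j"
    using r by (intro branchI) (auto simp: angles_def \<alpha>_def \<beta>_def G_def)
  then show ?thesis using r by (intro bexI) (auto simp: norm_mult)
qed

lemma branch_subset: "branch j \<subseteq> {z \<in> cball 0 R. v z = 0}"
  by (auto elim!: branchE)

lemma zero_set_eq: "{z \<in> cball 0 R. v z = 0} = (\<Union>j<2*n. branch j)"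
proof
  show "(\<Union>j<2*n. branch j) \<subseteq> {z \<in> cball 0 R. v z = 0}" using branch_subset by blast
  show "{z \<in> cball 0 R. v z = 0} \<subseteq> (\<Union>j<2*n. branch j)"
  proof
    fix z assume z: "z \<in> {z \<in> cball 0 R. v z = 0}"
    show "z \<in> (\<Union>j<2*n. branch j)"
    proof (cases "z = 0")
      case True
      then show ?thesis using zero_in_branch[of 0] n by (intro UN_I[of 0]) auto
    next
      case False
      define \<theta> where "\<theta> = Arg2pi z"
      have \<theta>: "0 \<le> \<theta>" "\<theta> < 2 * pi" "z = polar (norm z) \<theta>"
        using Arg2pi[of z] by (simp_all add: \<theta>_def cis_conv_exp is_Arg_def)
      have r: "0 < norm z" "norm z \<le> R" using z False by auto
      define j where "j = nat \<lfloor>n * \<theta> / pi\<rfloor>"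
      define t where "t = n * \<theta> - j * pi"
      have nonneg: "0 \<le> n * \<theta> / pi" using \<theta> by simp
      have j: "real j \<le> n * \<theta> / pi" "n * \<theta> / pi < real j + 1"
        unfolding j_def using nonneg by (simp_all add: of_nat_nat)
      have t: "0 \<le> t" "t < pi"
        using j by (simp_all add: t_def field_simps)
      have "n * \<theta> / pi < 2 * n" using \<theta> n by (simp add: field_simps)
      then have "j < 2 * n" using j by linarith
      have nt: "n * \<theta> = j * pi + t" by (simp add: t_def)
      have v: "v (polar (norm z) \<theta>) = 0" using z \<theta>(3) by simp
      \<comment> \<open>Outside the middle third of a half-period the cosine has absolute value at
        least one half, so \<open>v\<close> cannot vanish.\<close>
      have "\<not> t < pi / 3"
        using half_le_cos[of t] t polar_saddle_pos[OF saddle r, of \<theta>] polar_saddle_neg[OF saddle r, of \<theta>] v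
        unfolding nt cos_sin_shift by (cases "even j") auto
      moreover have "\<not> 2 * pi / 3 < t"
        using cos_le_neg_half[of t] t polar_saddle_pos[OF saddle r, of \<theta>] polar_saddle_neg[OF saddle r, of \<theta>] v
        unfolding nt cos_sin_shift by (cases "even j") auto
      ultimately have "\<theta> \<in> angles j" by (simp add: angles_iff t_def)
      then have "z \<in> branch j" using branchI[of "norm z" \<theta> j] r v \<theta>(3) by simp
      then show ?thesis using \<open>j < 2 * n\<close> by blast
    qed
  qed
qed

lemma branch_disjoint:
  assumes "i < 2 * n" "j < 2 * n" "i \<noteq> j"
  shows "branch i \<inter> branch j = {0}"
proof -
  have "z = 0" if "z \<in> branch i" "z \<in> branch j" for z
  proof (rule ccontr)
    assume "z \<noteq> 0"
    from that(1) obtain r \<theta> where "0 \<le> r" "r \<le> R" and \<theta>: "\<theta> \<in> angles i"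
      and zr: "z = polar r \<theta>" "norm z = r" "v z = 0" by (rule branchE)
    from that(2) obtain s \<phi> where "0 \<le> s" "s \<le> R" and \<phi>: "\<phi> \<in> angles j"
      and zs: "z = polar s \<phi>" "norm z = s" "v z = 0" by (rule branchE)
    have "0 < r" using zr \<open>0 \<le> r\<close> \<open>z \<noteq> 0\<close> by (cases "r = 0") auto
    then have "\<theta> = \<phi>"
      using zr(1) zs(1) \<open>0 \<le> s\<close> angles_bounds[OF \<theta> assms(1)] angles_bounds[OF \<phi> assms(2)]
      by (intro polar_eq_imp_eq(2)[of r \<theta> s \<phi>]) auto
    then have "int i = int j" using angles_floor[OF \<theta>] angles_floor[OF \<phi>] by simp
    then show False using assms by simp
  qed
  then show ?thesis using zero_in_branch by blast
qed

text \<open>\<open>norm\<close> is a continuous bijection from the compact branch onto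
  \<open>{0..R}\<close>, so its inverse is continuous: the radius parametrises the branch, and no
  implicit function theorem is involved.\<close>

lemma branch_arc:
  obtains g where "arc g" "pathstart g = 0" "pathfinish g \<noteq> 0" "path_image g = branch j"
proof -
  define h where "h = inv_into (branch j) norm"
  have im: "norm ` branch j = {0..R}"
  proof
    show "norm ` branch j \<subseteq> {0..R}" by (auto elim!: branchE)
    show "{0..R} \<subseteq> norm ` branch j"
      using branch_exists[of _ j] by fastforce
  qed
  have inj: "inj_on norm (branch j)" by (rule inj_onI) (rule branch_unique)
  have cont: "continuous_on {0..R} h"
    unfolding im[symmetric] h_def
    by (intro continuous_on_inv compact_branch continuous_intros) (simp add: inv_into_f_f inj)
  have h: "h r \<in> branch j" "norm (h r) = r" if "r \<in> {0..R}" for r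
    using that unfolding h_def im[symmetric] by (auto intro: inv_into_into f_inv_into_f)
  define g where "g = (\<lambda>t. h (R * t))"
  have Rt: "R * t \<in> {0..R}" if "t \<in> {0..1}" for t
    using that R by (simp add: mult_left_le)
  have ng: "norm (g t) = R * t" if "t \<in> {0..1}" for t
    using h(2)[OF Rt[OF that]] by (simp add: g_def)
  show thesis
  proof (rule that)
    have "continuous_on {0..1} g"
      unfolding g_def by (rule continuous_on_compose2[OF cont]) (use Rt in \<open>auto intro!: continuous_intros\<close>)
    moreover have "inj_on g {0..1}"
      using ng R by (intro inj_onI) (metis mult_cancel_left less_irrefl)
    ultimately show "arc g" by (simp add: arc_def path_def)
    have "norm (g 0) = 0" using ng[of 0] by simp
    then show "pathstart g = 0" by (simp add: pathstart_def)
    have "norm (g 1) \<noteq> 0" using ng[of 1] R by simp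
    then show "pathfinish g \<noteq> 0" by (simp add: pathfinish_def)
    show "path_image g = branch j"
    proof
      show "path_image g \<subseteq> branch j"
        unfolding path_image_def g_def using h(1) Rt by blast
      show "branch j \<subseteq> path_image g"
      proof
        fix z assume z: "z \<in> branch j"
        then have nz: "norm z \<in> {0..R}" using im by blast
        have "z = h (norm z)" unfolding h_def using z inj by simp
        also have "\<dots> = g (norm z / R)" using R by (simp add: g_def)
        finally show "z \<in> path_image g"
          unfolding path_image_def using nz R by (intro image_eqI) (auto simp: divide_le_eq)
      qed
    qed
  qed
qed

lemma zero_set_arcs:
  obtains \<gamma> where "{z \<in> cball 0 R. v z = 0} = (\<Union>i<n. path_image (\<gamma> i))"
    "\<forall>i<n. arc (\<gamma> i) \<and> 0 \<in> path_image (\<gamma> i) - {pathstart (\<gamma> i), pathfinish (\<gamma> i)}"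
    "\<forall>i<n. \<forall>j<n. i \<noteq> j \<longrightarrow> path_image (\<gamma> i) \<inter> path_image (\<gamma> j) = {0}"
proof -
  have "\<exists>g. arc g \<and> pathstart g = 0 \<and> pathfinish g \<noteq> 0 \<and> path_image g = branch j" for j
    using branch_arc[of j] by metis
  then obtain g where g: "\<And>j. arc (g j)" "\<And>j. pathstart (g j) = 0" "\<And>j. pathfinish (g j) \<noteq> 0"
    "\<And>j. path_image (g j) = branch j"
    by metis
  \<comment> \<open>Branch \<open>i\<close> is continued by branch \<open>i + n\<close>, which turns
    \<open>2 * n\<close> half-branches into \<open>n\<close> arcs through 0.\<close>
  define \<gamma> where "\<gamma> = (\<lambda>i. reversepath (g i) +++ g (i + n))"
  have im: "path_image (\<gamma> i) = branch i \<union> branch (i + n)" for i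
    unfolding \<gamma>_def using g by (subst path_image_join) auto
  show thesis
  proof (rule that)
    show "{z \<in> cball 0 R. v z = 0} = (\<Union>i<n. path_image (\<gamma> i))"
    proof -
      have "{..<2*n} = {..<n} \<union> (\<lambda>i. i + n) ` {..<n}"
      proof (intro equalityI subsetI)
        fix i assume "i \<in> {..<2*n}"
        then have "i < n \<or> i = (i - n) + n \<and> i - n < n" by auto
        then show "i \<in> {..<n} \<union> (\<lambda>i. i + n) ` {..<n}" by blast
      qed auto
      then show ?thesis unfolding zero_set_eq im by auto
    qed
    show "\<forall>i<n. arc (\<gamma> i) \<and> 0 \<in> path_image (\<gamma> i) - {pathstart (\<gamma> i), pathfinish (\<gamma> i)}"
    proof (intro allI impI conjI)
      fix i assume i: "i < n"
      show "arc (\<gamma> i)"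
        unfolding \<gamma>_def
      proof (rule arc_join)
        show "path_image (reversepath (g i)) \<inter> path_image (g (i + n)) \<subseteq> {pathstart (g (i + n))}"
          using branch_disjoint[of i "i + n"] i g n by simp
      qed (use g in \<open>auto simp: arc_reversepath\<close>)
      show "0 \<in> path_image (\<gamma> i) - {pathstart (\<gamma> i), pathfinish (\<gamma> i)}"
        unfolding im using zero_in_branch[of i] g(3)[of i] g(3)[of "i + n"] by (simp add: \<gamma>_def)
    qed
    show "\<forall>i<n. \<forall>j<n. i \<noteq> j \<longrightarrow> path_image (\<gamma> i) \<inter> path_image (\<gamma> j) = {0}"
    proof (intro allI impI)
      fix i j assume ij: "i < n" "j < n" "i \<noteq> j"
      have "branch i \<inter> branch j = {0}" "branch i \<inter> branch (j + n) = {0}"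
        "branch (i + n) \<inter> branch j = {0}" "branch (i + n) \<inter> branch (j + n) = {0}"
        by (rule branch_disjoint; use ij in simp)+
      then show "path_image (\<gamma> i) \<inter> path_image (\<gamma> j) = {0}" unfolding im by blast
    qed
  qed
qed

end

context quasilinear_solution
begin

lemma crit_multiplicity_exists:
  assumes "x0 \<in> \<Omega>" and \<Phi>: "linear \<Phi>" "bij \<Phi>"
    and m: "1 \<le> m" and dom: "\<And>z. z \<in> cball 0 R \<Longrightarrow> x0 + \<Phi> z \<in> \<Omega>"
    and saddle: "polar_saddle (Suc m) (\<lambda>z. u (x0 + \<Phi> z) - u x0) R"
  shows "has_crit_multiplicity u \<Omega> x0 m"
proof -
  interpret saddle "Suc m" "\<lambda>z. u (x0 + \<Phi> z) - u x0" R by unfold_locales (fact saddle)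
  obtain \<gamma> where \<gamma>: "{z \<in> cball 0 R. u (x0 + \<Phi> z) - u x0 = 0} = (\<Union>i<Suc m. path_image (\<gamma> i))"
    "\<forall>i<Suc m. arc (\<gamma> i) \<and> 0 \<in> path_image (\<gamma> i) - {pathstart (\<gamma> i), pathfinish (\<gamma> i)}"
    "\<forall>i<Suc m. \<forall>j<Suc m. i \<noteq> j \<longrightarrow> path_image (\<gamma> i) \<inter> path_image (\<gamma> j) = {0}"
    using zero_set_arcs by blast
  define X where "X = (\<lambda>z. x0 + \<Phi> z)"
  have X0: "X 0 = x0" using linear_0[OF \<Phi>(1)] by (simp add: X_def)
  have injX: "inj X" using \<Phi>(2) by (auto simp: X_def inj_def bij_def)
  have X_eq: "X = (\<lambda>x. x0 + x) \<circ> \<Phi>" by (simp add: X_def fun_eq_iff)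
  have arcX: "arc (X \<circ> g) \<longleftrightarrow> arc g" for g
    unfolding X_eq comp_assoc arc_translation_eq using \<Phi> by (simp add: arc_linear_image_eq bij_is_inj)
  have "open (X ` ball 0 R)"
    unfolding X_eq image_comp[symmetric]
    using \<Phi> by (intro open_translation open_surjective_linear_image) (auto simp: bij_is_surj)
  then have "x0 \<in> interior (X ` cball 0 R)"
    using R X0 by (intro interiorI[of "X ` ball 0 R"] image_mono ball_subset_cball)
      (simp_all add: image_eqI[of _ _ 0])
  moreover have "X ` cball 0 R \<subseteq> \<Omega>" using dom by (auto simp: X_def)
  moreover have "{x \<in> X ` cball 0 R. u x = u x0} = (\<Union>i<m+1. path_image (X \<circ> \<gamma> i))"
  proof -
    have "{x \<in> X ` cball 0 R. u x = u x0} = X ` {z \<in> cball 0 R. u (x0 + \<Phi> z) - u x0 = 0}"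
      by (auto simp: X_def)
    then show ?thesis unfolding \<gamma>(1) path_image_compose image_UN by simp
  qed
  moreover have "arc (X \<circ> \<gamma> i) \<and> x0 \<in> path_image (X \<circ> \<gamma> i) - {pathstart (X \<circ> \<gamma> i), pathfinish (X \<circ> \<gamma> i)}"
    if "i < m + 1" for i
  proof -
    have "arc (\<gamma> i)" "0 \<in> path_image (\<gamma> i)" "0 \<noteq> pathstart (\<gamma> i)" "0 \<noteq> pathfinish (\<gamma> i)"
      using \<gamma>(2) that by auto
    then show ?thesis
      unfolding path_image_compose pathstart_compose pathfinish_compose arcX
      using X0 injX by (auto simp: inj_def)
  qed
  moreover have "path_image (X \<circ> \<gamma> i) \<inter> path_image (X \<circ> \<gamma> j) = {x0}"
    if "i < m + 1" "j < m + 1" "i \<noteq> j" for i j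
    unfolding path_image_compose image_Int[OF injX, symmetric] using \<gamma>(3) that X0 by simp
  ultimately show ?thesis
    unfolding has_crit_multiplicity_def using m by (intro conjI exI[of _ "X ` cball 0 R"] exI[of _ "\<lambda>i. X \<circ> \<gamma> i"]) auto
qed

end

section \<open>Uniqueness of the multiplicity\<close>

text \<open>Arcs through \<open>x0\<close> are cut there into half-branches, because a level set
  determines the number of its half-branches but not their pairing into arcs.\<close>

definition star :: "'i set \<Rightarrow> ('i \<Rightarrow> real \<Rightarrow> 'a::euclidean_space) \<Rightarrow> 'a \<Rightarrow> bool" where
  "star I h x0 \<longleftrightarrow> finite I \<and> (\<forall>k\<in>I. arc (h k) \<and> pathstart (h k) = x0) \<and>
     (\<forall>k\<in>I. \<forall>l\<in>I. k \<noteq> l \<longrightarrow> path_image (h k) \<inter> path_image (h l) = {x0})"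

lemma star_Int: "star I h x0 \<Longrightarrow> k \<in> I \<Longrightarrow> l \<in> I \<Longrightarrow> k \<noteq> l \<Longrightarrow> path_image (h k) \<inter> path_image (h l) = {x0}"
  unfolding star_def by blast

text \<open>Branches are closed and meet only in \<open>x0\<close>, so a connected set that avoids
  \<open>x0\<close> cannot pass from one to another.\<close>

lemma star_branch_in_branch:
  assumes star: "star J g x0" and C: "connected C" "C \<noteq> {}" "x0 \<notin> C"
    and sub: "C \<subseteq> (\<Union>j\<in>J. path_image (g j))"
  shows "\<exists>j\<in>J. C \<subseteq> path_image (g j)"
proof -
  obtain c j where cj: "c \<in> C" "j \<in> J" "c \<in> path_image (g j)" using C sub by blast
  define T where "T = (\<Union>l\<in>J - {j}. path_image (g l))"
  have "closed (path_image (g j))"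
    using star cj(2) by (simp add: star_def closed_arc_image)
  moreover have "closed T"
    unfolding T_def using star by (intro closed_UN) (auto simp: star_def closed_arc_image)
  moreover have "C \<subseteq> path_image (g j) \<union> T" using sub cj unfolding T_def by blast
  moreover have "path_image (g j) \<inter> T \<inter> C = {}"
  proof -
    have "y = x0" if "l \<in> J - {j}" "y \<in> path_image (g j)" "y \<in> path_image (g l)" for l y
      using star_Int[OF star cj(2), of l] that by auto
    then show ?thesis using C(3) unfolding T_def by blast
  qed
  ultimately have "path_image (g j) \<inter> C = {} \<or> T \<inter> C = {}"
    using connected_closedD[OF C(1)] by blast
  then have "C \<subseteq> path_image (g j)" using \<open>C \<subseteq> path_image (g j) \<union> T\<close> cj by blast
  then show ?thesis using cj by blast
qed

text \<open>A short initial piece of each \<open>h k\<close> lies in a single \<open>g j\<close>.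
  Two arcs assigned to the same \<open>g j\<close> would both cover an initial piece of it and so
  meet outside \<open>x0\<close>; hence the assignment is injective.\<close>

lemma star_card_le:
  assumes I: "star I h x0" and J: "star J g x0" and W: "open W" "x0 \<in> W"
    and sub: "\<And>k. k \<in> I \<Longrightarrow> path_image (h k) \<inter> W \<subseteq> (\<Union>j\<in>J. path_image (g j))"
  shows "card I \<le> card J"
proof -
  have arch: "arc (h k)" "h k 0 = x0" if "k \<in> I" for k
    using I that by (auto simp: star_def pathstart_def)
  have arcg: "arc (g j)" "g j 0 = x0" if "j \<in> J" for j
    using J that by (auto simp: star_def pathstart_def)
  have "\<exists>e j. 0 < e \<and> e \<le> 1 \<and> j \<in> J \<and> h k ` {0..e} \<subseteq> path_image (g j)" if k: "k \<in> I" for k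
  proof -
    have cont: "continuous_on {0..1} (h k)" and inj: "inj_on (h k) {0..1}"
      using arch[OF k] by (auto simp: arc_def path_def)
    obtain d where d: "d > 0" "ball x0 d \<subseteq> W" using W open_contains_ball by blast
    obtain e where e: "e > 0" "\<And>t. t \<in> {0..1} \<Longrightarrow> dist t 0 < e \<Longrightarrow> dist (h k t) (h k 0) < d"
      using cont d(1) unfolding continuous_on_iff by (metis atLeastAtMost_iff order_refl zero_le_one)
    define e' where "e' = min (e / 2) 1"
    have e': "0 < e'" "e' \<le> 1" "e' < e" using e by (auto simp: e'_def)
    have hW: "h k t \<in> W" if "t \<in> {0..e'}" for t
      using e(2)[of t] that e' d arch[OF k] by (auto simp: dist_commute subset_iff)
    define C where "C = h k ` {0<..e'}"
    have CI: "C \<subseteq> path_image (h k)" unfolding C_def path_image_def using e' by (intro image_mono) auto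
    have x0C: "x0 \<notin> C"
    proof
      assume "x0 \<in> C"
      then obtain t where "t \<in> {0<..e'}" "h k t = h k 0" using arch[OF k] by (auto simp: C_def)
      then show False using inj e' by (auto dest!: inj_onD)
    qed
    have "connected C" unfolding C_def
      using cont e' by (intro connected_continuous_image continuous_on_subset[OF cont]) auto
    moreover have "C \<noteq> {}" using e' by (simp add: C_def)
    moreover have "C \<subseteq> (\<Union>j\<in>J. path_image (g j))"
    proof -
      have "C \<subseteq> W" unfolding C_def using hW by auto
      then show ?thesis using sub[OF k] CI by blast
    qed
    ultimately obtain j where j: "j \<in> J" "C \<subseteq> path_image (g j)"
      using star_branch_in_branch[OF J _ _ x0C] by blast
    have "x0 \<in> path_image (g j)" using arcg[OF j(1)] by (auto simp: path_image_def)
    moreover have "{0..e'} = insert 0 {0<..e'}" using e' by auto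
    ultimately have "h k ` {0..e'} \<subseteq> path_image (g j)" using j(2) arch[OF k] by (simp add: C_def)
    then show ?thesis using e' j by blast
  qed
  then obtain e \<phi> where e: "\<And>k. k \<in> I \<Longrightarrow> 0 < e k \<and> e k \<le> 1"
    and \<phi>: "\<And>k. k \<in> I \<Longrightarrow> \<phi> k \<in> J" "\<And>k. k \<in> I \<Longrightarrow> h k ` {0..e k} \<subseteq> path_image (g (\<phi> k))"
    by metis
  have "inj_on \<phi> I"
  proof (rule inj_onI, rule ccontr)
    fix k l assume kl: "k \<in> I" "l \<in> I" "\<phi> k = \<phi> l" "k \<noteq> l"
    define j where "j = \<phi> k"
    have j: "j \<in> J" using \<phi> kl by (simp add: j_def)
    obtain q where q: "homeomorphism {0..1} (path_image (g j)) (g j) q"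
      using arcg(1)[OF j] by (rule homeomorphism_arc)
    have qg: "q (g j t) = t" if "t \<in> {0..1}" for t
      using q that by (simp add: homeomorphism_def)
    have gq: "g j (q x) = x" "q x \<in> {0..1}" if "x \<in> path_image (g j)" for x
      using q that by (auto simp: homeomorphism_def)
    \<comment> \<open>In the parameter of \<open>g j\<close>, the initial piece of
      \<open>h i\<close> is a connected set containing 0 and some \<open>a > 0\<close>, hence all of
      \<open>{0..a}\<close>.\<close>
    have initial: "\<exists>a. 0 < a \<and> a \<le> 1 \<and> g j ` {0..a} \<subseteq> path_image (h i)" if i: "i \<in> I" "\<phi> i = j" for i
    proof -
      define a where "a = q (h i (e i))"
      have sub: "h i ` {0..e i} \<subseteq> path_image (g j)" using \<phi> i by blast
      have "continuous_on {0..e i} (h i)"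
        using arch[OF i(1)] e[OF i(1)] by (auto simp: arc_def path_def elim!: continuous_on_subset)
      then have conn: "connected (q ` h i ` {0..e i})"
        using q sub by (intro connected_continuous_image continuous_on_subset[OF homeomorphism_cont2[OF q]]) auto
      have "q (h i 0) = 0" using qg[of 0] arcg[OF j] arch[OF i(1)] by simp
      then have "0 \<in> q ` h i ` {0..e i}" using e[OF i(1)] by (force simp: image_iff)
      moreover have ain: "a \<in> q ` h i ` {0..e i}" using e[OF i(1)] by (auto simp: a_def)
      ultimately have Icc: "{0..a} \<subseteq> q ` h i ` {0..e i}"
        using conn connected_contains_Icc by blast
      have hin: "h i (e i) \<in> path_image (g j)" using sub e[OF i(1)] by auto
      have "a \<noteq> 0"
      proof
        assume "a = 0"
        then have "h i (e i) = h i 0"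
          using gq(1)[OF hin] arcg[OF j] arch[OF i(1)] by (simp add: a_def)
        then show False
          using arch(1)[OF i(1)] e[OF i(1)] unfolding arc_def by (auto dest!: inj_onD)
      qed
      then have "0 < a" "a \<le> 1" using gq(2)[OF hin] by (auto simp: a_def)
      moreover have "g j t \<in> path_image (h i)" if t: "t \<in> {0..a}" for t
      proof -
        obtain s where s: "s \<in> {0..e i}" "t = q (h i s)" using Icc t by blast
        then have "h i s \<in> path_image (g j)" using sub by blast
        then have "g j t = h i s" using gq(1) s(2) by simp
        then show ?thesis using s e[OF i(1)] by (auto simp: path_image_def)
      qed
      ultimately show ?thesis by blast
    qed
    obtain a where a: "0 < a" "a \<le> 1" "g j ` {0..a} \<subseteq> path_image (h k)"
      using initial[of k] kl j_def by blast
    obtain b where b: "0 < b" "b \<le> 1" "g j ` {0..b} \<subseteq> path_image (h l)"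
      using initial[of l] kl j_def by auto
    have "g j (min a b) \<in> path_image (h k) \<inter> path_image (h l)"
      using a b by (intro IntI subsetD[OF a(3)] subsetD[OF b(3)] imageI) auto
    then have "g j (min a b) = g j 0" using star_Int[OF I kl(1,2,4)] arcg[OF j] by auto
    then show False
      using arcg(1)[OF j] a b unfolding arc_def by (auto dest!: inj_onD)
  qed
  moreover have "\<phi> ` I \<subseteq> J" using \<phi> by blast
  moreover have "finite J" using J by (simp add: star_def)
  ultimately show ?thesis using card_inj_on_le by blast
qed

lemma arc_initial_segment:
  assumes "arc g" "s \<in> {0..1}" "t \<in> {0..1}" "s \<noteq> t"
  shows "arc (\<lambda>r. g (s + r * (t - s)))"
proof -
  have im: "s + r * (t - s) \<in> {0..1}" if "r \<in> {0..1}" for r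
  proof -
    have "0 \<le> (1 - r) * s" "0 \<le> r * t" using that assms by auto
    moreover have "(1 - r) * s + r * t \<le> 1"
      using that assms by (intro convex_bound_le) auto
    ultimately show ?thesis by (simp add: algebra_simps)
  qed
  have "continuous_on {0..1} (\<lambda>r. g (s + r * (t - s)))"
  proof (rule continuous_on_compose2[of "{0..1}" g])
    show "continuous_on {0..1} g" using assms(1) by (simp add: arc_def path_def)
    show "continuous_on {0..1} (\<lambda>r. s + r * (t - s))" by (intro continuous_intros)
    show "(\<lambda>r. s + r * (t - s)) ` {0..1} \<subseteq> {0..1}" using im by blast
  qed
  moreover have "inj_on (\<lambda>r. g (s + r * (t - s))) {0..1}"
  proof (rule inj_onI)
    fix x y assume xy: "x \<in> {0..1}" "y \<in> {0..1}" "g (s + x * (t - s)) = g (s + y * (t - s))"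
    then have "s + x * (t - s) = s + y * (t - s)"
      using assms(1) im unfolding arc_def by (blast dest: inj_onD)
    then show "x = y" using assms(4) by simp
  qed
  ultimately show ?thesis by (simp add: arc_def path_def)
qed

lemma crit_multiplicity_star:
  assumes "has_crit_multiplicity u \<Omega> x0 m"
  obtains h V where "star ({..<m+1} \<times> (UNIV::bool set)) h x0" "x0 \<in> interior V"
    "{x\<in>V. u x = u x0} = (\<Union>k\<in>{..<m+1} \<times> UNIV. path_image (h k))"
proof -
  from assms obtain V \<gamma> where V: "x0 \<in> interior V" and "V \<subseteq> \<Omega>"
    and Z: "{x\<in>V. u x = u x0} = (\<Union>i<m+1. path_image (\<gamma> i))"
    and A: "\<forall>i<m+1. arc (\<gamma> i) \<and> x0 \<in> path_image (\<gamma> i) - {pathstart (\<gamma> i), pathfinish (\<gamma> i)}"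
    and D: "\<forall>i<m+1. \<forall>j<m+1. i \<noteq> j \<longrightarrow> path_image (\<gamma> i) \<inter> path_image (\<gamma> j) = {x0}"
    unfolding has_crit_multiplicity_def by (elim conjE exE)
  have \<gamma>: "arc (\<gamma> i)" "x0 \<in> path_image (\<gamma> i) - {pathstart (\<gamma> i), pathfinish (\<gamma> i)}"
    if "i < m+1" for i
    using A that by blast+
  have dis: "path_image (\<gamma> i) \<inter> path_image (\<gamma> j) = {x0}" if "i < m+1" "j < m+1" "i \<noteq> j" for i j
    using D that by blast
  have "\<exists>s. 0 < s \<and> s < 1 \<and> \<gamma> i s = x0" if i: "i < m + 1" for i
  proof -
    obtain s where "s \<in> {0..1}" "\<gamma> i s = x0" using \<gamma>(2)[OF i] by (auto simp: path_image_def)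
    moreover have "s \<noteq> 0" "s \<noteq> 1"
      using \<gamma>(2)[OF i] calculation by (auto simp: pathstart_def pathfinish_def)
    ultimately show ?thesis by (intro exI[of _ s]) auto
  qed
  then obtain s where s: "\<And>i. i < m+1 \<Longrightarrow> 0 < s i" "\<And>i. i < m+1 \<Longrightarrow> s i < 1"
    "\<And>i. i < m+1 \<Longrightarrow> \<gamma> i (s i) = x0" by metis
  \<comment> \<open>The two halves of an arc, both starting at \<open>x0\<close>: \<open>b\<close>
    selects the end parameter 1 or 0.\<close>
  define h where "h = (\<lambda>(i,b) r. \<gamma> i (s i + r * (of_bool b - s i)))"
  have im: "path_image (h (i,b)) = \<gamma> i ` (if b then {s i..1} else {0..s i})" if i: "i < m+1" for i b
  proof -
    have "(\<lambda>r. s i + r * (of_bool b - s i)) ` {0..1} = (if b then {s i..1} else {0..s i})"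
    proof -
      have "(\<lambda>r. s i + r * (of_bool b - s i)) ` {0..1} = closed_segment (s i) (of_bool b)"
        unfolding closed_segment_image_interval by (intro image_cong) (auto simp: algebra_simps)
      then show ?thesis using s(1,2)[OF i] by (auto simp: closed_segment_eq_real_ivl)
    qed
    moreover have "path_image (h (i,b)) = \<gamma> i ` (\<lambda>r. s i + r * (of_bool b - s i)) ` {0..1}"
      by (simp add: path_image_def h_def image_image)
    ultimately show ?thesis by (simp only:)
  qed
  have both: "path_image (h (i,True)) \<union> path_image (h (i,False)) = path_image (\<gamma> i)" if i: "i < m+1" for i
  proof -
    have "{s i..1} \<union> {0..s i} = {0..1}" using s[OF i] by auto
    then show ?thesis using im[OF i] by (simp add: path_image_def flip: image_Un)
  qed
  have sub: "path_image (h (i,b)) \<subseteq> path_image (\<gamma> i)" if "i < m+1" for i b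
    using both[OF that] by (cases b) auto
  show thesis
  proof (rule that[OF _ V])
    show "star ({..<m+1} \<times> UNIV) h x0"
      unfolding star_def
    proof (intro conjI ballI impI)
      fix k assume "k \<in> {..<m+1} \<times> (UNIV::bool set)"
      then obtain i b where k: "k = (i,b)" "i < m+1" by auto
      have "arc (\<lambda>r. \<gamma> i (s i + r * (of_bool b - s i)))"
        using s[OF k(2)] by (intro arc_initial_segment \<gamma> k(2)) auto
      then show "arc (h k)" by (simp add: h_def k)
      show "pathstart (h k) = x0" using s(3)[OF k(2)] by (simp add: pathstart_def h_def k)
      fix l assume l': "l \<in> {..<m+1} \<times> (UNIV::bool set)" "k \<noteq> l"
      then obtain j c where l: "l = (j,c)" "j < m+1" by auto
      have "pathstart (h k) = x0" "pathstart (h l) = x0"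
        using s(3) k l by (simp_all add: pathstart_def h_def)
      then have x0: "x0 \<in> path_image (h k)" "x0 \<in> path_image (h l)"
        using pathstart_in_path_image by metis+
      show "path_image (h k) \<inter> path_image (h l) = {x0}"
      proof (cases "i = j")
        case True
        then have bc: "b = (\<not> c)" using l' k l by auto
        have inj: "inj_on (\<gamma> i) {0..1}" using \<gamma>(1)[OF k(2)] by (simp add: arc_def)
        have "\<gamma> i ` {s i..1} \<inter> \<gamma> i ` {0..s i} = \<gamma> i ` ({s i..1} \<inter> {0..s i})"
          using s[OF k(2)] by (intro inj_on_image_Int[OF inj, symmetric]) auto
        also have "{s i..1} \<inter> {0..s i} = {s i}" using s[OF k(2)] by auto
        finally have "\<gamma> i ` {s i..1} \<inter> \<gamma> i ` {0..s i} = {x0}" using s(3)[OF k(2)] by simp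
        then show ?thesis using im[OF k(2)] k l True bc by (cases c) (auto simp: Int_commute)
      next
        case False
        have "path_image (h k) \<subseteq> path_image (\<gamma> i)" "path_image (h l) \<subseteq> path_image (\<gamma> j)"
          using sub[OF k(2), of b] sub[OF l(2), of c] k l by simp_all
        then show ?thesis using dis[OF k(2) l(2) False] x0 by blast
      qed
    qed simp
    show "{x\<in>V. u x = u x0} = (\<Union>k\<in>{..<m+1} \<times> UNIV. path_image (h k))"
    proof -
      have "(\<Union>k\<in>{..<m+1} \<times> UNIV. path_image (h k)) = (\<Union>i<m+1. path_image (h (i,True)) \<union> path_image (h (i,False)))"
        by (auto simp: UNIV_bool)
      also have "\<dots> = (\<Union>i<m+1. path_image (\<gamma> i))" using both by auto
      finally show ?thesis using Z by simp
    qed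
  qed
qed

text \<open>Both families describe the same level set near \<open>x0\<close>, so their numbers of
  half-branches, \<open>2 * (m + 1)\<close> and \<open>2 * (m' + 1)\<close>, can be compared.
  Exchanging the roles gives uniqueness.\<close>

lemma crit_multiplicity_le:
  assumes "has_crit_multiplicity u \<Omega> x0 m" "has_crit_multiplicity u \<Omega> x0 m'"
  shows "m \<le> m'"
proof -
  obtain h V where h: "star ({..<m+1} \<times> (UNIV::bool set)) h x0" "x0 \<in> interior V"
    "{x\<in>V. u x = u x0} = (\<Union>k\<in>{..<m+1} \<times> UNIV. path_image (h k))"
    using crit_multiplicity_star[OF assms(1)] by blast
  obtain h' V' where h': "star ({..<m'+1} \<times> (UNIV::bool set)) h' x0" "x0 \<in> interior V'"
    "{x\<in>V'. u x = u x0} = (\<Union>k\<in>{..<m'+1} \<times> UNIV. path_image (h' k))"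
    using crit_multiplicity_star[OF assms(2)] by blast
  have "card ({..<m+1} \<times> (UNIV::bool set)) \<le> card ({..<m'+1} \<times> (UNIV::bool set))"
  proof (rule star_card_le[OF h(1) h'(1) open_interior h'(2)])
    fix k assume "k \<in> {..<m+1} \<times> (UNIV::bool set)"
    then have "path_image (h k) \<subseteq> {x\<in>V. u x = u x0}" using h(3) by blast
    then show "path_image (h k) \<inter> interior V' \<subseteq> (\<Union>k\<in>{..<m'+1} \<times> UNIV. path_image (h' k))"
      unfolding h'(3)[symmetric] using interior_subset by blast
  qed
  then show ?thesis by (simp add: card_cartesian_product)
qed

section \<open>Separation of the sectors\<close>

lemma polar_ray_segment:
  fixes a b t :: real
  assumes "z \<in> closed_segment (polar a t) (polar b t)" "a \<le> b"
  obtains r where "a \<le> r" "r \<le> b" "z = polar r t"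
proof -
  obtain x where x: "0 \<le> x" "x \<le> 1" "z = (1 - x) *\<^sub>R (polar a t) + x *\<^sub>R (polar b t)"
    using assms(1) by (auto simp: closed_segment_def)
  have "(1 - x) * a + x * b \<in> closed_segment a b"
    using x by (auto simp: closed_segment_def)
  then have "a \<le> (1 - x) * a + x * b" "(1 - x) * a + x * b \<le> b"
    using assms(2) by (auto simp: closed_segment_eq_real_ivl)
  moreover have "z = polar ((1 - x) * a + x * b) t"
    using x(3) by (simp add: scaleR_conv_of_real algebra_simps)
  ultimately show thesis by (rule that)
qed

lemma connected_sector:
  fixes e c d :: real
  shows "connected ((\<lambda>(r,t). polar r t) ` ({0<..<e} \<times> {c<..<d}))"
  unfolding split_beta
  by (intro connected_continuous_image connected_Times continuous_intros) auto

text \<open>Close a path between the two rays up at the origin. Both sides of the resulting Jordan curve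
  contain one of the negative rays near the origin, so the minimum principle fails inside it.\<close>

lemma no_path_between_rays:
  fixes w :: "complex \<Rightarrow> real"
  assumes \<Omega>: "open \<Omega>" "simply_connected \<Omega>" and w: "continuous_on \<Omega> w"
    and nomin: "\<And>z. z \<in> \<Omega> \<Longrightarrow> \<not> (\<forall>\<^sub>F y in at z. w z \<le> w y)"
    and r0: "0 < r0" "cball 0 r0 \<subseteq> \<Omega>" and w0: "0 \<le> w 0"
    and ang: "\<alpha> < \<tau>" "\<tau> < \<beta>" "\<beta> < \<sigma>" "\<sigma> < \<alpha> + 2 * pi"
    and pos: "\<And>r. 0 < r \<Longrightarrow> r \<le> r0 \<Longrightarrow> 0 \<le> w (polar r \<alpha>) \<and> 0 \<le> w (polar r \<beta>)"
    and neg: "\<And>r. 0 < r \<Longrightarrow> r \<le> r0 \<Longrightarrow> w (polar r \<tau>) < 0 \<and> w (polar r \<sigma>) < 0"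
  shows "\<not> path_component ({z \<in> \<Omega>. 0 \<le> w z} - {0}) (polar r0 \<alpha>) (polar r0 \<beta>)"
proof
  let ?S = "{z \<in> \<Omega>. 0 \<le> w z} - {0}"
  assume "path_component ?S (polar r0 \<alpha>) (polar r0 \<beta>)"
  then obtain p where p: "path p" "path_image p \<subseteq> ?S" "pathstart p = polar r0 \<alpha>"
    "pathfinish p = polar r0 \<beta>"
    unfolding path_component_def by blast
  have cl: "closed (path_image p)" "0 \<notin> path_image p"
    using p by (auto simp: closed_path_image)
  then obtain d where d: "d > 0" "\<And>z. z \<in> path_image p \<Longrightarrow> d \<le> norm z"
    using separate_point_closed[OF cl] by (metis dist_0_norm)
  \<comment> \<open>The closed disc of radius \<open>e\<close> misses \<open>p\<close>, so inside it
    only the two rays matter.\<close>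
  define e where "e = min d r0 / 2"
  have e: "0 < e" "e < d" "e < r0" using d(1) r0(1) by (auto simp: e_def)
  have S_ray: "polar r \<alpha> \<in> ?S" "polar r \<beta> \<in> ?S" if "0 < r" "r \<le> r0" for r
  proof -
    have "polar r t \<in> \<Omega>" for t
      using r0(2) that by (auto simp: subset_iff norm_mult)
    then show "polar r \<alpha> \<in> ?S" "polar r \<beta> \<in> ?S"
      using pos[OF that] that by auto
  qed
  define q where "q = linepath (polar e \<alpha>) (polar r0 \<alpha>) +++ p +++
    linepath (polar r0 \<beta>) (polar e \<beta>)"
  have q: "path q" "pathstart q = polar e \<alpha>" "pathfinish q = polar e \<beta>"
    using p by (auto simp: q_def)
  have qim: "z \<in> ?S \<and> e \<le> norm z \<and> (norm z = e \<longrightarrow> z = polar e \<alpha> \<or> z = polar e \<beta>)"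
    if "z \<in> path_image q" for z
  proof -
    have "path_image q = closed_segment (polar e \<alpha>) (polar r0 \<alpha>) \<union> (path_image p \<union>
        closed_segment (polar r0 \<beta>) (polar e \<beta>))"
      unfolding q_def using p by (simp add: path_image_join)
    from that[unfolded this]
    consider "z \<in> closed_segment (polar e \<alpha>) (polar r0 \<alpha>)" | "z \<in> path_image p"
      | "z \<in> closed_segment (polar r0 \<beta>) (polar e \<beta>)"
      by blast
    then show ?thesis
    proof cases
      case 1
      then obtain r where "e \<le> r" "r \<le> r0" "z = polar r \<alpha>"
        by (rule polar_ray_segment) (use e in auto)
      then show ?thesis using S_ray[of r] e by (auto simp: norm_mult)
    next
      case 2
      then show ?thesis using p(2) d(2)[OF 2] e by auto
    next
      case 3
      then have "z \<in> closed_segment (polar e \<beta>) (polar r0 \<beta>)"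
        by (subst closed_segment_commute)
      then obtain r where "e \<le> r" "r \<le> r0" "z = polar r \<beta>"
        by (rule polar_ray_segment) (use e in auto)
      then show ?thesis using S_ray[of r] e by (auto simp: norm_mult)
    qed
  qed
  have ab: "polar e \<alpha> \<noteq> polar e \<beta>"
    using polar_eq_imp_eq(2)[of e \<alpha> e \<beta>] e ang by auto
  \<comment> \<open>\<open>q\<close> may cross itself; an arc within its image can be closed up to a
    Jordan curve.\<close>
  then obtain h where h: "arc h" "path_image h \<subseteq> path_image q" "pathstart h = polar e \<alpha>"
    "pathfinish h = polar e \<beta>"
    using path_contains_arc[OF q] by metis
  define g where "g = linepath (polar e \<beta>) 0 +++ linepath 0 (polar e \<alpha>)"
  have seg: "\<exists>r. 0 \<le> r \<and> r \<le> e \<and> z = polar r t" if "z \<in> closed_segment 0 (polar e t)" for z t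
    using polar_ray_segment[of z 0 t e] that e by force
  have segI: "polar r t \<in> closed_segment 0 (polar e t)" if "0 \<le> r" "r \<le> e" for r t
    unfolding closed_segment_def
    using that e by (auto intro!: exI[of _ "r / e"] simp: scaleR_conv_of_real)
  have gim: "path_image g = closed_segment 0 (polar e \<beta>) \<union> closed_segment 0 (polar e \<alpha>)"
    unfolding g_def by (simp add: path_image_join closed_segment_commute)
  have arcg: "arc g"
    unfolding g_def
  proof (rule arc_join)
    show "path_image (linepath (polar e \<beta>) 0) \<inter> path_image (linepath 0 (polar e \<alpha>))
        \<subseteq> {pathstart (linepath 0 (polar e \<alpha>))}"
    proof
      fix z assume z: "z \<in> path_image (linepath (polar e \<beta>) 0) \<inter> path_image (linepath 0 (polar e \<alpha>))"
      obtain r s where rs: "0 \<le> r" "z = polar r \<beta>" "0 \<le> s" "z = polar s \<alpha>"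
        using z seg[of z \<alpha>] seg[of z \<beta>] by (auto simp: closed_segment_commute)
      have "r = 0"
      proof (rule ccontr)
        assume "r \<noteq> 0"
        then have "\<beta> = \<alpha>" using rs ang by (intro polar_eq_imp_eq(2)[of r \<beta> s \<alpha>]) auto
        then show False using ang by simp
      qed
      then show "z \<in> {pathstart (linepath 0 (polar e \<alpha>))}" using rs by simp
    qed
  qed (use e in \<open>auto intro!: arc_linepath\<close>)
  define \<Gamma> where "\<Gamma> = g +++ h"
  have g_ends: "pathstart g = polar e \<beta>" "pathfinish g = polar e \<alpha>"
    by (simp_all add: g_def)
  have \<Gamma>: "simple_path \<Gamma>" "pathfinish \<Gamma> = pathstart \<Gamma>"
  proof -
    show "simple_path \<Gamma>"
      unfolding \<Gamma>_def
    proof (rule simple_path_join_loop[OF arcg h(1)])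
      show "path_image g \<inter> path_image h \<subseteq> {pathstart g, pathstart h}"
      proof
        fix z assume z: "z \<in> path_image g \<inter> path_image h"
        then obtain r t where "0 \<le> r" "r \<le> e" "z = polar r t" using seg gim by blast
        then have "norm z \<le> e" by (simp add: norm_mult)
        moreover have "z \<in> path_image q" using z h by blast
        ultimately show "z \<in> {pathstart g, pathstart h}"
          using qim[of z] h g_ends by auto
      qed
    qed (use h g_ends in auto)
    show "pathfinish \<Gamma> = pathstart \<Gamma>" using h g_ends by (simp add: \<Gamma>_def)
  qed
  define G where "G = path_image \<Gamma>"
  have G: "G = closed_segment 0 (polar e \<beta>) \<union> closed_segment 0 (polar e \<alpha>) \<union> path_image h"
    unfolding G_def \<Gamma>_def using h g_ends by (simp add: path_image_join gim)
  have GS: "z \<in> \<Omega> \<and> 0 \<le> w z" if z: "z \<in> G" for z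
  proof -
    have ray: "polar r \<alpha> \<in> \<Omega> \<and> 0 \<le> w (polar r \<alpha>)"
        "polar r \<beta> \<in> \<Omega> \<and> 0 \<le> w (polar r \<beta>)" if "0 \<le> r" "r \<le> e" for r
      using that S_ray[of r] e r0 w0 by (cases "r = 0"; auto)+
    from z consider "z \<in> closed_segment 0 (polar e \<beta>)" | "z \<in> closed_segment 0 (polar e \<alpha>)"
      | "z \<in> path_image q" using G h by blast
    then show ?thesis
    proof cases
      case 1
      then show ?thesis using seg[OF 1] ray by auto
    next
      case 2
      then show ?thesis using seg[OF 2] ray by auto
    next
      case 3
      then show ?thesis using qim[OF 3] by auto
    qed
  qed
  have J: "open (inside G)" "bounded (inside G)" "frontier (inside G) = G"
    using Jordan_inside_outside[OF \<Gamma>] unfolding G_def by auto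
  \<comment> \<open>Simple connectedness enters here: the curve lies in \<open>\<Omega>\<close> and
    so encloses no hole.\<close>
  have in\<Omega>: "inside G \<subseteq> \<Omega>"
    using GS by (intro subset_simply_connected_imp_inside_subset \<Omega>) auto
  \<comment> \<open>The origin lies on the curve, so the inside reaches into the small disc, in one
    of the two sectors between the rays. Which one is unknown, but each contains a negative
    ray.\<close>
  have "0 \<in> frontier (inside G)" using J(3) G by simp
  then obtain y where y: "y \<in> inside G" "norm y < e"
    using e(1) unfolding frontier_straddle by (metis dist_0_norm)
  have yG: "y \<notin> G" using y(1) inside_no_overlap by blast
  then have "y \<noteq> 0" using G by auto
  define \<theta> where "\<theta> = \<alpha> + Arg2pi (y / cis \<alpha>)"
  have \<theta>: "\<alpha> \<le> \<theta>" "\<theta> < \<alpha> + 2 * pi" "y = polar (norm y) \<theta>"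
  proof -
    have *: "0 \<le> Arg2pi (y / cis \<alpha>)" "Arg2pi (y / cis \<alpha>) < 2 * pi"
      "y / cis \<alpha> = polar (norm (y / cis \<alpha>)) (Arg2pi (y / cis \<alpha>))"
      using Arg2pi[of "y / cis \<alpha>"] by (simp_all add: is_Arg_def cis_conv_exp)
    then show "\<alpha> \<le> \<theta>" "\<theta> < \<alpha> + 2 * pi" by (simp_all add: \<theta>_def)
    have "y = (y / cis \<alpha>) * cis \<alpha>" by simp
    also have "\<dots> = polar (norm y) (Arg2pi (y / cis \<alpha>)) * cis \<alpha>"
      by (subst *(3)) (simp add: norm_divide)
    also have "\<dots> = polar (norm y) \<theta>"
      by (simp add: \<theta>_def cis_mult add.commute)
    finally show "y = polar (norm y) \<theta>" .
  qed
  have "\<theta> \<noteq> \<alpha>" "\<theta> \<noteq> \<beta>"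
  proof -
    have "y \<in> G" if "\<theta> = \<alpha> \<or> \<theta> = \<beta>"
      using that segI[of "norm y" \<theta>] \<theta>(3) y(2) unfolding G by auto
    then show "\<theta> \<noteq> \<alpha>" "\<theta> \<noteq> \<beta>" using yG by blast+
  qed
  then obtain c d' \<phi> where cd: "c < \<theta>" "\<theta> < d'" "c < \<phi>" "\<phi> < d'" "\<phi> = \<tau> \<or> \<phi> = \<sigma>"
    "(c = \<alpha> \<and> d' = \<beta>) \<or> (c = \<beta> \<and> d' = \<alpha> + 2 * pi)"
    using \<theta>(1,2) ang by (cases "\<theta> < \<beta>") force+
  \<comment> \<open>The open sector around \<open>y\<close> avoids the curve, so the inside contains
    all of it, including a point of the negative ray.\<close>
  define Q where "Q = (\<lambda>(r,t). polar r t) ` ({0<..<e} \<times> {c<..<d'})"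
  have "Q \<subseteq> - G"
  proof
    fix z assume "z \<in> Q"
    then obtain r t where rt: "0 < r" "r < e" "c < t" "t < d'" "z = polar r t"
      by (auto simp: Q_def)
    have "z \<notin> path_image h"
      using qim[of z] h(2) rt by (auto simp: norm_mult)
    moreover have "z \<notin> closed_segment 0 (polar e \<alpha>)"
    proof
      assume "z \<in> closed_segment 0 (polar e \<alpha>)"
      then obtain s where "0 \<le> s" "z = polar s \<alpha>" using seg by blast
      then have "t = \<alpha>" using rt cd(6) ang by (intro polar_eq_imp_eq(2)[of r t s \<alpha>]) auto
      then show False using rt cd(6) ang by auto
    qed
    moreover have "z \<notin> closed_segment 0 (polar e \<beta>)"
    proof
      assume "z \<in> closed_segment 0 (polar e \<beta>)"
      then obtain s where "0 \<le> s" "z = polar s \<beta>" using seg by blast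
      then have "t = \<beta>" using rt cd(6) ang by (intro polar_eq_imp_eq(2)[of r t s \<beta>]) auto
      then show False using rt cd(6) ang by auto
    qed
    ultimately show "z \<in> - G" unfolding G by blast
  qed
  moreover have "connected Q" unfolding Q_def by (rule connected_sector)
  moreover have "y \<in> Q"
    unfolding Q_def using \<theta>(3) y(2) \<open>y \<noteq> 0\<close> cd by (auto intro!: image_eqI[of _ _ "(norm y, \<theta>)"])
  moreover define z0 where "z0 = polar (e / 2) \<phi>"
  moreover have "z0 \<in> Q"
    unfolding Q_def z0_def using e cd by (auto intro!: image_eqI[of _ _ "(e / 2, \<phi>)"])
  ultimately have "connected_component (- G) y z0"
    by (auto simp: connected_component_def)
  then have z0in: "z0 \<in> inside G" using inside_same_component y(1) by blast
  have wz0: "w z0 < 0" using neg[of "e / 2"] e cd(5) by (auto simp: z0_def)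
  have K: "compact (closure (inside G))" "closure (inside G) = inside G \<union> G"
  proof -
    show "compact (closure (inside G))" using J(2) by (simp only: compact_closure)
    show "closure (inside G) = inside G \<union> G"
      using closure_Un_frontier[of "inside G"] J(3) by simp
  qed
  have K\<Omega>: "closure (inside G) \<subseteq> \<Omega>" using K(2) in\<Omega> GS by auto
  \<comment> \<open>The minimum over the closed inside is negative, hence not attained on the curve,
    and thus is a local minimum in \<open>\<Omega>\<close>.\<close>
  obtain z where z: "z \<in> closure (inside G)" "\<And>y. y \<in> closure (inside G) \<Longrightarrow> w z \<le> w y"
    using continuous_attains_inf[OF K(1) _ continuous_on_subset[OF w K\<Omega>]] z0in closure_subset by blast
  have "w z < 0" using z(2)[of z0] z0in wz0 closure_subset by fastforce
  then have "z \<in> inside G" using z(1) K(2) GS by force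
  then have "\<forall>\<^sub>F y in at z. y \<in> inside G"
    using J(1) by (simp add: eventually_at_in_open')
  then have "\<forall>\<^sub>F y in at z. w z \<le> w y"
    by (rule eventually_mono) (use z(2) closure_subset in blast)
  then show False using nomin[of z] z(1) K\<Omega> by blast
qed

section \<open>Superlevel sets near the boundary\<close>

lemma mvt_segment:
  fixes f :: "'a::real_inner \<Rightarrow> real"
  assumes "\<And>x. x \<in> closed_segment a b \<Longrightarrow> (f has_derivative (\<lambda>h. G x \<bullet> h)) (at x)"
  shows "\<exists>x\<in>closed_segment a b. f b - f a = G x \<bullet> (b - a)"
proof -
  define l where "l = (\<lambda>t::real. a + t *\<^sub>R (b - a))"
  have l: "l t \<in> closed_segment a b" if "0 \<le> t" "t \<le> 1" for t
    using that unfolding closed_segment_def l_def by (auto simp: algebra_simps intro!: exI[of _ t])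
  have "\<exists>t>0. t < 1 \<and> f (l 1) - f (l 0) = (1 - 0) * (G (l t) \<bullet> (b - a))"
  proof (rule MVT2)
    fix t :: real assume "0 \<le> t" "t \<le> 1"
    have "(l has_derivative (\<lambda>h. h *\<^sub>R (b - a))) (at t)"
      unfolding l_def by (auto intro!: derivative_eq_intros)
    from has_derivative_compose[OF this assms[OF l]] \<open>0 \<le> t\<close> \<open>t \<le> 1\<close>
    show "((\<lambda>t. f (l t)) has_real_derivative G (l t) \<bullet> (b - a)) (at t)"
      unfolding has_field_derivative_def by (simp add: mult.commute[of _ "G (l t) \<bullet> (b - a)"])
  qed simp
  then show ?thesis using l by (auto simp: l_def)
qed

text \<open>Two points of \<open>\<Omega>\<close> near a boundary point are joined by pushing both along the inner normal and
  then connecting them by a segment.\<close>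

lemma smooth_boundary_locally_path_connected:
  assumes sb: "smooth_boundary \<Omega>" and "open \<Omega>" and p: "p \<in> frontier \<Omega>" and U: "open U" "p \<in> U"
  obtains \<delta> where "0 < \<delta>"
    "\<And>x y. x \<in> \<Omega> \<inter> ball p \<delta> \<Longrightarrow> y \<in> \<Omega> \<inter> ball p \<delta> \<Longrightarrow> path_component (\<Omega> \<inter> U) x y"
proof -
  obtain V \<rho> where V: "open V" "p \<in> V" and sm: "smooth_fun_on \<rho> V"
    and g0: "\<forall>x\<in>V. grad \<rho> x \<noteq> 0" and \<Omega>V: "\<Omega> \<inter> V = {x\<in>V. \<rho> x < 0}"
    using sb p unfolding smooth_boundary_def by blast
  have "Ck_on 1 \<rho> V" using sm unfolding smooth_fun_on_def by blast
  then have dif: "\<rho> differentiable (at x)" and contp: "continuous_on V (partial_deriv i \<rho>)" if "x \<in> V" for x i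
    using that by auto
  have d\<rho>: "(\<rho> has_derivative (\<lambda>h. grad \<rho> x \<bullet> h)) (at x)" if "x \<in> V" for x
    using has_derivative_partial_deriv[OF dif[OF that]] by (simp add: grad_def inner_vec_def)
  define g where "g = grad \<rho> p"
  \<comment> \<open>As \<open>norm g = 2 * \<eta>\<close>, gradients within \<open>\<eta>\<close> of
    \<open>g\<close> make \<open>\<rho>\<close> fall along the inner normal at rate at least
    \<open>\<eta>\<close>.\<close>
  define \<eta> where "\<eta> = norm g / 2"
  have g: "0 < norm g" "0 < \<eta>" using g0 V by (auto simp: g_def \<eta>_def)
  have "continuous_on V (grad \<rho>)"
    unfolding grad_def using contp[OF V(2)] by (intro continuous_intros)
  then obtain \<epsilon>1 where \<epsilon>1: "\<epsilon>1 > 0" "\<And>x. x \<in> V \<Longrightarrow> dist x p < \<epsilon>1 \<Longrightarrow> dist (grad \<rho> x) (grad \<rho> p) < \<eta>"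
    using V(2) g(2) unfolding continuous_on_iff by meson
  obtain \<epsilon>2 where \<epsilon>2: "\<epsilon>2 > 0" "ball p \<epsilon>2 \<subseteq> U \<inter> V"
    using U V open_contains_ball[of "U \<inter> V"] by (meson IntI open_Int)
  define \<epsilon> where "\<epsilon> = min \<epsilon>1 \<epsilon>2"
  have \<epsilon>: "\<epsilon> > 0" "ball p \<epsilon> \<subseteq> U \<inter> V" using \<epsilon>1 \<epsilon>2 by (auto simp: \<epsilon>_def)
  have gclose: "norm (grad \<rho> x - g) \<le> \<eta>" if "x \<in> ball p \<epsilon>" for x
    using \<epsilon>1(2)[of x] \<epsilon>(2) that by (auto simp: \<epsilon>_def g_def dist_norm norm_minus_commute)
  have diff: "\<bar>\<rho> b - \<rho> a - g \<bullet> (b - a)\<bar> \<le> \<eta> * norm (b - a)"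
    if ab: "a \<in> ball p \<epsilon>" "b \<in> ball p \<epsilon>" for a b
  proof -
    have seg: "closed_segment a b \<subseteq> ball p \<epsilon>"
      using ab by (intro closed_segment_subset) auto
    obtain x where x: "x \<in> closed_segment a b" "\<rho> b - \<rho> a = grad \<rho> x \<bullet> (b - a)"
      using mvt_segment[of a b \<rho> "grad \<rho>"] d\<rho> seg \<epsilon>(2) by blast
    have "\<rho> b - \<rho> a - g \<bullet> (b - a) = (grad \<rho> x - g) \<bullet> (b - a)"
      using x(2) by (simp add: inner_diff_left)
    also have "\<bar>\<dots>\<bar> \<le> norm (grad \<rho> x - g) * norm (b - a)" by (rule Cauchy_Schwarz_ineq2)
    also have "\<dots> \<le> \<eta> * norm (b - a)" using gclose x seg by (intro mult_right_mono) auto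
    finally show ?thesis .
  qed
  define e where "e = (1 / norm g) *\<^sub>R g"
  have e: "norm e = 1" "g \<bullet> e = norm g"
    using g by (auto simp: e_def dot_square_norm power2_eq_square)
  \<comment> \<open>Pushing by \<open>L\<close> lowers \<open>\<rho>\<close> by at least
    \<open>L * \<eta> = 6 * \<delta> * \<eta>\<close>. The connecting segment is shorter than
    \<open>2 * \<delta>\<close>, and \<open>\<rho>\<close> rises on it at rate at most
    \<open>3 * \<eta>\<close>, so it stays negative. Everything remains in the ball since
    \<open>\<delta> + L < \<epsilon>\<close>.\<close>
  define \<delta> where "\<delta> = \<epsilon> / 8"
  define L where "L = 6 * \<delta>"
  have \<delta>: "\<delta> > 0" "L > 0" using \<epsilon> by (auto simp: \<delta>_def L_def)
  have shift: "x - t *\<^sub>R e \<in> ball p \<epsilon>" if "x \<in> ball p \<delta>" "0 \<le> t" "t \<le> L" for x t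
  proof -
    have "dist p (x - t *\<^sub>R e) \<le> dist p x + norm (t *\<^sub>R e)"
      using dist_triangle[of p "x - t *\<^sub>R e" x] by (simp add: dist_norm)
    then show ?thesis using that e by (simp add: \<delta>_def L_def)
  qed
  have in\<Omega>: "x \<in> \<Omega> \<inter> U" if "x \<in> ball p \<epsilon>" "\<rho> x < 0" for x
    using that \<epsilon>(2) \<Omega>V by blast
  have neg: "\<rho> x < 0" if "x \<in> \<Omega> \<inter> ball p \<epsilon>" for x
    using that \<epsilon>(2) \<Omega>V by blast
  have sub: "ball p \<delta> \<subseteq> ball p \<epsilon>" using \<epsilon> by (intro subset_ball) (simp add: \<delta>_def)
  have down: "\<rho> (x - t *\<^sub>R e) \<le> \<rho> x - t * \<eta>" if "x \<in> ball p \<delta>" "0 \<le> t" "t \<le> L" for x t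
  proof -
    have "\<bar>\<rho> (x - t *\<^sub>R e) - \<rho> x - g \<bullet> ((x - t *\<^sub>R e) - x)\<bar> \<le> \<eta> * norm ((x - t *\<^sub>R e) - x)"
      using that sub shift by (intro diff) auto
    then have "\<bar>\<rho> (x - t *\<^sub>R e) - \<rho> x + t * norm g\<bar> \<le> \<eta> * t"
      using e that by simp
    then have "\<rho> (x - t *\<^sub>R e) - \<rho> x + t * norm g \<le> \<eta> * t" by (simp only: abs_le_iff)
    moreover have "t * norm g = 2 * (t * \<eta>)" by (simp add: \<eta>_def)
    ultimately show ?thesis by (simp add: mult.commute)
  qed
  have push: "path_component (\<Omega> \<inter> U) x (x - L *\<^sub>R e)" if x: "x \<in> \<Omega> \<inter> ball p \<delta>" for x
  proof (rule path_component_linepath, rule subsetI)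
    fix z assume "z \<in> closed_segment x (x - L *\<^sub>R e)"
    then obtain s where s: "0 \<le> s" "s \<le> 1" "z = (1 - s) *\<^sub>R x + s *\<^sub>R (x - L *\<^sub>R e)"
      by (auto simp: closed_segment_def)
    then have z: "z = x - (s * L) *\<^sub>R e" by (simp add: algebra_simps)
    have sL: "0 \<le> s * L" "s * L \<le> L" using s \<delta> by (auto simp: mult_left_le_one_le)
    have "\<rho> x < 0" using x sub by (intro neg) blast
    moreover have "0 \<le> s * L * \<eta>" using sL g(2) by simp
    ultimately have "\<rho> z < 0" using down[of x "s * L"] x sL unfolding z by auto
    then show "z \<in> \<Omega> \<inter> U" using shift[of x "s * L"] x sL unfolding z by (intro in\<Omega>) auto
  qed
  have across: "path_component (\<Omega> \<inter> U) (x - L *\<^sub>R e) (y - L *\<^sub>R e)"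
    if x: "x \<in> \<Omega> \<inter> ball p \<delta>" and y: "y \<in> \<Omega> \<inter> ball p \<delta>" for x y
  proof (rule path_component_linepath, rule subsetI)
    fix z assume z: "z \<in> closed_segment (x - L *\<^sub>R e) (y - L *\<^sub>R e)"
    have xy: "x - L *\<^sub>R e \<in> ball p \<epsilon>" "y - L *\<^sub>R e \<in> ball p \<epsilon>"
      using shift[of x L] shift[of y L] x y \<delta> by auto
    then have zb: "z \<in> ball p \<epsilon>"
      using z closed_segment_subset[of _ "ball p \<epsilon>"] by (meson convex_ball subset_iff)
    have "norm (z - (x - L *\<^sub>R e)) \<le> norm ((y - L *\<^sub>R e) - (x - L *\<^sub>R e))"
      using segment_bound(1)[OF z] .
    also have "\<dots> \<le> norm (y - p) + norm (x - p)"
      using norm_triangle_ineq4[of "y - p" "x - p"] by simp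
    also have "\<dots> < 2 * \<delta>" using x y by (simp add: dist_norm norm_minus_commute)
    finally have zx: "norm (z - (x - L *\<^sub>R e)) < 2 * \<delta>" .
    have "g \<bullet> (z - (x - L *\<^sub>R e)) \<le> 2 * (\<eta> * norm (z - (x - L *\<^sub>R e)))"
      using norm_cauchy_schwarz[of g "z - (x - L *\<^sub>R e)"] by (simp add: \<eta>_def)
    moreover have "\<rho> z - \<rho> (x - L *\<^sub>R e) - g \<bullet> (z - (x - L *\<^sub>R e)) \<le> \<eta> * norm (z - (x - L *\<^sub>R e))"
      using diff[OF xy(1) zb] by (rule abs_le_D1)
    ultimately have "\<rho> z - \<rho> (x - L *\<^sub>R e) \<le> 3 * \<eta> * norm (z - (x - L *\<^sub>R e))"
      by linarith
    also have "\<dots> \<le> 3 * \<eta> * (2 * \<delta>)" using zx g by (intro mult_left_mono) auto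
    also have "\<dots> = L * \<eta>" by (simp add: L_def)
    finally have "\<rho> z \<le> \<rho> (x - L *\<^sub>R e) + L * \<eta>" by simp
    moreover have "\<rho> (x - L *\<^sub>R e) \<le> \<rho> x - L * \<eta>" using down[of x L] x \<delta> by auto
    moreover have "\<rho> x < 0" using x sub by (intro neg) blast
    ultimately have "\<rho> z < 0" by linarith
    then show "z \<in> \<Omega> \<inter> U" using zb by (intro in\<Omega>)
  qed
  show thesis
  proof (rule that[OF \<delta>(1)])
    fix x y assume "x \<in> \<Omega> \<inter> ball p \<delta>" "y \<in> \<Omega> \<inter> ball p \<delta>"
    then have "path_component (\<Omega> \<inter> U) x (x - L *\<^sub>R e)"
      "path_component (\<Omega> \<inter> U) (x - L *\<^sub>R e) (y - L *\<^sub>R e)"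
      "path_component (\<Omega> \<inter> U) (y - L *\<^sub>R e) y"
      by (auto intro!: push across path_component_sym[OF push])
    then show "path_component (\<Omega> \<inter> U) x y"
      by (blast intro: path_component_trans)
  qed
qed

section \<open>From superlevel components to boundary maxima\<close>

locale dirichlet_solution = quasilinear_solution +
  fixes \<psi> :: "real^2 \<Rightarrow> real"
  assumes nonempty: "\<Omega> \<noteq> {}" and bounded_domain: "bounded \<Omega>"
    and boundary: "smooth_boundary \<Omega>" and simply_connected_domain: "simply_connected \<Omega>"
    and cont_closure: "continuous_on (closure \<Omega>) u"
    and boundary_values: "x \<in> frontier \<Omega> \<Longrightarrow> u x = \<psi> x"
    and finite_maxima: "finite (local_max_points \<psi> (frontier \<Omega>))"
begin

abbreviation peaks :: "(real^2) set" where
  "peaks \<equiv> local_max_points \<psi> (frontier \<Omega>)"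

abbreviation superlevel :: "real \<Rightarrow> (real^2) set" where
  "superlevel c \<equiv> {x \<in> \<Omega>. c < u x}"

lemma peaks_nonempty: "peaks \<noteq> {}"
proof -
  have "frontier \<Omega> \<noteq> {}"
    using nonempty bounded_domain frontier_eq_empty not_bounded_UNIV by metis
  moreover have "compact (frontier \<Omega>)" using bounded_domain by (rule compact_frontier_bounded)
  moreover have "continuous_on (frontier \<Omega>) u"
    using cont_closure by (rule continuous_on_subset) (simp add: frontier_def)
  ultimately obtain p where p: "p \<in> frontier \<Omega>" "\<forall>y\<in>frontier \<Omega>. u y \<le> u p"
    using continuous_attains_sup by blast
  then have "p \<in> peaks"
    using boundary_values by (auto simp: local_max_points_def eventually_at_filter)
  then show ?thesis by blast
qed

text \<open>\<open>u\<close> is maximised over the closure of the path component of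
  \<open>x1\<close>. The maximum principle places the maximiser \<open>p\<close> on the boundary,
  and local path-connectedness puts all points of \<open>\<Omega>\<close> close to \<open>p\<close>
  into the component, so boundary points near \<open>p\<close> are limits of it and have values at
  most \<open>\<psi> p\<close>.\<close>

lemma superlevel_reaches_peak:
  assumes x1: "x1 \<in> \<Omega>" "c < u x1"
  obtains p where "p \<in> peaks"
    "\<forall>\<^sub>F y in nhds p. y \<in> \<Omega> \<longrightarrow> path_component (superlevel c) x1 y"
proof -
  define S where "S = superlevel c"
  define D where "D = path_component_set S x1"
  have "open S"
  proof -
    have "S = \<Omega> \<inter> u -` {c<..}" by (auto simp: S_def)
    then show ?thesis using continuous_on_u open_domain by (simp add: continuous_open_preimage)
  qed
  have x1S: "x1 \<in> S" using x1 by (simp add: S_def)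
  then have x1D: "x1 \<in> D" by (simp add: D_def path_component_refl)
  have DS: "D \<subseteq> S" unfolding D_def by (rule path_component_subset)
  then have D\<Omega>: "closure D \<subseteq> closure \<Omega>" by (intro closure_mono) (auto simp: S_def)
  have "compact (closure D)"
    using bounded_subset[OF bounded_domain] DS by (auto simp: compact_closure S_def)
  then obtain p where p: "p \<in> closure D" "\<And>y. y \<in> closure D \<Longrightarrow> u y \<le> u p"
    using continuous_attains_sup[of "closure D" u] continuous_on_subset[OF cont_closure D\<Omega>] x1D closure_subset
    by blast
  have "u x1 \<le> u p" using p(2) x1D closure_subset by blast
  then have up: "c < u p" using x1 by simp
  have "p \<notin> \<Omega>"
  proof
    assume p\<Omega>: "p \<in> \<Omega>"
    then have "p \<in> S" using up by (simp add: S_def)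
    then obtain r where r: "r > 0" "ball p r \<subseteq> S" using \<open>open S\<close> open_contains_ball by blast
    obtain z where z: "z \<in> D" "dist z p < r" using p(1) r(1) closure_approachable by blast
    have "y \<in> D" if "y \<in> ball p r" for y
    proof -
      have "closed_segment z y \<subseteq> S"
        using that z r(2) closed_segment_subset[of z "ball p r" y] by (auto simp: dist_commute)
      then have "path_component S z y" by (rule path_component_linepath)
      then show ?thesis using z(1) path_component_trans by (auto simp: D_def)
    qed
    then have "u y \<le> u p" if "y \<in> ball p r" for y
      using p(2) closure_subset that by blast
    then have "\<forall>\<^sub>F y in at p. u y \<le> u p"
      unfolding eventually_at using r(1) by (metis dist_commute mem_ball)
    then show False using no_local_extremum(2)[OF p\<Omega>] by blast
  qed
  then have pfr: "p \<in> frontier \<Omega>"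
    using p(1) D\<Omega> open_domain by (auto simp: frontier_def interior_open)
  obtain d where d: "d > 0" "\<And>y. y \<in> closure \<Omega> \<Longrightarrow> dist y p < d \<Longrightarrow> dist (u y) (u p) < u p - c"
  proof -
    have "p \<in> closure \<Omega>" "0 < u p - c" using p(1) D\<Omega> up by auto
    then show ?thesis using cont_closure that unfolding continuous_on_iff by blast
  qed
  have sub: "\<Omega> \<inter> ball p d \<subseteq> S"
  proof
    fix y assume y: "y \<in> \<Omega> \<inter> ball p d"
    then have "dist (u y) (u p) < u p - c"
      using closure_subset by (intro d(2)) (auto simp: dist_commute)
    then show "y \<in> S" using y by (auto simp: S_def dist_real_def)
  qed
  obtain \<delta> where \<delta>: "0 < \<delta>" "\<And>x y. x \<in> \<Omega> \<inter> ball p \<delta> \<Longrightarrow> y \<in> \<Omega> \<inter> ball p \<delta> \<Longrightarrow> path_component (\<Omega> \<inter> ball p d) x y"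
    using smooth_boundary_locally_path_connected[OF boundary open_domain pfr, of "ball p d"] d(1) by auto
  obtain z where z: "z \<in> D" "dist z p < \<delta>" using p(1) \<delta>(1) closure_approachable by blast
  have near: "y \<in> D" if "y \<in> \<Omega> \<inter> ball p \<delta>" for y
  proof -
    have "z \<in> \<Omega> \<inter> ball p \<delta>" using z DS by (auto simp: S_def dist_commute)
    then have "path_component S z y" using \<delta>(2) that sub path_component_of_subset by blast
    then show ?thesis using z(1) path_component_trans by (auto simp: D_def)
  qed
  have "\<psi> q \<le> \<psi> p" if q: "q \<in> frontier \<Omega>" "q \<in> ball p \<delta>" for q
  proof -
    have "q \<in> closure (\<Omega> \<inter> ball p \<delta>)"
    proof -
      have "q \<in> closure \<Omega>" using q(1) by (simp add: frontier_def)
      then have "q \<in> closure (ball p \<delta> \<inter> \<Omega>)"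
        using q(2) open_Int_closure_subset[of "ball p \<delta>" \<Omega>] by auto
      then show ?thesis by (simp add: Int_commute)
    qed
    also have "\<dots> \<subseteq> closure D" using near by (intro closure_mono) blast
    finally show ?thesis using p(2)[of q] boundary_values q(1) pfr by simp
  qed
  then have "\<forall>\<^sub>F q in at p within frontier \<Omega>. \<psi> q \<le> \<psi> p"
    unfolding eventually_at using \<delta>(1) by (metis dist_commute mem_ball)
  then have "p \<in> peaks" using pfr by (simp add: local_max_points_def)
  moreover have "\<forall>\<^sub>F y in nhds p. y \<in> \<Omega> \<longrightarrow> path_component (superlevel c) x1 y"
    unfolding eventually_nhds_metric using \<delta>(1) near
    by (intro exI[of _ \<delta>]) (auto simp: D_def S_def dist_commute)
  ultimately show thesis by (rule that)
qed

text \<open>In the saddle coordinates the points sit at radius \<open>R\<close> on the rays of angle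
  \<open>2 * pi * s / n\<close>, where \<open>n = m + 1\<close>. Indices up to \<open>m\<close> give
  the \<open>m + 1\<close> different sectors; larger ones repeat them.\<close>

lemma crit_sectors:
  assumes x0: "x0 \<in> \<Omega>" "grad u x0 = 0"
  obtains m and pt :: "nat \<Rightarrow> real^2" where "has_crit_multiplicity u \<Omega> x0 m"
    "\<And>s. pt s \<in> \<Omega> \<and> u x0 < u (pt s)"
    "\<And>s. path_component (insert x0 (superlevel (u x0))) x0 (pt s)"
    "\<And>s t. s \<le> m \<Longrightarrow> t \<le> m \<Longrightarrow> s \<noteq> t \<Longrightarrow> \<not> path_component ({z \<in> \<Omega>. u x0 \<le> u z} - {x0}) (pt s) (pt t)"
proof -
  obtain \<Phi> :: "complex \<Rightarrow> real^2" and m R where \<Phi>: "linear \<Phi>" "bij \<Phi>" and m: "1 \<le> m"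
    and dom: "\<And>z. z \<in> cball 0 R \<Longrightarrow> x0 + \<Phi> z \<in> \<Omega>"
    and sad: "polar_saddle (Suc m) (\<lambda>z. u (x0 + \<Phi> z) - u x0) R"
    by (rule critical_point_saddle[OF x0]) (rule that)
  define n where "n = Suc m"
  define w where "w = (\<lambda>z. u (x0 + \<Phi> z) - u x0)"
  have sad: "polar_saddle n w R" using sad by (simp add: n_def w_def)
  have R: "0 < R" using sad by (simp add: polar_saddle_def)
  define X where "X = (\<lambda>z. x0 + \<Phi> z)"
  have X0: "X 0 = x0" using linear_0[OF \<Phi>(1)] by (simp add: X_def)
  have contX: "continuous_on T X" for T
    unfolding X_def using \<Phi>(1) by (intro continuous_intros linear_continuous_on) (simp add: linear_conv_bounded_linear)
  define ang where "ang = (\<lambda>s::nat. 2 * pi * s / n)"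
  \<comment> \<open>The middle of the negative sector that follows the \<open>s\<close>-th positive
    one: \<open>n * mid s\<close> is an odd multiple of \<open>pi\<close>.\<close>
  define mid where "mid = (\<lambda>s::nat. (2 * s + 1) * pi / n)"
  define pt where "pt = (\<lambda>s. X (polar R (ang s)))"
  have n0: "real n > 0" by (simp add: n_def)
  have pos: "0 < w (polar r (ang s))" if "0 < r" "r \<le> R" for r s
  proof (rule polar_saddle_pos[OF sad that])
    have "n * ang s = 2 * real s * pi" using n0 by (simp add: ang_def)
    then show "1/2 \<le> cos (n * ang s)" by (simp only: cos_2npi)
  qed
  have neg: "w (polar r (mid s)) < 0" if "0 < r" "r \<le> R" for r s
  proof (rule polar_saddle_neg[OF sad that])
    have "n * mid s = real (2 * s + 1) * pi" using n0 by (simp add: mid_def)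
    then show "cos (n * mid s) \<le> - (1/2)" by (simp only: cos_npi) simp
  qed
  have ray: "X (polar r t) \<in> \<Omega>" if "0 \<le> r" "r \<le> R" for r t
    unfolding X_def using that by (intro dom) (simp add: norm_mult)
  show thesis
  proof (rule that)
    show "has_crit_multiplicity u \<Omega> x0 m"
      using crit_multiplicity_exists[OF x0(1) \<Phi> m dom] sad by (simp add: n_def w_def)
    show "pt s \<in> \<Omega> \<and> u x0 < u (pt s)" for s
      using ray[of R "ang s"] pos[of R s] R by (simp add: pt_def w_def X_def)
    show "path_component (insert x0 (superlevel (u x0))) x0 (pt s)" for s
    proof -
      define l where "l = (\<lambda>t. X (polar (R * t) (ang s)))"
      have "path l"
        unfolding path_def l_def by (intro continuous_on_compose2[OF contX[of UNIV]] continuous_intros) auto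
      moreover have "path_image l \<subseteq> insert x0 (superlevel (u x0))"
      proof
        fix y assume "y \<in> path_image l"
        then obtain t where t: "0 \<le> t" "t \<le> 1" "y = l t" by (auto simp: path_image_def)
        have Rt: "0 \<le> R * t" "R * t \<le> R" using t R by (auto simp: mult_left_le)
        show "y \<in> insert x0 (superlevel (u x0))"
        proof (cases "t = 0")
          case True
          then show ?thesis using t X0 by (simp add: l_def)
        next
          case False
          then have "0 < R * t" using R t by simp
          then show ?thesis
            using ray[OF Rt, of "ang s"] pos[of "R * t" s] Rt t(3) by (simp add: l_def w_def X_def del: of_real_mult)
        qed
      qed
      moreover have "pathstart l = x0" "pathfinish l = pt s"
        using X0 by (simp_all add: l_def pathstart_def pathfinish_def pt_def)
      ultimately show ?thesis unfolding path_component_def by blast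
    qed
    have sep: "\<not> path_component ({z \<in> \<Omega>. u x0 \<le> u z} - {x0}) (pt s) (pt t)" if st: "s < t" "t \<le> m" for s t
    proof
      assume pc: "path_component ({z \<in> \<Omega>. u x0 \<le> u z} - {x0}) (pt s) (pt t)"
      \<comment> \<open>The separation is proved in the complex coordinates, so path, domain and
        minimum principle are carried there by \<open>Y\<close>.\<close>
      define Y where "Y = (\<lambda>x. inv \<Phi> (x - x0))"
      have YX: "Y (X z) = z" for z using \<Phi>(2) by (simp add: X_def Y_def bij_is_inj)
      have XY: "X (Y x) = x" for x using \<Phi>(2) by (simp add: X_def Y_def bij_is_surj surj_f_inv_f)
      have contY: "continuous_on T Y" for T
      proof (rule continuous_at_imp_continuous_on, rule ballI)
        fix x
        have "Y = (\<lambda>y. Y x + inv \<Phi> (y - x))"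
        proof
          fix y
          have "\<Phi> (Y x + inv \<Phi> (y - x)) = \<Phi> (Y y)"
            using \<Phi> by (simp add: Y_def linear_add bij_is_surj surj_f_inv_f)
          then show "Y y = Y x + inv \<Phi> (y - x)" using \<Phi>(2) by (metis bij_inv_eq_iff)
        qed
        moreover have "((\<lambda>y. Y x + inv \<Phi> (y - x)) \<longlongrightarrow> Y x + 0) (at x)"
          by (intro tendsto_intros tendsto_mono[OF at_within_le_nhds filterlim_inverse_affine(1)[OF \<Phi>]])
        ultimately show "isCont Y x" by (simp add: isCont_def)
      qed
      define \<Omega>' where "\<Omega>' = Y ` \<Omega>"
      have \<Omega>'_iff: "z \<in> \<Omega>' \<longleftrightarrow> X z \<in> \<Omega>" for z
        unfolding \<Omega>'_def using YX[of z, symmetric] XY by auto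
      have op: "open \<Omega>'"
      proof -
        have "\<Omega>' = X -` \<Omega>" using \<Omega>'_iff by blast
        then show ?thesis using open_domain contX[of UNIV] by (simp add: open_vimage)
      qed
      have "\<Omega> homeomorphic \<Omega>'"
        unfolding homeomorphic_def homeomorphism_def \<Omega>'_def
        by (intro exI[of _ Y] exI[of _ X]) (simp add: image_image XY YX contX contY)
      then have sc: "simply_connected \<Omega>'"
        using simply_connected_domain homeomorphic_simply_connected by blast
      have wX: "w z = u (X z) - u x0" for z by (simp add: w_def X_def)
      have cw: "continuous_on \<Omega>' w"
        unfolding wX using \<Omega>'_iff
        by (intro continuous_intros continuous_on_compose2[OF continuous_on_u contX]) auto
      have nomin: "\<not> (\<forall>\<^sub>F y in at z. w z \<le> w y)" if z: "z \<in> \<Omega>'" for z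
      proof
        assume "\<forall>\<^sub>F y in at z. w z \<le> w y"
        then have "\<forall>\<^sub>F h in at 0. w z \<le> w (h + z)" by (simp add: eventually_at_to_0[of _ z])
        then have "\<forall>\<^sub>F h in at 0. u (X z) \<le> u (X z + \<Phi> h)"
          by (rule eventually_mono) (simp add: wX X_def linear_add[OF \<Phi>(1)] add_ac)
        then have "\<forall>\<^sub>F y in at (X z). u (X z) \<le> u y"
          by (rule eventually_affine_image(1)[OF \<Phi>, of "\<lambda>y. u (X z) \<le> u y"])
        then show False using no_local_extremum(1) z \<Omega>'_iff by blast
      qed
      have "path_component ({z \<in> \<Omega>'. 0 \<le> w z} - {0}) (polar R (ang s)) (polar R (ang t))"
      proof -
        obtain p where p: "path p" "path_image p \<subseteq> {z \<in> \<Omega>. u x0 \<le> u z} - {x0}"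
          "pathstart p = pt s" "pathfinish p = pt t"
          using pc unfolding path_component_def by blast
        have "path (Y \<circ> p)" using p(1) contY by (intro path_continuous_image)
        moreover have "path_image (Y \<circ> p) \<subseteq> {z \<in> \<Omega>'. 0 \<le> w z} - {0}"
        proof
          fix z assume "z \<in> path_image (Y \<circ> p)"
          then obtain x where x: "x \<in> path_image p" "z = Y x" by (auto simp: path_image_compose)
          then have "x \<in> \<Omega>" "u x0 \<le> u x" "x \<noteq> x0" using p(2) by auto
          then show "z \<in> {z \<in> \<Omega>'. 0 \<le> w z} - {0}"
            using x(2) XY[of x] X0 by (auto simp: \<Omega>'_iff wX)
        qed
        moreover have "pathstart (Y \<circ> p) = polar R (ang s)" "pathfinish (Y \<circ> p) = polar R (ang t)"
          using p YX by (simp_all add: pathstart_compose pathfinish_compose pt_def)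
        ultimately show ?thesis unfolding path_component_def by blast
      qed
      moreover have "\<not> path_component ({z \<in> \<Omega>'. 0 \<le> w z} - {0}) (polar R (ang s)) (polar R (ang t))"
      proof (rule no_path_between_rays[OF op sc cw nomin R])
        show "cball 0 R \<subseteq> \<Omega>'" using dom \<Omega>'_iff by (auto simp: X_def)
        show "0 \<le> w 0" using X0 by (simp add: wX)
        have ang: "ang k = real (2 * k) * pi / n" for k by (simp add: ang_def mult_ac)
        \<comment> \<open>The negative ray at \<open>mid s\<close> lies between the two positive
          rays, and the one at \<open>mid t\<close> lies on their other side, before a full turn is
          completed.\<close>
        show "ang s < mid s" "mid s < ang t" "ang t < mid t"
          unfolding ang mid_def using n0 st
          by (intro divide_strict_right_mono mult_strict_right_mono; simp)+
        show "mid t < ang s + 2 * pi"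
        proof -
          have "(2 * real t + 1) * pi < (2 * real n) * pi"
            using st by (intro mult_strict_right_mono) (auto simp: n_def)
          then have "mid t < 2 * pi" using n0 by (simp add: mid_def divide_less_eq mult_ac)
          moreover have "0 \<le> ang s" by (simp add: ang_def)
          ultimately show ?thesis by simp
        qed
        show "0 \<le> w (polar r (ang s)) \<and> 0 \<le> w (polar r (ang t))" if "0 < r" "r \<le> R" for r
          using pos[OF that, of s] pos[OF that, of t] by simp
        show "w (polar r (mid s)) < 0 \<and> w (polar r (mid t)) < 0" if "0 < r" "r \<le> R" for r
          using neg[OF that, of s] neg[OF that, of t] by simp
      qed
      ultimately show False by blast
    qed
    show "\<not> path_component ({z \<in> \<Omega>. u x0 \<le> u z} - {x0}) (pt s) (pt t)" if "s \<le> m" "t \<le> m" "s \<noteq> t" for s t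
    proof (cases "s < t")
      case True
      then show ?thesis using sep that by blast
    next
      case False
      then have "t < s" using that by simp
      then show ?thesis using sep[of t s] that(1) by (blast intro: path_component_sym)
    qed
  qed
qed

end

section \<open>Counting\<close>

context dirichlet_solution
begin

text \<open>The critical points are processed by decreasing value of \<open>u\<close>. Initially each peak is its own
  class; a critical point of multiplicity \<open>m\<close> merges the \<open>m + 1\<close> classes reached from its sectors,
  which are distinct because the sectors are separated in \<open>{u \<ge> u x} - {x}\<close>. One representative
  always survives.\<close>

lemma multiplicity_sum_le:
  assumes F: "finite F" "F \<subseteq> interior_critical_points u \<Omega>"
    and mult: "\<And>x. x \<in> F \<Longrightarrow> has_crit_multiplicity u \<Omega> x (m x)"
  shows "(\<Sum>x\<in>F. m x) + 1 \<le> card peaks"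
proof -
  have "\<exists>pt. (\<forall>s. pt s \<in> \<Omega> \<and> u x < u (pt s)) \<and>
      (\<forall>s. path_component (insert x (superlevel (u x))) x (pt s)) \<and>
      (\<forall>s\<le>m x. \<forall>t\<le>m x. s \<noteq> t \<longrightarrow> \<not> path_component ({z \<in> \<Omega>. u x \<le> u z} - {x}) (pt s) (pt t))"
    if x: "x \<in> F" for x
  proof -
    have "x \<in> \<Omega>" "grad u x = 0" using x F by (auto simp: interior_critical_points_def)
    then obtain k pt where *: "has_crit_multiplicity u \<Omega> x k"
      "\<And>s. pt s \<in> \<Omega> \<and> u x < u (pt s)"
      "\<And>s. path_component (insert x (superlevel (u x))) x (pt s)"
      "\<And>s t. s \<le> k \<Longrightarrow> t \<le> k \<Longrightarrow> s \<noteq> t \<Longrightarrow> \<not> path_component ({z \<in> \<Omega>. u x \<le> u z} - {x}) (pt s) (pt t)"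
      by (rule crit_sectors) (rule that)
    have "k = m x"
      using crit_multiplicity_le[OF *(1) mult[OF x]] crit_multiplicity_le[OF mult[OF x] *(1)] by simp
    then show ?thesis using * by (intro exI[of _ pt]) simp
  qed
  then have "\<exists>pt. \<forall>x\<in>F. (\<forall>s. pt x s \<in> \<Omega> \<and> u x < u (pt x s)) \<and>
      (\<forall>s. path_component (insert x (superlevel (u x))) x (pt x s)) \<and>
      (\<forall>s\<le>m x. \<forall>t\<le>m x. s \<noteq> t \<longrightarrow> \<not> path_component ({z \<in> \<Omega>. u x \<le> u z} - {x}) (pt x s) (pt x t))"
    by (intro bchoice) blast
  then obtain pt where pt: "\<forall>x\<in>F. (\<forall>s. pt x s \<in> \<Omega> \<and> u x < u (pt x s)) \<and>
      (\<forall>s. path_component (insert x (superlevel (u x))) x (pt x s)) \<and>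
      (\<forall>s\<le>m x. \<forall>t\<le>m x. s \<noteq> t \<longrightarrow> \<not> path_component ({z \<in> \<Omega>. u x \<le> u z} - {x}) (pt x s) (pt x t))" ..
  have pt1: "pt x s \<in> \<Omega>" "u x < u (pt x s)"
    and pt2: "path_component (insert x (superlevel (u x))) x (pt x s)" if "x \<in> F" for x s
    using pt that by blast+
  have pt3: "\<not> path_component ({z \<in> \<Omega>. u x \<le> u z} - {x}) (pt x s) (pt x t)"
    if "x \<in> F" "s \<le> m x" "t \<le> m x" "s \<noteq> t" for x s t
    using pt that by blast
  have "\<exists>p. p \<in> peaks \<and> (\<forall>\<^sub>F y in nhds p. y \<in> \<Omega> \<longrightarrow> path_component (superlevel (u x)) (pt x s) y)"
    if "x \<in> F" for x s
    using superlevel_reaches_peak[OF pt1[OF that]] by blast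
  then have "\<exists>p. \<forall>x\<in>F. \<forall>s. p x s \<in> peaks \<and>
      (\<forall>\<^sub>F y in nhds (p x s). y \<in> \<Omega> \<longrightarrow> path_component (superlevel (u x)) (pt x s) y)"
    by (intro bchoice ballI choice allI) blast
  then obtain p where p: "\<forall>x\<in>F. \<forall>s. p x s \<in> peaks \<and>
      (\<forall>\<^sub>F y in nhds (p x s). y \<in> \<Omega> \<longrightarrow> path_component (superlevel (u x)) (pt x s) y)" ..
  \<comment> \<open>Finitely many components reach the peak \<open>q\<close>, each containing all
    points of \<open>\<Omega>\<close> close to \<open>q\<close>, so one such point can represent
    \<open>q\<close> for all of them.\<close>
  have "\<exists>y. \<forall>x\<in>F. \<forall>s\<le>m x. p x s = q \<longrightarrow> path_component (superlevel (u x)) (pt x s) y"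
    if q: "q \<in> peaks" for q
  proof -
    have "\<forall>\<^sub>F y in nhds q. \<forall>x\<in>F. \<forall>s\<in>{..m x}. p x s = q \<longrightarrow> y \<in> \<Omega> \<longrightarrow>
        path_component (superlevel (u x)) (pt x s) y"
      using F(1) p by (intro eventually_ball_finite ballI finite_atMost) auto
    then obtain T where T: "open T" "q \<in> T" "\<And>y. y \<in> T \<Longrightarrow> \<forall>x\<in>F. \<forall>s\<in>{..m x}. p x s = q \<longrightarrow> y \<in> \<Omega> \<longrightarrow>
        path_component (superlevel (u x)) (pt x s) y"
      unfolding eventually_nhds by blast
    have "q \<in> closure \<Omega>" using q by (auto simp: local_max_points_def frontier_def)
    then obtain y where "y \<in> \<Omega>" "y \<in> T"
      using T(1,2) closure_iff_nhds_not_empty[of q \<Omega>] by blast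
    then show ?thesis using T(3) by (intro exI[of _ y]) auto
  qed
  then have "\<exists>yy. \<forall>q\<in>peaks. \<forall>x\<in>F. \<forall>s\<le>m x. p x s = q \<longrightarrow> path_component (superlevel (u x)) (pt x s) (yy q)"
    by (intro bchoice) blast
  then obtain yy where yy: "\<forall>q\<in>peaks. \<forall>x\<in>F. \<forall>s\<le>m x. p x s = q \<longrightarrow>
      path_component (superlevel (u x)) (pt x s) (yy q)" ..
  have peak: "p x s \<in> peaks" and reach: "s \<le> m x \<Longrightarrow> path_component (superlevel (u x)) (pt x s) (yy (p x s))"
    if "x \<in> F" for x s
    using p yy that by blast+
  \<comment> \<open>The region available to paths once \<open>E\<close> has been processed:
    everything at least as high as some point of \<open>E\<close>, except the points of
    \<open>F\<close> still waiting.\<close>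
  define link where "link = (\<lambda>E. {z \<in> \<Omega>. \<exists>y\<in>E. u y \<le> u z} - (F - E))"
  \<comment> \<open>\<open>E\<close> ranges over the upper parts of \<open>F\<close>; ties may be
    broken in any way, as the comparisons are weak. \<open>P\<close> holds the surviving
    representatives.\<close>
  have main: "\<exists>P. P \<subseteq> peaks \<and> P \<noteq> {} \<and> card P + (\<Sum>x\<in>E. m x) \<le> card peaks \<and>
       (\<forall>q\<in>peaks. \<exists>r\<in>P. q = r \<or> path_component (link E) (yy q) (yy r))"
    if "E \<subseteq> F" "\<forall>x\<in>E. \<forall>y\<in>F - E. u y \<le> u x" for E
    using finite_subset[OF that(1) F(1)] that
  proof (induction "card E" arbitrary: E)
    case 0
    then have "E = {}" by simp
    then show ?case using peaks_nonempty by (intro exI[of _ peaks]) auto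
  next
    case (Suc k)
    then have "E \<noteq> {}" by auto
    \<comment> \<open>A lowest point of \<open>E\<close> is the one processed last.\<close>
    obtain x where x: "x \<in> E" "\<And>y. y \<in> E \<Longrightarrow> u x \<le> u y"
      using ex_is_arg_min_if_finite[OF Suc.prems(1) \<open>E \<noteq> {}\<close>, of u]
      by (auto simp: is_arg_min_linorder)
    define E' where "E' = E - {x}"
    have xF: "x \<in> F" using x Suc.prems by blast
    have below: "u y \<le> u x" if "y \<in> F - E" for y using Suc.prems(3) x(1) that by blast
    have "\<exists>P. P \<subseteq> peaks \<and> P \<noteq> {} \<and> card P + (\<Sum>x\<in>E'. m x) \<le> card peaks \<and>
       (\<forall>q\<in>peaks. \<exists>r\<in>P. q = r \<or> path_component (link E') (yy q) (yy r))"
    proof (rule Suc.hyps(1))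
      show "k = card E'" using Suc.hyps(2) Suc.prems(1) x(1) by (simp add: E'_def)
      show "finite E'" "E' \<subseteq> F" using Suc.prems by (auto simp: E'_def)
      show "\<forall>z\<in>E'. \<forall>y\<in>F - E'. u y \<le> u z"
        using Suc.prems(3) x by (auto simp: E'_def)
    qed
    then obtain P where P: "P \<subseteq> peaks" "P \<noteq> {}" "card P + (\<Sum>x\<in>E'. m x) \<le> card peaks"
      and rep: "\<forall>q\<in>peaks. \<exists>r\<in>P. q = r \<or> path_component (link E') (yy q) (yy r)" by blast
    from bchoice[OF rep[unfolded Bex_def]]
    obtain \<pi> where \<pi>: "\<forall>q\<in>peaks. \<pi> q \<in> P \<and> (q = \<pi> q \<or> path_component (link E') (yy q) (yy (\<pi> q)))" ..
    have finP: "finite P" using P(1) finite_maxima finite_subset by blast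
    \<comment> \<open>Relative to \<open>E'\<close> the point \<open>x\<close> is still waiting, so
      paths for \<open>E'\<close> avoid it, and they stay at heights at least \<open>u x\<close>:
      they run in the region where the sectors of \<open>x\<close> are separated.\<close>
    have link_above: "link E' \<subseteq> {z \<in> \<Omega>. u x \<le> u z} - {x}"
      using x xF by (fastforce simp: link_def E'_def)
    have link_mono: "link E' \<subseteq> link E" by (auto simp: link_def E'_def)
    \<comment> \<open>Waiting points have height at most \<open>u x\<close>, so the strict
      superlevel set contains none of them.\<close>
    have super_link: "superlevel (u x) \<subseteq> link E"
      using x(1) below by (fastforce simp: link_def)
    have x_link: "x \<in> link E" using x(1) xF F(2) by (auto simp: link_def interior_critical_points_def)
    define r where "r = (\<lambda>s. \<pi> (p x s))"
    have rP: "r s \<in> P" for s using \<pi> peak[OF xF] by (simp add: r_def)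
    have to_r: "path_component S (pt x s) (yy (r s))"
      if "s \<le> m x" "superlevel (u x) \<subseteq> S" "link E' \<subseteq> S" for s S
    proof -
      have 1: "path_component S (pt x s) (yy (p x s))"
        using reach[OF xF that(1)] that(2) by (rule path_component_of_subset[rotated])
      have "p x s = r s \<or> path_component (link E') (yy (p x s)) (yy (r s))"
        using \<pi> peak[OF xF] by (simp add: r_def)
      then show ?thesis
      proof
        assume "path_component (link E') (yy (p x s)) (yy (r s))"
        with that(3) have "path_component S (yy (p x s)) (yy (r s))"
          by (rule path_component_of_subset)
        with 1 show ?thesis by (rule path_component_trans)
      qed (use 1 in simp)
    qed
    \<comment> \<open>A shared representative would join two sectors of \<open>x\<close> by a path
      that avoids \<open>x\<close>.\<close>
    have r_inj: "inj_on r {..m x}"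
    proof (rule inj_onI, rule ccontr)
      fix s t assume st: "s \<in> {..m x}" "t \<in> {..m x}" "r s = r t" "s \<noteq> t"
      let ?S = "{z \<in> \<Omega>. u x \<le> u z} - {x}"
      have sup: "superlevel (u x) \<subseteq> ?S" by auto
      have s: "path_component ?S (pt x s) (yy (r s))" and t: "path_component ?S (pt x t) (yy (r t))"
        using st(1,2) by (auto intro!: to_r[OF _ sup link_above])
      have "path_component ?S (pt x s) (pt x t)"
        using s path_component_sym[OF t] unfolding st(3) by (rule path_component_trans)
      then show False using pt3[OF xF] st by auto
    qed
    have x_r: "path_component (link E) x (yy (r s))" if "s \<le> m x" for s
    proof -
      have "path_component (link E) x (pt x s)"
      proof (rule path_component_of_subset)
        show "insert x (superlevel (u x)) \<subseteq> link E" using super_link x_link by simp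
        show "path_component (insert x (superlevel (u x))) x (pt x s)" by (rule pt2[OF xF])
      qed
      then show ?thesis using to_r[OF that super_link link_mono] by (rule path_component_trans)
    qed
    \<comment> \<open>The \<open>m x + 1\<close> classes joined at \<open>x\<close> keep
      \<open>r 0\<close> as their representative; the other \<open>m x\<close> representatives,
      distinct by injectivity, are dropped.\<close>
    define P' where "P' = P - r ` {1..m x}"
    have "r 0 \<notin> r ` {1..m x}" using inj_onD[OF r_inj, of 0] by fastforce
    then have r0: "r 0 \<in> P'" using rP by (simp add: P'_def)
    have "card (r ` {1..m x}) = m x"
      using card_image[OF inj_on_subset[OF r_inj, of "{1..m x}"]] by fastforce
    moreover have "r ` {1..m x} \<subseteq> P" using rP by blast
    ultimately have "card P' + m x = card P"
      using finP card_Diff_subset[of "r ` {1..m x}" P] card_mono[of P "r ` {1..m x}"]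
      by (simp add: P'_def)
    moreover have "(\<Sum>x\<in>E. m x) = m x + (\<Sum>x\<in>E'. m x)"
      unfolding E'_def using Suc.prems(1) x(1) by (rule sum.remove)
    ultimately have "card P' + (\<Sum>x\<in>E. m x) \<le> card peaks" using P(3) by simp
    moreover have "\<exists>t\<in>P'. q = t \<or> path_component (link E) (yy q) (yy t)" if q: "q \<in> peaks" for q
    proof -
      have step: "q = \<pi> q \<or> path_component (link E) (yy q) (yy (\<pi> q))" and "\<pi> q \<in> P"
        using \<pi> q path_component_of_subset[OF link_mono] by blast+
      show ?thesis
      proof (cases "\<pi> q \<in> P'")
        case True
        then show ?thesis using step by (intro bexI[of _ "\<pi> q"]) auto
      next
        case False
        then obtain s where s: "s \<le> m x" "\<pi> q = r s" using \<open>\<pi> q \<in> P\<close> by (auto simp: P'_def)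
        have "path_component (link E) (yy (r s)) (yy (r 0))"
          using path_component_trans[OF path_component_sym[OF x_r[OF s(1)]] x_r[of 0]] by simp
        then have "path_component (link E) (yy q) (yy (r 0))"
          using step path_component_trans unfolding s(2) by metis
        then show ?thesis using r0 by blast
      qed
    qed
    moreover have "P' \<subseteq> peaks" using P(1) by (auto simp: P'_def)
    ultimately show ?case using r0 by (intro exI[of _ P']) blast
  qed
  obtain P where P: "P \<subseteq> peaks" "P \<noteq> {}" "card P + (\<Sum>x\<in>F. m x) \<le> card peaks"
    using main[of F] by auto
  have "finite P" using P(1) finite_maxima finite_subset by blast
  then have "1 \<le> card P" using P(2) by (simp add: Suc_le_eq card_gt_0_iff)
  then show ?thesis using P(3) by simp
qed

lemma ex1_crit_multiplicity:
  assumes "x \<in> interior_critical_points u \<Omega>"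
  shows "\<exists>!k. has_crit_multiplicity u \<Omega> x k"
proof -
  have "x \<in> \<Omega>" "grad u x = 0" using assms by (auto simp: interior_critical_points_def)
  then obtain k where "has_crit_multiplicity u \<Omega> x k" by (rule crit_sectors)
  then show ?thesis using crit_multiplicity_le le_antisym by metis
qed

lemma crit_multiplicity:
  assumes "x \<in> interior_critical_points u \<Omega>"
  shows "has_crit_multiplicity u \<Omega> x (crit_multiplicity u \<Omega> x)"
  unfolding crit_multiplicity_def by (rule theI'[OF ex1_crit_multiplicity[OF assms]])

lemma sum_crit_multiplicity_le:
  assumes "finite F" "F \<subseteq> interior_critical_points u \<Omega>"
  shows "(\<Sum>x\<in>F. crit_multiplicity u \<Omega> x) + 1 \<le> card peaks"
  using assms by (intro multiplicity_sum_le crit_multiplicity) auto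

text \<open>Every multiplicity is at least 1, so a finite set of as many critical points as there
  are peaks would already violate the inequality.\<close>

lemma finite_critical_points: "finite (interior_critical_points u \<Omega>)"
proof (rule ccontr)
  assume "infinite (interior_critical_points u \<Omega>)"
  then obtain F where F: "finite F" "card F = card peaks" "F \<subseteq> interior_critical_points u \<Omega>"
    using infinite_arbitrarily_large by blast
  have "card F \<le> (\<Sum>x\<in>F. crit_multiplicity u \<Omega> x)"
  proof -
    have "1 \<le> crit_multiplicity u \<Omega> x" if "x \<in> F" for x
      using crit_multiplicity[of x] F(3) that by (auto simp: has_crit_multiplicity_def)
    then have "(\<Sum>x\<in>F. 1) \<le> (\<Sum>x\<in>F. crit_multiplicity u \<Omega> x)" by (rule sum_mono)
    then show ?thesis by simp
  qed
  then show False using sum_crit_multiplicity_le[OF F(1,3)] F(2) by simp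
qed

end

theorem theorem1p1:
  fixes \<Omega> :: "(real^2) set"
    and \<psi> u :: "real^2 \<Rightarrow> real"
    and a :: "2 \<Rightarrow> 2 \<Rightarrow> real^2 \<Rightarrow> real"
    and N :: nat
  assumes "open \<Omega>" and "connected \<Omega>" and "\<Omega> \<noteq> {}"
    and "bounded \<Omega>" and "smooth_boundary \<Omega>" and "simply_connected \<Omega>"
    and "C1_closure \<psi> \<Omega>"
    and "finite (local_max_points \<psi> (frontier \<Omega>))"
    and "card (local_max_points \<psi> (frontier \<Omega>)) = N"
    and "\<And>i j. smooth_fun_on (a i j) UNIV"
    and "uniformly_elliptic a u \<Omega>"
    and "classical_solution a \<psi> \<Omega> u"
    and "\<not> u constant_on \<Omega>"
  shows "finite (interior_critical_points u \<Omega>) \<and>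
    (\<forall>x\<in>interior_critical_points u \<Omega>. \<exists>!m. has_crit_multiplicity u \<Omega> x m) \<and>
    (\<Sum>x\<in>interior_critical_points u \<Omega>. crit_multiplicity u \<Omega> x) + 1 \<le> N"
proof -
  interpret dirichlet_solution \<Omega> u a \<psi>
    using assms by unfold_locales (auto simp: classical_solution_def)
  show ?thesis
    using finite_critical_points ex1_crit_multiplicity
      sum_crit_multiplicity_le[OF finite_critical_points] assms(9) by auto
qed

end
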